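(* Let $\Omega_*$ be a surgery theory on a subcategory $\mathcal{Z}^t(\mathcal{T})$ of $\mathcal{Z}^t(Top)$, and let $G$ be a group and $\omega\in H^1(BG;\mathbb{Z}/2\mathbb{Z})$ be such that $(BG,\Lambda_\omega)$ is an object of $\mathcal{Z}^t(\mathcal{T})$. Let $g\in G$ and let $c_g\colon G\to G$ be the inner automorphism $c_g(h)=g^{-1}hg$. Then $$\Omega_*\bigl(\mathbf{B}(c_g,\omega)\bigr)\colon\Omega_*(BG,\Lambda_\omega)\to\Omega_*(BG,\Lambda_\omega)$$ is the identity if $\omega(g)=+1$ and is $\Omega_*(1_{BG},-1_{\Lambda_\omega})$ if $\omega(g)=-1$. If $\Omega_*$ preserves the involution, then $\Omega_*\bigl(\mathbf{B}(c_g,\omega)\bigr)$ is minus the identity if $\omega(g)=-1$.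
   Context: **Systems.** $\Pi(X)$ denotes the path (fundamental) groupoid of a space $X$: paths $\lambda$ up to homotopy rel endpoints, composed by concatenation. A $\mathbb{Z}^t$-system on $X$ is a homomorphism of groupoids $\Lambda\colon\Pi(X)\to\{\pm1\}$. A map $\zeta\colon\Lambda_0\to\Lambda_1$ of $\mathbb{Z}^t$-systems on $X$ is a function $\zeta\colon X\to\{\pm1\}$ with $\Lambda_0(\lambda)\Lambda_1(\lambda)=\zeta(\lambda(0))\zeta(\lambda(1))$ for every $\lambda\in\Pi(X)$; maps compose by pointwise multiplication, $1_\Lambda$ (constant $+1$) is the identity map of $\Lambda$, and $-\zeta$ is again a map. For continuous $f\colon X\to Y$, $f^*(\Lambda)(\lambda)=\Lambda(f\circ\lambda)$ and $f^*(\zeta)=\zeta\circ f$. The twist $\omega(\Lambda)\in H^1(X;\mathbb{Z}/2\mathbb{Z})\cong\mathrm{Hom}(H_1(X;\mathbb{Z}/2\mathbb{Z}),\{\pm1\})$ is the class whose value on a loop $L$ is $\Lambda(L)$. An element $\mathfrak{c}\in H^0(X;\mathbb{Z}/2\mathbb{Z})$ is regarded as a function $X\to\{\pm1\}$ constant on path components, and $(\mathfrak{c}\bullet\zeta)(x)=\mathfrak{c}(x)\zeta(x)$; any two maps between the same two systems differ by such a $\mathfrak{c}$. **The category $\mathcal{Z}^t(Top)$.** Objects: pairs $(X,\Lambda_X)$ with $X$ a space and $\Lambda_X$ a $\mathbb{Z}^t$-system on $X$. Morphisms $(X_0,\Lambda_{X_0})\to(X_1,\Lambda_{X_1})$: pairs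 $(f,\zeta)$ with $f\colon X_0\to X_1$ continuous and $\zeta\colon\Lambda_{X_0}\to f^*(\Lambda_{X_1})$ a map of systems. Composition: $(g,\psi)\circ(f,\zeta)=(g\circ f,f^*(\psi)\circ\zeta)$. The identity of $(X,\Lambda)$ is $(1_X,1_\Lambda)$. It has an involution which is the identity on objects and sends $(f,\zeta)$ to $(f,-\zeta)$. **Having homotopies.** Let $\theta_{[0,1]}$ be the trivial system (constant $+1$) on $[0,1]$, and let $\Lambda\bullet\theta_{[0,1]}$ be the system on $X\times[0,1]$ with $(\Lambda\bullet\theta_{[0,1]})(\lambda_0\times\lambda_1)=\Lambda(\lambda_0)$, that is, $r^*(\Lambda)$ for the projection $r\colon X\times[0,1]\to X$. Let $\iota_i\colon X\to X\times[0,1]$, $\iota_i(x)=(x,i)$. A subcategory $\mathcal{Z}^t(\mathcal{T})$ of $\mathcal{Z}^t(Top)$ has homotopies if: (1) whenever $(X,\Lambda)$ is an object, so is $(X\times[0,1],\Lambda\bullet\theta_{[0,1]})$; (2) the morphisms $(\iota_i,1_\Lambda)\colon(X,\Lambda)\to(X\times[0,1],\Lambda\bullet\theta_{[0,1]})$, $i=0,1$, are in $\mathcal{Z}^t(\mathcal{T})$; (3) if $(f_i,\zeta_i)\colon(X,\Lambda_X)\to(Y,\Lambda_Y)$, $i=0,1$, are two maps in $\mathcal{Z}^t(\mathcal{T})$ whose $f_i$ are homotopic, then for any homotopy $F\colon X\times[0,1]\to Y$ from $f_0$ to $f_1$ there is a map $\zeta_F\colon\Lambda_X\bullet\theta_{[0,1]}\to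 F^*(\Lambda_Y)$ such that $(F,\zeta_F)$ is a map in $\mathcal{Z}^t(\mathcal{T})$ and $(F,\zeta_F)\circ(\iota_0,1_{\Lambda_X})=(f_0,\zeta_0)$; (4) if $(f,\zeta_i)\colon(X,\Lambda_X)\to(Y,\Lambda_Y)$, $i=0,1$, are two morphisms with the same $f$, so that there is $\mathfrak{c}\in H^0(X;\mathbb{Z}/2\mathbb{Z})$ with $\zeta_0=\mathfrak{c}\bullet\zeta_1$, then $(1_X,\mathfrak{c}\bullet1_{\Lambda_X})$ is a map in $\mathcal{Z}^t(\mathcal{T})$. **Homotopy functors.** A functor $\Omega_*$ on $\mathcal{Z}^t(\mathcal{T})$ is a homotopy functor if $\mathcal{Z}^t(\mathcal{T})$ has homotopies and, for every object $(X,\Lambda)$, $\Omega_*(\iota_0,1_\Lambda)\circ\Omega_*(r,1_{\Lambda\bullet\theta_{[0,1]}})$ is the identity of $\Omega_*(X\times[0,1],\Lambda\bullet\theta_{[0,1]})$. If $\Omega_*$ takes values in an additive category, it preserves the involution if $\Omega_*(f,-\zeta)=-\Omega_*(f,\zeta)$ whenever both $(f,\pm\zeta)$ are in $\mathcal{Z}^t(\mathcal{T})$. **Classifying spaces.** For a group $G$, $BG$ is Segal's classifying space of $G$ regarded as a category with one object (the geometric realization of its nerve): it has one $0$-simplex, the base point, and $k$-simplices for $k>0$ given by sequences of $k$ group elements. Each $x\in BG$ lies in the interior of a unique (nondegenerate) simplex; let $s_G(x)\in\Pi(BG)$ be the straight line path from $x$ to the initial vertex of that simplex, which is the base point. Given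 $\omega\in H^1(BG;\mathbb{Z}/2\mathbb{Z})$, $\Lambda_\omega$ is the unique $\mathbb{Z}^t$-system on $BG$ with twist $\omega$ and $\Lambda_\omega(s_G(x))=1$ for all $x\in BG$. For $g\in G$, $\omega(g)\in\{\pm1\}$ is the value of $\omega$ on the loop in $BG$ given by the $1$-simplex $g$. For a homomorphism $\psi\colon H\to G$, with induced map $B\psi\colon BH\to BG$, one has $(B\psi)^*(\Lambda_\omega)=\Lambda_{(B\psi)^*(\omega)}$, and $\mathbf{B}(\psi,\omega)$ denotes the morphism $(B\psi,1_{\Lambda_{(B\psi)^*(\omega)}})\colon(BH,\Lambda_{(B\psi)^*(\omega)})\to(BG,\Lambda_\omega)$ of $\mathcal{Z}^t(Top)$. For $\psi=c_g$, $(Bc_g)^*(\omega)=\omega$. **Surgery theories.** A surgery theory is a homotopy functor $\Omega_*$ on a subcategory $\mathcal{Z}^t(\mathcal{T})$ of $\mathcal{Z}^t(Top)$ with the following closure property: whenever $(K,\Lambda)$ is an object of $\mathcal{Z}^t(\mathcal{T})$ with $K$ path-connected, then for any $u\colon K\to B\pi_1(K)$ inducing an isomorphism on $\pi_1$, the pair $(B\pi_1(K),\Lambda_{(u^* )^{-1}(\omega(\Lambda))})$ is an object of $\mathcal{Z}^t(\mathcal{T})$, and for at least one map $\zeta\colon\Lambda\to u^*(\Lambda_{(u^* )^{-1}(\omega(\Lambda))})$ the pair $(u,\zeta)$ is a map in $\mathcal{Z}^t(\mathcal{T})$.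
   Formalization: For ω(g)=−1 the claims are made provided B(c_g,ω) or (1_BG,−1) is a morphism of Z^t(T) (the other then is too), as otherwise neither side need be defined; π₁(K) in the closure property is read up to isomorphism. *)

theory Defs
  imports "HOL-Homology.Homology"
begin

section \<open>Topological preliminaries\<close>

abbreviation unit_interval :: "real topology" where
  "unit_interval \<equiv> top_of_set {0..1}"

definition quot_topology :: "'a topology \<Rightarrow> ('a \<Rightarrow> 'b) \<Rightarrow> 'b topology" where
  "quot_topology X q =
     topology (\<lambda>U. U \<subseteq> q ` topspace X \<and> openin X {x \<in> topspace X. q x \<in> U})"

lemma istopology_quot:
  "istopology (\<lambda>U. U \<subseteq> q ` topspace X \<and> openin X {x \<in> topspace X. q x \<in> U})"
proof -
  have "openin X {x \<in> topspace X. q x \<in> S \<inter> T}"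
    if "openin X {x \<in> topspace X. q x \<in> S}" "openin X {x \<in> topspace X. q x \<in> T}" for S T
  proof -
    have "{x \<in> topspace X. q x \<in> S \<inter> T}
        = {x \<in> topspace X. q x \<in> S} \<inter> {x \<in> topspace X. q x \<in> T}" by auto
    then show ?thesis using that by auto
  qed
  moreover have "openin X {x \<in> topspace X. q x \<in> \<Union>\<K>}"
    if "\<forall>K\<in>\<K>. openin X {x \<in> topspace X. q x \<in> K}" for \<K>
  proof -
    have "{x \<in> topspace X. q x \<in> \<Union>\<K>} = (\<Union>K\<in>\<K>. {x \<in> topspace X. q x \<in> K})" by auto
    then show ?thesis using that by auto
  qed
  ultimately show ?thesis unfolding istopology_def by blast
qed

lemma openin_quot_topology:
  "openin (quot_topology X q) U \<longleftrightarrow>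
     U \<subseteq> q ` topspace X \<and> openin X {x \<in> topspace X. q x \<in> U}"
  by (simp add: quot_topology_def topology_inverse'[OF istopology_quot])


section \<open>The fundamental groupoid\<close>

text \<open>\<open>path_class X p\<close> is the class of the path \<open>p\<close> modulo homotopy rel endpoints. Paths are
  total functions on the reals of which only the restriction to the unit interval matters.\<close>

definition path_class :: "'a topology \<Rightarrow> (real \<Rightarrow> 'a) \<Rightarrow> (real \<Rightarrow> 'a) set" where
  "path_class X p =
     {q. homotopic_with (\<lambda>r. r 0 = p 0 \<and> r 1 = p 1) unit_interval X p q}"

definition path_groupoid :: "'a topology \<Rightarrow> (real \<Rightarrow> 'a) set set" where
  "path_groupoid X = path_class X ` {p. pathin X p}"

definition path_concat :: "(real \<Rightarrow> 'a) \<Rightarrow> (real \<Rightarrow> 'a) \<Rightarrow> real \<Rightarrow> 'a" where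
  "path_concat p q = (\<lambda>t. if t \<le> 1/2 then p (2 * t) else q (2 * t - 1))"

definition class_concat ::
  "'a topology \<Rightarrow> (real \<Rightarrow> 'a) set \<Rightarrow> (real \<Rightarrow> 'a) set \<Rightarrow> (real \<Rightarrow> 'a) set" where
  "class_concat X a b = (\<Union>p\<in>a. \<Union>q\<in>b. path_class X (path_concat p q))"

definition class_map :: "'b topology \<Rightarrow> ('a \<Rightarrow> 'b) \<Rightarrow> (real \<Rightarrow> 'a) set \<Rightarrow> (real \<Rightarrow> 'b) set" where
  "class_map Y f a = (\<Union>p\<in>a. path_class Y (f \<circ> p))"

definition fundamental_group :: "'a topology \<Rightarrow> 'a \<Rightarrow> (real \<Rightarrow> 'a) set monoid" where
  "fundamental_group X x =
     \<lparr>carrier = path_class X ` {p. pathin X p \<and> p 0 = x \<and> p 1 = x},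
      mult = class_concat X,
      one = path_class X (\<lambda>_. x)\<rparr>"

definition induces_pi1_iso :: "'a topology \<Rightarrow> 'b topology \<Rightarrow> ('a \<Rightarrow> 'b) \<Rightarrow> bool" where
  "induces_pi1_iso X Y f \<longleftrightarrow>
     (\<forall>x\<in>topspace X.
        class_map Y f \<in> iso (fundamental_group X x) (fundamental_group Y (f x)))"


section \<open>Systems\<close>

text \<open>The group \<open>\<int>/2\<close> is written multiplicatively, as \<open>{1, -1}\<close>, throughout. Functions out of
  spaces, path groupoids and so on are taken extensional, so that their equality in HOL is
  equality of functions in the mathematical sense.\<close>

type_synonym 'a sys = "(real \<Rightarrow> 'a) set \<Rightarrow> int"

definition Zt_system :: "'a topology \<Rightarrow> 'a sys \<Rightarrow> bool" where
  "Zt_system X \<Lambda> \<longleftrightarrow>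
     \<Lambda> \<in> path_groupoid X \<rightarrow>\<^sub>E {1, -1} \<and>
     (\<forall>p q. pathin X p \<longrightarrow> pathin X q \<longrightarrow> p 1 = q 0 \<longrightarrow>
        \<Lambda> (class_concat X (path_class X p) (path_class X q))
          = \<Lambda> (path_class X p) * \<Lambda> (path_class X q))"

definition system_map :: "'a topology \<Rightarrow> 'a sys \<Rightarrow> 'a sys \<Rightarrow> ('a \<Rightarrow> int) \<Rightarrow> bool" where
  "system_map X \<Lambda>0 \<Lambda>1 \<zeta> \<longleftrightarrow>
     \<zeta> \<in> topspace X \<rightarrow>\<^sub>E {1, -1} \<and>
     (\<forall>p. pathin X p \<longrightarrow>
        \<Lambda>0 (path_class X p) * \<Lambda>1 (path_class X p) = \<zeta> (p 0) * \<zeta> (p 1))"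

definition sys_pullback :: "'a topology \<Rightarrow> 'b topology \<Rightarrow> ('a \<Rightarrow> 'b) \<Rightarrow> 'b sys \<Rightarrow> 'a sys" where
  "sys_pullback X Y f \<Lambda> = (\<lambda>a\<in>path_groupoid X. \<Lambda> (class_map Y f a))"

definition one_map :: "'a topology \<Rightarrow> 'a \<Rightarrow> int" where
  "one_map X = (\<lambda>x\<in>topspace X. 1)"

definition neg_map :: "'a topology \<Rightarrow> ('a \<Rightarrow> int) \<Rightarrow> 'a \<Rightarrow> int" where
  "neg_map X \<zeta> = (\<lambda>x\<in>topspace X. - \<zeta> x)"

text \<open>\<open>H\<^sup>0(X; \<int>/2)\<close>, regarded as the functions constant on path components.\<close>

definition H0 :: "'a topology \<Rightarrow> ('a \<Rightarrow> int) set" where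
  "H0 X = {c \<in> topspace X \<rightarrow>\<^sub>E {1, -1}. \<forall>p. pathin X p \<longrightarrow> c (p 0) = c (p 1)}"

definition H0_act :: "'a topology \<Rightarrow> ('a \<Rightarrow> int) \<Rightarrow> ('a \<Rightarrow> int) \<Rightarrow> 'a \<Rightarrow> int" where
  "H0_act X c \<zeta> = (\<lambda>x\<in>topspace X. c x * \<zeta> x)"


section \<open>Singular cohomology with coefficients in \<open>\<int>/2\<close>\<close>

type_synonym 'a cochain = "((nat \<Rightarrow> real) \<Rightarrow> 'a) \<Rightarrow> int"

definition cochains :: "nat \<Rightarrow> 'a topology \<Rightarrow> 'a cochain set" where
  "cochains p X = singular_simplex_set p X \<rightarrow>\<^sub>E {1, -1}"

definition coboundary :: "nat \<Rightarrow> 'a topology \<Rightarrow> 'a cochain \<Rightarrow> 'a cochain" where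
  "coboundary p X c =
     (\<lambda>\<sigma>\<in>singular_simplex_set (Suc p) X. \<Prod>k\<le>Suc p. c (singular_face (Suc p) k \<sigma>))"

definition cocycles :: "nat \<Rightarrow> 'a topology \<Rightarrow> 'a cochain set" where
  "cocycles p X =
     {c \<in> cochains p X. \<forall>\<sigma>. singular_simplex (Suc p) X \<sigma> \<longrightarrow> coboundary p X c \<sigma> = 1}"

fun coboundaries :: "nat \<Rightarrow> 'a topology \<Rightarrow> 'a cochain set" where
  "coboundaries 0 X = {\<lambda>\<sigma>\<in>singular_simplex_set 0 X. 1}"
| "coboundaries (Suc p) X = coboundary p X ` cochains p X"

definition cohomology_class :: "nat \<Rightarrow> 'a topology \<Rightarrow> 'a cochain \<Rightarrow> 'a cochain set" where
  "cohomology_class p X c =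
     (\<lambda>b. \<lambda>\<sigma>\<in>singular_simplex_set p X. c \<sigma> * b \<sigma>) ` coboundaries p X"

definition cohomology :: "nat \<Rightarrow> 'a topology \<Rightarrow> 'a cochain set set" where
  "cohomology p X = cohomology_class p X ` cocycles p X"

definition cohomology_pullback ::
  "nat \<Rightarrow> 'a topology \<Rightarrow> ('a \<Rightarrow> 'b) \<Rightarrow> 'b cochain set \<Rightarrow> 'a cochain set" where
  "cohomology_pullback p X f w =
     (\<Union>c\<in>w. cohomology_class p X (\<lambda>\<sigma>\<in>singular_simplex_set p X. c (simplex_map p f \<sigma>)))"

abbreviation H1 :: "'a topology \<Rightarrow> 'a cochain set set" where
  "H1 \<equiv> cohomology 1"

definition path_simplex :: "(real \<Rightarrow> 'a) \<Rightarrow> (nat \<Rightarrow> real) \<Rightarrow> 'a" where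
  "path_simplex L = (\<lambda>s\<in>standard_simplex 1. L (s 1))"

text \<open>The value of a one-dimensional class on a loop, which does not depend on the cocycle.\<close>

definition loop_value :: "'a cochain set \<Rightarrow> (real \<Rightarrow> 'a) \<Rightarrow> int" where
  "loop_value w L = (THE v. \<forall>c\<in>w. c (path_simplex L) = v)"

definition twist :: "'a topology \<Rightarrow> 'a sys \<Rightarrow> 'a cochain set" where
  "twist X \<Lambda> =
     (THE w. w \<in> H1 X \<and>
        (\<forall>L. pathin X L \<longrightarrow> L 0 = L 1 \<longrightarrow> loop_value w L = \<Lambda> (path_class X L)))"


section \<open>Categories\<close>

record ('o, 'm) category =
  Obj :: "'o set"
  Arr :: "'m set"
  Dom :: "'m \<Rightarrow> 'o"
  Cod :: "'m \<Rightarrow> 'o"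
  Ident :: "'o \<Rightarrow> 'm"
  Comp :: "'m \<Rightarrow> 'm \<Rightarrow> 'm"

text \<open>\<open>Comp C g f\<close> is \<open>g\<close> after \<open>f\<close>.\<close>

definition Homs :: "('o, 'm) category \<Rightarrow> 'o \<Rightarrow> 'o \<Rightarrow> 'm set" where
  "Homs C a b = {f \<in> Arr C. Dom C f = a \<and> Cod C f = b}"

definition is_category :: "('o, 'm) category \<Rightarrow> bool" where
  "is_category C \<longleftrightarrow>
     (\<forall>f\<in>Arr C. Dom C f \<in> Obj C \<and> Cod C f \<in> Obj C) \<and>
     (\<forall>a\<in>Obj C. Ident C a \<in> Homs C a a) \<and>
     (\<forall>f\<in>Arr C. \<forall>g\<in>Arr C. Dom C g = Cod C f \<longrightarrow>
        Comp C g f \<in> Homs C (Dom C f) (Cod C g)) \<and>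
     (\<forall>f\<in>Arr C. Comp C f (Ident C (Dom C f)) = f \<and> Comp C (Ident C (Cod C f)) f = f) \<and>
     (\<forall>f\<in>Arr C. \<forall>g\<in>Arr C. \<forall>h\<in>Arr C. Dom C g = Cod C f \<longrightarrow> Dom C h = Cod C g \<longrightarrow>
        Comp C h (Comp C g f) = Comp C (Comp C h g) f)"

definition subcategory :: "('o, 'm) category \<Rightarrow> ('o, 'm) category \<Rightarrow> bool" where
  "subcategory S C \<longleftrightarrow>
     Obj S \<subseteq> Obj C \<and> Arr S \<subseteq> Arr C \<and>
     Dom S = Dom C \<and> Cod S = Cod C \<and> Ident S = Ident C \<and> Comp S = Comp C \<and>
     (\<forall>f\<in>Arr S. Dom S f \<in> Obj S \<and> Cod S f \<in> Obj S) \<and>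
     (\<forall>a\<in>Obj S. Ident S a \<in> Arr S) \<and>
     (\<forall>f\<in>Arr S. \<forall>g\<in>Arr S. Dom S g = Cod S f \<longrightarrow> Comp S g f \<in> Arr S)"

definition is_functor ::
  "('o, 'm) category \<Rightarrow> ('o2, 'm2) category \<Rightarrow> ('o \<Rightarrow> 'o2) \<Rightarrow> ('m \<Rightarrow> 'm2) \<Rightarrow> bool" where
  "is_functor C D Fo Fm \<longleftrightarrow>
     is_category C \<and> is_category D \<and>
     (\<forall>a\<in>Obj C. Fo a \<in> Obj D) \<and>
     (\<forall>f\<in>Arr C. Fm f \<in> Homs D (Fo (Dom C f)) (Fo (Cod C f))) \<and>
     (\<forall>a\<in>Obj C. Fm (Ident C a) = Ident D (Fo a)) \<and>
     (\<forall>f\<in>Arr C. \<forall>g\<in>Arr C. Dom C g = Cod C f \<longrightarrow> Fm (Comp C g f) = Comp D (Fm g) (Fm f))"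

text \<open>An additive category: \<open>H a b\<close> is the abelian group structure on the morphisms from \<open>a\<close> to
  \<open>b\<close>, written multiplicatively as all groups of \<open>HOL-Algebra\<close>, so that \<open>\<one>\<close> is the zero
  morphism, \<open>\<otimes>\<close> is the addition and \<open>inv\<close> is minus.\<close>

definition additive_category :: "('o, 'm) category \<Rightarrow> ('o \<Rightarrow> 'o \<Rightarrow> 'm monoid) \<Rightarrow> bool" where
  "additive_category D H \<longleftrightarrow>
     is_category D \<and>
     (\<forall>a\<in>Obj D. \<forall>b\<in>Obj D. comm_group (H a b) \<and> carrier (H a b) = Homs D a b) \<and>
     (\<forall>a\<in>Obj D. \<forall>b\<in>Obj D. \<forall>c\<in>Obj D. \<forall>f\<in>Homs D a b. \<forall>g\<in>Homs D b c.
        (\<forall>f'\<in>Homs D a b.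
           Comp D g (f \<otimes>\<^bsub>H a b\<^esub> f') = Comp D g f \<otimes>\<^bsub>H a c\<^esub> Comp D g f') \<and>
        (\<forall>g'\<in>Homs D b c.
           Comp D (g \<otimes>\<^bsub>H b c\<^esub> g') f = Comp D g f \<otimes>\<^bsub>H a c\<^esub> Comp D g' f)) \<and>
     (\<exists>z\<in>Obj D. Ident D z = \<one>\<^bsub>H z z\<^esub>) \<and>
     (\<forall>a\<in>Obj D. \<forall>b\<in>Obj D. \<exists>s\<in>Obj D.
        \<exists>i\<in>Homs D a s. \<exists>j\<in>Homs D b s. \<exists>p\<in>Homs D s a. \<exists>q\<in>Homs D s b.
          Comp D p i = Ident D a \<and> Comp D q j = Ident D b \<and>
          Comp D p j = \<one>\<^bsub>H b a\<^esub> \<and> Comp D q i = \<one>\<^bsub>H a b\<^esub> \<and>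
          Comp D i p \<otimes>\<^bsub>H s s\<^esub> Comp D j q = Ident D s)"

definition minus_arr ::
  "('o, 'm) category \<Rightarrow> ('o \<Rightarrow> 'o \<Rightarrow> 'm monoid) \<Rightarrow> 'm \<Rightarrow> 'm" where
  "minus_arr D H f = inv\<^bsub>H (Dom D f) (Cod D f)\<^esub> f"


section \<open>The category of spaces with a system\<close>

type_synonym 'a zobj = "'a topology \<times> 'a sys"

record 'a zarr =
  src :: "'a zobj"
  tgt :: "'a zobj"
  fn :: "'a \<Rightarrow> 'a"
  sgm :: "'a \<Rightarrow> int"

abbreviation zarrow :: "'a zobj \<Rightarrow> 'a zobj \<Rightarrow> ('a \<Rightarrow> 'a) \<Rightarrow> ('a \<Rightarrow> int) \<Rightarrow> 'a zarr" where
  "zarrow A B f \<zeta> \<equiv> \<lparr>src = A, tgt = B, fn = f, sgm = \<zeta>\<rparr>"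

abbreviation id_fn :: "'a topology \<Rightarrow> 'a \<Rightarrow> 'a" where
  "id_fn X \<equiv> (\<lambda>x\<in>topspace X. x)"

definition Zt_Top :: "('a zobj, 'a zarr) category" where
  "Zt_Top =
     \<lparr>Obj = {(X, \<Lambda>). Zt_system X \<Lambda>},
      Arr = {zarrow (X, \<Lambda>X) (Y, \<Lambda>Y) f \<zeta> | X \<Lambda>X Y \<Lambda>Y f \<zeta>.
               Zt_system X \<Lambda>X \<and> Zt_system Y \<Lambda>Y \<and>
               continuous_map X Y f \<and> f \<in> extensional (topspace X) \<and>
               system_map X \<Lambda>X (sys_pullback X Y f \<Lambda>Y) \<zeta>},
      Dom = src,
      Cod = tgt,
      Ident = (\<lambda>A. zarrow A A (id_fn (fst A)) (one_map (fst A))),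
      Comp = (\<lambda>b a. zarrow (src a) (tgt b)
                (compose (topspace (fst (src a))) (fn b) (fn a))
                (\<lambda>x\<in>topspace (fst (src a)). sgm b (fn a x) * sgm a x))\<rparr>"

definition involution :: "'a zarr \<Rightarrow> 'a zarr" where
  "involution a = a\<lparr>sgm := neg_map (fst (src a)) (sgm a)\<rparr>"


section \<open>A universe of points\<close>

text \<open>All spaces of the category must have their points in a single HOL type. The following type
  is closed under the constructions needed: \<open>Cyl x t\<close> serves as the point \<open>(x, t)\<close> of
  \<open>X \<times> [0,1]\<close>, and \<open>Cell [g\<^sub>1, \<dots>, g\<^sub>k] t\<close> as a point of the classifying space of a group with
  elements in the universe. \<open>Atom\<close> embeds an arbitrary type, and \<open>Loop\<close> makes sure that every
  fundamental group of a space in the universe is isomorphic to a group with carrier in the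
  universe (represent each class by one of its loops).\<close>

datatype 'a point =
    Atom 'a
  | Cyl "'a point" real
  | Cell "'a point list" "nat \<Rightarrow> real"
  | Loop "real \<Rightarrow> 'a point"

type_synonym 'a space = "'a point topology"
type_synonym 'a obj = "'a point zobj"
type_synonym 'a arr = "'a point zarr"


section \<open>Having homotopies\<close>

definition cylinder :: "'a space \<Rightarrow> 'a space" where
  "cylinder X = quot_topology (prod_topology X unit_interval) (\<lambda>(x, t). Cyl x t)"

definition cyl_proj :: "'a space \<Rightarrow> 'a point \<Rightarrow> 'a point" where
  "cyl_proj X = (\<lambda>z\<in>topspace (cylinder X). case z of Cyl x t \<Rightarrow> x)"

definition cyl_incl :: "'a space \<Rightarrow> real \<Rightarrow> 'a point \<Rightarrow> 'a point" where
  "cyl_incl X i = (\<lambda>x\<in>topspace X. Cyl x i)"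

fun cyl_obj :: "'a obj \<Rightarrow> 'a obj" where
  "cyl_obj (X, \<Lambda>) = (cylinder X, sys_pullback (cylinder X) X (cyl_proj X) \<Lambda>)"

definition incl_arr :: "'a obj \<Rightarrow> real \<Rightarrow> 'a arr" where
  "incl_arr A i = zarrow A (cyl_obj A) (cyl_incl (fst A) i) (one_map (fst A))"

definition proj_arr :: "'a obj \<Rightarrow> 'a arr" where
  "proj_arr A = zarrow (cyl_obj A) A (cyl_proj (fst A)) (one_map (cylinder (fst A)))"

definition homotopy_from_to ::
  "'a space \<Rightarrow> 'a space \<Rightarrow> ('a point \<Rightarrow> 'a point) \<Rightarrow> ('a point \<Rightarrow> 'a point)
     \<Rightarrow> ('a point \<Rightarrow> 'a point) \<Rightarrow> bool" where
  "homotopy_from_to X Y F f0 f1 \<longleftrightarrow>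
     continuous_map (cylinder X) Y F \<and> F \<in> extensional (topspace (cylinder X)) \<and>
     (\<forall>x\<in>topspace X. F (Cyl x 0) = f0 x \<and> F (Cyl x 1) = f1 x)"

definition has_homotopies :: "('a obj, 'a arr) category \<Rightarrow> bool" where
  "has_homotopies T \<longleftrightarrow>
     subcategory T Zt_Top \<and>
     (\<forall>A\<in>Obj T. cyl_obj A \<in> Obj T) \<and>
     (\<forall>A\<in>Obj T. incl_arr A 0 \<in> Arr T \<and> incl_arr A 1 \<in> Arr T) \<and>
     (\<forall>A B f0 \<zeta>0 f1 \<zeta>1 F.
        zarrow A B f0 \<zeta>0 \<in> Arr T \<longrightarrow> zarrow A B f1 \<zeta>1 \<in> Arr T \<longrightarrow>
        homotopy_from_to (fst A) (fst B) F f0 f1 \<longrightarrow>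
        (\<exists>\<zeta>F. zarrow (cyl_obj A) B F \<zeta>F \<in> Arr T \<and>
              Comp T (zarrow (cyl_obj A) B F \<zeta>F) (incl_arr A 0) = zarrow A B f0 \<zeta>0)) \<and>
     (\<forall>A B f \<zeta>0 \<zeta>1 c.
        zarrow A B f \<zeta>0 \<in> Arr T \<longrightarrow> zarrow A B f \<zeta>1 \<in> Arr T \<longrightarrow>
        c \<in> H0 (fst A) \<longrightarrow> \<zeta>0 = H0_act (fst A) c \<zeta>1 \<longrightarrow>
        zarrow A A (id_fn (fst A)) (H0_act (fst A) c (one_map (fst A))) \<in> Arr T)"

text \<open>That \<open>\<Omega>(r, 1)\<close> be defined is part of the notion: having homotopies does not put
  \<open>(r, 1)\<close> into the subcategory.\<close>

definition homotopy_functor ::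
  "('a obj, 'a arr) category \<Rightarrow> ('o, 'm) category \<Rightarrow> ('a obj \<Rightarrow> 'o) \<Rightarrow> ('a arr \<Rightarrow> 'm) \<Rightarrow> bool"
where
  "homotopy_functor T D \<Omega>o \<Omega>m \<longleftrightarrow>
     has_homotopies T \<and> is_functor T D \<Omega>o \<Omega>m \<and>
     (\<forall>A\<in>Obj T. proj_arr A \<in> Arr T \<and>
        Comp D (\<Omega>m (incl_arr A 0)) (\<Omega>m (proj_arr A)) = Ident D (\<Omega>o (cyl_obj A)))"

definition preserves_involution ::
  "('a obj, 'a arr) category \<Rightarrow> ('o, 'm) category \<Rightarrow> ('o \<Rightarrow> 'o \<Rightarrow> 'm monoid)
     \<Rightarrow> ('a arr \<Rightarrow> 'm) \<Rightarrow> bool" where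
  "preserves_involution T D H \<Omega>m \<longleftrightarrow>
     (\<forall>a. a \<in> Arr T \<longrightarrow> involution a \<in> Arr T \<longrightarrow> \<Omega>m (involution a) = minus_arr D H (\<Omega>m a))"


section \<open>Classifying spaces\<close>

text \<open>The nerve of a group as a category with one object. For a monotone map \<open>\<alpha>\<close> from
  \<open>{0..m}\<close> to \<open>{0..k}\<close>, the \<open>j\<close>-th entry of \<open>\<alpha>\<^sup>* [g\<^sub>1, \<dots>, g\<^sub>k]\<close> is the product
  \<open>g\<^bsub>\<alpha> j + 1\<^esub> \<dots> g\<^bsub>\<alpha> (j + 1)\<^esub>\<close>: the entry \<open>g\<^sub>i\<close> is the edge from vertex \<open>i - 1\<close> to vertex \<open>i\<close>,
  and consecutive edges are multiplied from left to right.\<close>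

definition nerve_pull ::
  "('g, 'x) monoid_scheme \<Rightarrow> nat \<Rightarrow> (nat \<Rightarrow> nat) \<Rightarrow> 'g list \<Rightarrow> 'g list" where
  "nerve_pull G m \<alpha> gs =
     map (\<lambda>j. foldr (mult G) (take (\<alpha> (Suc j) - \<alpha> j) (drop (\<alpha> j) gs)) \<one>\<^bsub>G\<^esub>) [0..<m]"

definition simplex_push :: "nat \<Rightarrow> (nat \<Rightarrow> nat) \<Rightarrow> (nat \<Rightarrow> real) \<Rightarrow> nat \<Rightarrow> real" where
  "simplex_push m \<alpha> t = (\<lambda>j. \<Sum>i | i \<le> m \<and> \<alpha> i = j. t i)"

definition pre_realization ::
  "('g, 'x) monoid_scheme \<Rightarrow> ('g list \<times> (nat \<Rightarrow> real)) topology" where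
  "pre_realization G =
     sum_topology (\<lambda>gs. subtopology (powertop_real UNIV) (standard_simplex (length gs)))
       (lists (carrier G))"

definition realization_rel ::
  "('g, 'x) monoid_scheme \<Rightarrow> (('g list \<times> (nat \<Rightarrow> real)) \<times> ('g list \<times> (nat \<Rightarrow> real))) set" where
  "realization_rel G =
     {((nerve_pull G m \<alpha> gs, t), (gs, simplex_push m \<alpha> t)) | m \<alpha> gs t.
        gs \<in> lists (carrier G) \<and> t \<in> standard_simplex m \<and>
        mono_on {..m} \<alpha> \<and> \<alpha> ` {..m} \<subseteq> {..length gs}}"

definition realization_equiv ::
  "('g, 'x) monoid_scheme \<Rightarrow> (('g list \<times> (nat \<Rightarrow> real)) \<times> ('g list \<times> (nat \<Rightarrow> real))) set" where
  "realization_equiv G = (realization_rel G \<union> (realization_rel G)\<inverse>)\<^sup>*"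

text \<open>A point of the geometric realization is an equivalence class; in the universe of points it
  is denoted by an arbitrary but fixed representative of this class.\<close>

definition BG_point :: "('a point, 'x) monoid_scheme \<Rightarrow> 'a point list \<times> (nat \<Rightarrow> real) \<Rightarrow> 'a point" where
  "BG_point G z = (case SOME w. (z, w) \<in> realization_equiv G of (gs, t) \<Rightarrow> Cell gs t)"

definition BG :: "('a point, 'x) monoid_scheme \<Rightarrow> 'a space" where
  "BG G = quot_topology (pre_realization G) (BG_point G)"

definition B_map ::
  "('a point, 'x) monoid_scheme \<Rightarrow> ('a point, 'y) monoid_scheme \<Rightarrow> ('a point \<Rightarrow> 'a point)
     \<Rightarrow> 'a point \<Rightarrow> 'a point" where
  "B_map H G \<psi> =
     (\<lambda>x\<in>topspace (BG H). case x of Cell hs t \<Rightarrow> BG_point G (map \<psi> hs, t))"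

text \<open>The simplex of the nerve given by \<open>gs\<close> is nondegenerate iff \<open>\<one>\<close> does not occur in \<open>gs\<close>,
  since the degeneracies insert \<open>\<one>\<close>.\<close>

definition interior_rep ::
  "('a point, 'x) monoid_scheme \<Rightarrow> 'a point \<Rightarrow> 'a point list \<times> (nat \<Rightarrow> real)" where
  "interior_rep G x =
     (THE (gs, t). gs \<in> lists (carrier G) \<and> \<one>\<^bsub>G\<^esub> \<notin> set gs \<and>
        t \<in> standard_simplex (length gs) \<and> (\<forall>i\<le>length gs. 0 < t i) \<and> BG_point G (gs, t) = x)"

definition line_to_base :: "('a point, 'x) monoid_scheme \<Rightarrow> 'a point \<Rightarrow> (real \<Rightarrow> 'a point) set" where
  "line_to_base G x =
     (case interior_rep G x of (gs, t) \<Rightarrow>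
        path_class (BG G)
          (\<lambda>s. BG_point G (gs, \<lambda>i. (1 - s) * t i + s * (if i = 0 then 1 else 0))))"

definition BG_system :: "('a point, 'x) monoid_scheme \<Rightarrow> 'a point cochain set \<Rightarrow> 'a point sys" where
  "BG_system G w =
     (THE \<Lambda>. Zt_system (BG G) \<Lambda> \<and> twist (BG G) \<Lambda> = w \<and>
        (\<forall>x\<in>topspace (BG G). \<Lambda> (line_to_base G x) = 1))"

definition BG_obj :: "('a point, 'x) monoid_scheme \<Rightarrow> 'a point cochain set \<Rightarrow> 'a obj" where
  "BG_obj G w = (BG G, BG_system G w)"

definition value_on :: "('a point, 'x) monoid_scheme \<Rightarrow> 'a point cochain set \<Rightarrow> 'a point \<Rightarrow> int" where
  "value_on G w g =
     loop_value w (\<lambda>s. BG_point G ([g], \<lambda>i. if i = 0 then 1 - s else if i = 1 then s else 0))"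

definition B_arr ::
  "('a point, 'x) monoid_scheme \<Rightarrow> ('a point, 'y) monoid_scheme \<Rightarrow> ('a point \<Rightarrow> 'a point)
     \<Rightarrow> 'a point cochain set \<Rightarrow> 'a arr" where
  "B_arr H G \<psi> w =
     zarrow (BG_obj H (cohomology_pullback 1 (BG H) (B_map H G \<psi>) w)) (BG_obj G w)
       (B_map H G \<psi>) (one_map (BG H))"

definition inner_aut :: "('g, 'x) monoid_scheme \<Rightarrow> 'g \<Rightarrow> 'g \<Rightarrow> 'g" where
  "inner_aut G g = (\<lambda>h. inv\<^bsub>G\<^esub> g \<otimes>\<^bsub>G\<^esub> h \<otimes>\<^bsub>G\<^esub> g)"


section \<open>Surgery theories\<close>

text \<open>In the closure property, the expression \<open>B\<pi>\<^sub>1(K)\<close> refers to \<open>\<pi>\<^sub>1(K)\<close> as a group up to isomorphism: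
  no base point is chosen, and in particular a group \<open>P\<close> is itself a model of \<open>\<pi>\<^sub>1(BP)\<close>. Hence
  \<open>P\<close> ranges over all groups in the universe for which there is a map \<open>u : K \<rightarrow> BP\<close> inducing an
  isomorphism on \<open>\<pi>\<^sub>1\<close>; as \<open>\<pi>\<^sub>1(BP) \<cong> P\<close>, such a \<open>P\<close> is isomorphic to \<open>\<pi>\<^sub>1(K)\<close>.\<close>

definition pi1_closed :: "('a obj, 'a arr) category \<Rightarrow> bool" where
  "pi1_closed T \<longleftrightarrow>
     (\<forall>K \<Lambda>. \<forall>P :: 'a point monoid. \<forall>u.
        (K, \<Lambda>) \<in> Obj T \<longrightarrow> path_connected_space K \<longrightarrow> topspace K \<noteq> {} \<longrightarrow>
        group P \<longrightarrow> continuous_map K (BG P) u \<longrightarrow> u \<in> extensional (topspace K) \<longrightarrow>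
        induces_pi1_iso K (BG P) u \<longrightarrow>
        (let w = inv_into (H1 (BG P)) (cohomology_pullback 1 K u) (twist K \<Lambda>) in
           BG_obj P w \<in> Obj T \<and> (\<exists>\<zeta>. zarrow (K, \<Lambda>) (BG_obj P w) u \<zeta> \<in> Arr T)))"

definition surgery_theory ::
  "('a obj, 'a arr) category \<Rightarrow> ('o, 'm) category \<Rightarrow> ('a obj \<Rightarrow> 'o) \<Rightarrow> ('a arr \<Rightarrow> 'm) \<Rightarrow> bool"
where
  "surgery_theory T D \<Omega>o \<Omega>m \<longleftrightarrow> homotopy_functor T D \<Omega>o \<Omega>m \<and> pi1_closed T"

end

theory Submission
  imports Defs "HOL-Analysis.Abstract_Topological_Spaces"
begin

text \<open>
  The two endomorphisms \<open>1\<close> and \<open>Bc\<^sub>g\<close> of \<open>BG\<close> are joined by a homotopy \<open>F\<close> which moves the base point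
  once around the loop \<open>g\<close>. Everything else is bookkeeping of signs along this homotopy.

  \<^bold>\<open>The homotopy.\<close> Inner automorphisms are naturally isomorphic to the identity, the isomorphism being
  \<open>g\<close>. As \<open>G\<close> is a groupoid, no prism decomposition is needed: if a simplex of the nerve is
  described by labels \<open>v\<^sub>0, \<dots>, v\<^sub>k\<close> of its vertices (the entries being \<open>v\<^sub>j\<inverse> v\<^bsub>j+1\<^esub>\<close>), then
  \<open>v\<^sub>0, \<dots>, v\<^sub>k, v\<^sub>0 g, \<dots>, v\<^sub>k g\<close> are the labels of a simplex whose front face is the given simplex and
  whose back face is its image under \<open>c\<^sub>g\<close>, and \<open>F\<close> is the straight line homotopy from the front face
  to the back face. This is compatible with all simplicial operators at once
  (\<open>conj_homotopy_respects\<close>), and it is continuous on the cylinder because the product of a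
  quotient map with the interval is a quotient map (\<open>homotopy_conj_cylinder\<close>).

  \<^bold>\<open>The system \<open>\<Lambda>\<^sub>\<omega>\<close>.\<close> Systems correspond to singular one-cocycles, and a class in \<open>H\<^sup>1\<close> of a
  path-connected space is determined by its values on loops. Changing a cocycle in \<open>\<omega>\<close> by the
  coboundary of its values on the lines to the base point gives the normalised system; uniqueness is
  similar (\<open>BG_system\<close>). That the lines are well defined rests on the uniqueness of nondegenerate
  representatives (\<open>nondegenerate_unique\<close>).

  \<^bold>\<open>The conclusion.\<close> \<open>Bc\<^sub>g\<close> is a homeomorphism which acts trivially on \<open>H\<^sup>1\<close> by homotopy invariance, so the
  closure property of a surgery theory puts \<open>(Bc\<^sub>g, \<zeta>)\<close> into the subcategory for some \<open>\<zeta>\<close>, and the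
  homotopy \<open>F\<close> lifts to a morphism \<open>(F, \<zeta>\<^sub>F)\<close> which starts at the identity. Its other end is
  \<open>(Bc\<^sub>g, \<phi>)\<close>. The function \<open>\<phi>\<close> is constant, since \<open>\<Lambda>\<^sub>\<omega>\<close> is trivial both on the lines to the base point
  and on their images, and its value at the base point is \<open>\<omega>(g)\<close> (\<open>conj_cylinder_end\<close>). Both ends of the
  cylinder have the same image under \<open>\<Omega>\<close> (\<open>homotopy_functor_incl\<close>), so \<open>\<Omega>(Bc\<^sub>g, \<omega>(g))\<close> is the
  identity (\<open>surgery_theory_inner_aut\<close>). If \<open>\<omega>(g) = -1\<close>, then \<open>(Bc\<^sub>g, 1)\<close> is the composition of
  \<open>(Bc\<^sub>g, -1)\<close> and \<open>(1, -1)\<close>.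
\<close>

section \<open>Paths up to homotopy\<close>

abbreviation unit_square :: "(real \<times> real) topology" where
  "unit_square \<equiv> prod_topology unit_interval unit_interval"

lemma path_class_eq_homotopic:
  assumes "homotopic_with (\<lambda>r. r 0 = p 0 \<and> r 1 = p 1) unit_interval X p q"
  shows "path_class X p = path_class X q"
proof -
  have e: "q 0 = p 0" "q 1 = p 1"
    using homotopic_with_imp_property[OF assms] by auto
  show ?thesis
    unfolding path_class_def e
  proof (intro Collect_cong iffI)
    show "homotopic_with (\<lambda>r. r 0 = p 0 \<and> r 1 = p 1) unit_interval X q r"
      if "homotopic_with (\<lambda>r. r 0 = p 0 \<and> r 1 = p 1) unit_interval X p r" for r
      by (rule homotopic_with_trans[OF homotopic_with_symD[OF assms] that])
    show "homotopic_with (\<lambda>r. r 0 = p 0 \<and> r 1 = p 1) unit_interval X p r"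
      if "homotopic_with (\<lambda>r. r 0 = p 0 \<and> r 1 = p 1) unit_interval X q r" for r
      by (rule homotopic_with_trans[OF assms that])
  qed
qed

lemma path_class_eqI:
  assumes "continuous_map unit_square X h"
    and h0: "\<And>t. t \<in> {0..1} \<Longrightarrow> h (0, t) = p t" and h1: "\<And>t. t \<in> {0..1} \<Longrightarrow> h (1, t) = q t"
    and "\<And>s. s \<in> {0..1} \<Longrightarrow> h (s, 0) = p 0 \<and> h (s, 1) = p 1"
  shows "path_class X p = path_class X q"
proof (rule path_class_eq_homotopic, subst homotopic_with)
  show "(r 0 = p 0 \<and> r 1 = p 1) = (r' 0 = p 0 \<and> r' 1 = p 1)"
    if "\<And>x. x \<in> topspace unit_interval \<Longrightarrow> r x = r' x" for r r' :: "real \<Rightarrow> 'a"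
    using that[of 0] that[of 1] by simp
  show "\<exists>h. continuous_map unit_square X h \<and> (\<forall>x\<in>topspace unit_interval. h (0, x) = p x) \<and>
      (\<forall>x\<in>topspace unit_interval. h (1, x) = q x) \<and>
      (\<forall>t\<in>{0..1}. h (t, 0) = p 0 \<and> h (t, 1) = p 1)"
    by (rule exI[of _ h]) (use assms in simp)
qed

lemma path_classE:
  assumes "q \<in> path_class X p"
  obtains h where "continuous_map unit_square X h"
    "\<And>t. h (0, t) = p t" "\<And>t. h (1, t) = q t"
    "\<And>s. s \<in> {0..1} \<Longrightarrow> h (s, 0) = p 0 \<and> h (s, 1) = p 1"
  using assms unfolding path_class_def homotopic_with_def mem_Collect_eq by blast

lemma path_class_self: "pathin X p \<Longrightarrow> p \<in> path_class X p"
  by (simp add: path_class_def pathin_def)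

lemma path_class_nonempty: "pathin X p \<Longrightarrow> path_class X p \<noteq> {}"
  using path_class_self by fastforce

lemma path_class_memD:
  assumes "q \<in> path_class X p"
  shows "pathin X p" "pathin X q" "path_class X q = path_class X p" "q 0 = p 0" "q 1 = p 1"
proof -
  have hom: "homotopic_with (\<lambda>r. r 0 = p 0 \<and> r 1 = p 1) unit_interval X p q"
    using assms by (simp add: path_class_def)
  show "pathin X p" "pathin X q"
    using homotopic_with_imp_continuous_maps[OF hom] by (auto simp: pathin_def)
  show "q 0 = p 0" "q 1 = p 1"
    using homotopic_with_imp_property[OF hom] by auto
  show "path_class X q = path_class X p"
    using path_class_eq_homotopic[OF hom] by simp
qed

lemma path_class_cong:
  assumes "pathin X p" "\<And>t. t \<in> {0..1} \<Longrightarrow> p t = q t"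
  shows "path_class X p = path_class X q"
proof -
  have "homotopic_with (\<lambda>r. r 0 = p 0 \<and> r 1 = p 1) unit_interval X p q"
    by (rule homotopic_with_equal) (use assms in \<open>auto simp: pathin_def\<close>)
  then show ?thesis by (rule path_class_eq_homotopic)
qed

lemma pathin_in_topspace: "pathin X p \<Longrightarrow> t \<in> {0..1} \<Longrightarrow> p t \<in> topspace X"
  using path_image_subset_topspace by blast

lemma path_class_in_groupoid [simp]: "pathin X p \<Longrightarrow> path_class X p \<in> path_groupoid X"
  by (auto simp: path_groupoid_def)

lemma continuous_map_square_parts:
  "continuous_map unit_square euclideanreal fst" "continuous_map unit_square euclideanreal snd"
  using continuous_map_fst[of unit_interval unit_interval] continuous_map_snd[of unit_interval unit_interval]
  by (auto simp: continuous_map_in_subtopology)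

lemma pathin_path_concat:
  assumes "pathin X p" "pathin X q" "p 1 = q 0"
  shows "pathin X (path_concat p q)"
  unfolding pathin_def path_concat_def
proof (rule continuous_map_cases_le)
  show "continuous_map (subtopology unit_interval {x \<in> topspace unit_interval. x \<le> 1 / 2}) X (\<lambda>x. p (2 * x))"
  proof (rule continuous_map_compose[unfolded o_def, of _ unit_interval "\<lambda>x. 2 * x" X p])
    show "continuous_map (subtopology unit_interval {x \<in> topspace unit_interval. x \<le> 1 / 2}) unit_interval ((*) 2)"
      by (auto simp: continuous_map_in_subtopology subtopology_subtopology intro!: continuous_intros)
  qed (use assms in \<open>auto simp: pathin_def\<close>)
  show "continuous_map (subtopology unit_interval {x \<in> topspace unit_interval. 1 / 2 \<le> x}) X (\<lambda>x. q (2 * x - 1))"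
  proof (rule continuous_map_compose[unfolded o_def, of _ unit_interval "\<lambda>x. 2 * x - 1" X q])
    show "continuous_map (subtopology unit_interval {x \<in> topspace unit_interval. 1 / 2 \<le> x}) unit_interval (\<lambda>x. 2 * x - 1)"
      by (auto simp: continuous_map_in_subtopology subtopology_subtopology intro!: continuous_intros)
  qed (use assms in \<open>auto simp: pathin_def\<close>)
  show "p (2 * t) = q (2 * t - 1)" if "t \<in> topspace unit_interval" "t = 1 / 2" for t
    using assms(3) by (simp add: that(2))
qed auto

lemma path_class_concat_cong:
  assumes p: "p' \<in> path_class X p" and q: "q' \<in> path_class X q" and pq: "p 1 = q 0"
  shows "path_class X (path_concat p' q') = path_class X (path_concat p q)"
proof -
  obtain h where h: "continuous_map unit_square X h"
    "\<And>t. h (0, t) = p t" "\<And>t. h (1, t) = p' t"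
    "\<And>s. s \<in> {0..1} \<Longrightarrow> h (s, 0) = p 0 \<and> h (s, 1) = p 1"
    using path_classE[OF p] by metis
  obtain k where k: "continuous_map unit_square X k"
    "\<And>t. k (0, t) = q t" "\<And>t. k (1, t) = q' t"
    "\<And>s. s \<in> {0..1} \<Longrightarrow> k (s, 0) = q 0 \<and> k (s, 1) = q 1"
    using path_classE[OF q] by metis
  define H where "H = (\<lambda>z. if snd z \<le> 1/2 then h (fst z, 2 * snd z) else k (fst z, 2 * snd z - 1))"
  have top: "topspace unit_square = {0..1} \<times> {0..1}" by simp
  have "continuous_map unit_square X H"
    unfolding H_def
  proof (rule continuous_map_cases_le)
    let ?A = "subtopology unit_square {x \<in> topspace unit_square. snd x \<le> 1 / 2}"
    have "continuous_map ?A unit_square (\<lambda>z. (fst z, 2 * snd z))"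
      by (auto simp: continuous_map_pairwise o_def continuous_map_in_subtopology
            intro!: continuous_intros continuous_map_from_subtopology continuous_map_square_parts)
    then show "continuous_map ?A X (\<lambda>z. h (fst z, 2 * snd z))"
      using continuous_map_compose[OF _ h(1)] by (force simp: o_def)
    let ?B = "subtopology unit_square {x \<in> topspace unit_square. 1 / 2 \<le> snd x}"
    have "continuous_map ?B unit_square (\<lambda>z. (fst z, 2 * snd z - 1))"
      by (auto simp: continuous_map_pairwise o_def continuous_map_in_subtopology
            intro!: continuous_intros continuous_map_from_subtopology continuous_map_square_parts)
    then show "continuous_map ?B X (\<lambda>z. k (fst z, 2 * snd z - 1))"
      using continuous_map_compose[OF _ k(1)] by (force simp: o_def)
    show "h (fst z, 2 * snd z) = k (fst z, 2 * snd z - 1)"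
      if "z \<in> topspace unit_square" "snd z = 1 / 2" for z
      unfolding that(2) using that(1) h(4)[of "fst z"] k(4)[of "fst z"] pq by auto
  qed (simp_all only: continuous_map_square_parts continuous_map_const, simp_all)
  then have "path_class X (path_concat p q) = path_class X (path_concat p' q')"
    by (rule path_class_eqI) (use h k in \<open>auto simp: H_def path_concat_def\<close>)
  then show ?thesis by simp
qed

lemma class_concat_path_class:
  assumes "pathin X p" "pathin X q" "p 1 = q 0"
  shows "class_concat X (path_class X p) (path_class X q) = path_class X (path_concat p q)"
proof -
  have "(\<Union>q'\<in>path_class X q. path_class X (path_concat p' q')) = path_class X (path_concat p q)"
    if "p' \<in> path_class X p" for p'
    by (rule SUP_eq_const[OF path_class_nonempty[OF assms(2)]]) (rule path_class_concat_cong[OF that(1)], assumption, rule assms(3))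
  then show ?thesis
    unfolding class_concat_def by (rule SUP_eq_const[OF path_class_nonempty[OF assms(1)]])
qed

lemma class_map_path_class:
  assumes "pathin X p" "continuous_map X Y f"
  shows "class_map Y f (path_class X p) = path_class Y (f \<circ> p)"
proof -
  have "path_class Y (f \<circ> q) = path_class Y (f \<circ> p)" if q: "q \<in> path_class X p" for q
  proof -
    obtain h where h: "continuous_map unit_square X h"
      "\<And>t. h (0, t) = p t" "\<And>t. h (1, t) = q t"
      "\<And>s. s \<in> {0..1} \<Longrightarrow> h (s, 0) = p 0 \<and> h (s, 1) = p 1"
      using path_classE[OF q] by metis
    show ?thesis
      by (rule path_class_eqI[symmetric, where h = "f \<circ> h"])
         (use h continuous_map_compose[OF h(1) assms(2)] in auto)
  qed
  then show ?thesis
    unfolding class_map_def by (rule SUP_eq_const[OF path_class_nonempty[OF assms(1)]])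
qed

lemma compose_path_concat: "f \<circ> path_concat p q = path_concat (f \<circ> p) (f \<circ> q)"
  by (auto simp: path_concat_def)

lemma homeomorphism_induces_pi1_iso:
  assumes f: "continuous_map X Y f" and k: "continuous_map Y X k"
    and kf: "\<And>x. x \<in> topspace X \<Longrightarrow> k (f x) = x" and fk: "\<And>y. y \<in> topspace Y \<Longrightarrow> f (k y) = y"
  shows "induces_pi1_iso X Y f"
  unfolding induces_pi1_iso_def
proof
  fix x assume x: "x \<in> topspace X"
  have kf_class: "class_map X k (class_map Y f (path_class X p)) = path_class X p" if "pathin X p" for p
  proof -
    have "class_map X k (class_map Y f (path_class X p)) = path_class X (k \<circ> (f \<circ> p))"
      using class_map_path_class[OF that f] class_map_path_class[OF pathin_compose[OF that f] k] by simp
    also have "\<dots> = path_class X p"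
      by (rule path_class_cong[symmetric, OF that]) (use kf pathin_in_topspace[OF that] in auto)
    finally show ?thesis .
  qed
  have fk_class: "class_map Y f (path_class X (k \<circ> q)) = path_class Y q" if "pathin Y q" for q
  proof -
    have "class_map Y f (path_class X (k \<circ> q)) = path_class Y (f \<circ> (k \<circ> q))"
      using class_map_path_class[OF that k] class_map_path_class[OF pathin_compose[OF that k] f] by simp
    also have "\<dots> = path_class Y q"
      by (rule path_class_cong[symmetric, OF that]) (use fk pathin_in_topspace[OF that] in auto)
    finally show ?thesis .
  qed
  have "class_map Y f \<in> hom (fundamental_group X x) (fundamental_group Y (f x))"
  proof (rule homI)
    fix a assume "a \<in> carrier (fundamental_group X x)"
    then obtain p where p: "a = path_class X p" "pathin X p" "p 0 = x" "p 1 = x"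
      by (auto simp: fundamental_group_def)
    moreover have "pathin Y (f \<circ> p)" using pathin_compose[OF p(2) f] .
    ultimately show "class_map Y f a \<in> carrier (fundamental_group Y (f x))"
      by (auto simp: fundamental_group_def class_map_path_class[OF p(2) f])
  next
    fix a b assume "a \<in> carrier (fundamental_group X x)" "b \<in> carrier (fundamental_group X x)"
    then obtain p q where p: "a = path_class X p" "pathin X p" "p 0 = x" "p 1 = x"
      and q: "b = path_class X q" "pathin X q" "q 0 = x" "q 1 = x"
      by (auto simp: fundamental_group_def)
    show "class_map Y f (a \<otimes>\<^bsub>fundamental_group X x\<^esub> b)
        = class_map Y f a \<otimes>\<^bsub>fundamental_group Y (f x)\<^esub> class_map Y f b"
      using p(3,4) q(3,4) unfolding p(1) q(1)
      by (simp add: fundamental_group_def class_concat_path_class class_map_path_class[OF _ f] p(2) q(2)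
          pathin_path_concat pathin_compose[OF p(2) f] pathin_compose[OF q(2) f] compose_path_concat)
  qed
  moreover have "bij_betw (class_map Y f) (carrier (fundamental_group X x))
      (carrier (fundamental_group Y (f x)))"
    unfolding bij_betw_def
  proof
    show "inj_on (class_map Y f) (carrier (fundamental_group X x))"
      by (rule inj_on_inverseI[where g = "class_map X k"]) (auto simp: fundamental_group_def kf_class)
    show "class_map Y f ` carrier (fundamental_group X x) = carrier (fundamental_group Y (f x))"
    proof
      show "class_map Y f ` carrier (fundamental_group X x) \<subseteq> carrier (fundamental_group Y (f x))"
        using calculation by (auto simp: hom_def)
      show "carrier (fundamental_group Y (f x)) \<subseteq> class_map Y f ` carrier (fundamental_group X x)"
      proof
        fix b assume "b \<in> carrier (fundamental_group Y (f x))"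
        then obtain q where q: "b = path_class Y q" "pathin Y q" "q 0 = f x" "q 1 = f x"
          by (auto simp: fundamental_group_def)
        have "pathin X (k \<circ> q)" "(k \<circ> q) 0 = x" "(k \<circ> q) 1 = x"
          using pathin_compose[OF q(2) k] kf[OF x] q(3,4) by auto
        then show "b \<in> class_map Y f ` carrier (fundamental_group X x)"
          using fk_class[OF q(2)] q(1) by (force simp: fundamental_group_def)
      qed
    qed
  qed
  ultimately show "class_map Y f \<in> iso (fundamental_group X x) (fundamental_group Y (f x))"
    by (simp add: iso_def)
qed

section \<open>One-cocycles on triangles and squares\<close>

abbreviation simplex_top :: "nat \<Rightarrow> (nat \<Rightarrow> real) topology" where
  "simplex_top n \<equiv> subtopology (powertop_real UNIV) (standard_simplex n)"

lemma continuous_map_into_simplex: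
  assumes "\<And>i. continuous_map Y euclideanreal (\<lambda>y. f y i)"
    and "\<And>y. y \<in> topspace Y \<Longrightarrow> f y \<in> standard_simplex n"
  shows "continuous_map Y (simplex_top n) f"
  using assms by (auto simp: continuous_map_in_subtopology continuous_map_componentwise_UNIV)

lemma continuous_map_simplex_coord: "continuous_map (simplex_top n) euclideanreal (\<lambda>t. t i)"
  by (intro continuous_map_from_subtopology continuous_map_product_projection) simp

text \<open>The point of the standard \<open>1\<close>-simplex with barycentric coordinates \<open>(1 - t, t)\<close>.\<close>

definition seg :: "real \<Rightarrow> nat \<Rightarrow> real" where
  "seg t = (\<lambda>i. if i = 0 then 1 - t else if i = 1 then t else 0)"

lemma seg_in_simplex [simp]: "t \<in> {0..1} \<Longrightarrow> seg t \<in> standard_simplex (Suc 0)"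
  by (auto simp: seg_def standard_simplex_def)

lemma seg_coord [simp]: "seg t 0 = 1 - t" "seg t (Suc 0) = t"
  by (auto simp: seg_def)

lemma simplex_1_eq_seg:
  assumes "s \<in> standard_simplex 1"
  shows "s (Suc 0) \<in> {0..1}" "seg (s (Suc 0)) = s"
proof -
  have s: "s 0 + s 1 = 1" "\<And>i. 1 < i \<Longrightarrow> s i = 0" "0 \<le> s (Suc 0)" "s (Suc 0) \<le> 1"
    using assms by (auto simp: standard_simplex_def)
  show "s (Suc 0) \<in> {0..1}" using s by simp
  show "seg (s (Suc 0)) = s"
  proof
    fix i show "seg (s (Suc 0)) i = s i"
      using s(1) s(2)[of i] by (auto simp: seg_def)
  qed
qed

lemma continuous_map_seg: "continuous_map unit_interval (simplex_top 1) seg"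
proof (rule continuous_map_into_simplex)
  show "continuous_map unit_interval euclideanreal (\<lambda>t. seg t i)" for i
    by (cases "i = 0"; cases "i = 1") (auto simp: seg_def intro!: continuous_intros)
qed simp

lemma path_simplex_apply [simp]: "s \<in> standard_simplex (Suc 0) \<Longrightarrow> path_simplex L s = L (s (Suc 0))"
  by (simp add: path_simplex_def)

lemma path_simplex_cong:
  assumes "\<And>t. t \<in> {0..1} \<Longrightarrow> L t = L' t"
  shows "path_simplex L = path_simplex L'"
  unfolding path_simplex_def using assms simplex_1_eq_seg(1) by (auto intro!: restrict_ext)

lemma singular_simplex_path_simplex:
  assumes "pathin X L" shows "singular_simplex 1 X (path_simplex L)"
  unfolding singular_simplex_def
proof
  have "continuous_map (simplex_top 1) unit_interval (\<lambda>s. s (Suc 0))"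
    using continuous_map_simplex_coord[of 1 "Suc 0"] simplex_1_eq_seg(1)
    by (simp add: continuous_map_in_subtopology)
  then have "continuous_map (simplex_top 1) X (L \<circ> (\<lambda>s. s (Suc 0)))"
    using assms continuous_map_compose unfolding pathin_def by blast
  then show "continuous_map (simplex_top 1) X (path_simplex L)"
    by (rule continuous_map_eq) simp
qed (simp add: path_simplex_def)

lemma singular_1_simplex_eq:
  assumes "singular_simplex 1 X \<sigma>"
  shows "pathin X (\<sigma> \<circ> seg)" "path_simplex (\<sigma> \<circ> seg) = \<sigma>"
proof -
  have \<sigma>: "continuous_map (simplex_top 1) X \<sigma>" "\<sigma> \<in> extensional (standard_simplex 1)"
    using assms by (auto simp: singular_simplex_def)
  show "pathin X (\<sigma> \<circ> seg)"
    unfolding pathin_def by (rule continuous_map_compose[OF continuous_map_seg \<sigma>(1)])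
  show "path_simplex (\<sigma> \<circ> seg) = \<sigma>"
    by (rule extensionalityI[OF _ \<sigma>(2)])
       (use simplex_1_eq_seg(2) in \<open>auto simp: path_simplex_def\<close>)
qed

text \<open>The point with barycentric coordinates \<open>(a, b, c)\<close>.\<close>

definition tri :: "real \<Rightarrow> real \<Rightarrow> real \<Rightarrow> nat \<Rightarrow> real" where
  "tri a b c = (\<lambda>i. if i = 0 then a else if i = 1 then b else if i = 2 then c else 0)"

lemma tri_coord [simp]: "tri a b c 0 = a" "tri a b c (Suc 0) = b" "tri a b c 2 = c"
  by (auto simp: tri_def)

lemma tri_in_simplex:
  "0 \<le> a \<Longrightarrow> 0 \<le> b \<Longrightarrow> 0 \<le> c \<Longrightarrow> a + b + c = 1 \<Longrightarrow> tri a b c \<in> standard_simplex 2"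
  by (auto simp: tri_def standard_simplex_def numeral_2_eq_2)

lemma singular_face_2:
  assumes "\<And>s. s \<in> {0..1} \<Longrightarrow> \<sigma> (tri 0 (1 - s) s) = f (tri 0 (1 - s) s)"
    "\<And>s. s \<in> {0..1} \<Longrightarrow> \<sigma> (tri (1 - s) 0 s) = f (tri (1 - s) 0 s)"
    "\<And>s. s \<in> {0..1} \<Longrightarrow> \<sigma> (tri (1 - s) s 0) = f (tri (1 - s) s 0)"
  shows "singular_face 2 0 \<sigma> = path_simplex (\<lambda>s. f (tri 0 (1 - s) s))"
    "singular_face 2 (Suc 0) \<sigma> = path_simplex (\<lambda>s. f (tri (1 - s) 0 s))"
    "singular_face 2 2 \<sigma> = path_simplex (\<lambda>s. f (tri (1 - s) s 0))"
proof -
  have *: "simplical_face 0 s = tri 0 (1 - s (Suc 0)) (s (Suc 0)) \<and>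
      simplical_face (Suc 0) s = tri (1 - s (Suc 0)) 0 (s (Suc 0)) \<and>
      simplical_face 2 s = tri (1 - s (Suc 0)) (s (Suc 0)) 0" if "s \<in> standard_simplex 1" for s
  proof -
    have s: "s 0 = 1 - s (Suc 0)" "\<And>i. 1 < i \<Longrightarrow> s i = 0"
      using that by (auto simp: standard_simplex_def algebra_simps)
    have "simplical_face 0 s i = tri 0 (1 - s (Suc 0)) (s (Suc 0)) i \<and>
      simplical_face (Suc 0) s i = tri (1 - s (Suc 0)) 0 (s (Suc 0)) i \<and>
      simplical_face 2 s i = tri (1 - s (Suc 0)) (s (Suc 0)) 0 i" for i
    proof -
      consider "i = 0" | "i = Suc 0" | "i = 2" | "i > 2" by linarith
      then show ?thesis
        using s(1) s(2)[of i] s(2)[of "i - 1"] by cases (auto simp: simplical_face_def tri_def)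
    qed
    then show ?thesis by auto
  qed
  show "singular_face 2 0 \<sigma> = path_simplex (\<lambda>s. f (tri 0 (1 - s) s))"
    "singular_face 2 (Suc 0) \<sigma> = path_simplex (\<lambda>s. f (tri (1 - s) 0 s))"
    "singular_face 2 2 \<sigma> = path_simplex (\<lambda>s. f (tri (1 - s) s 0))"
    unfolding singular_face_def path_simplex_def
    using * assms simplex_1_eq_seg(1) by (auto intro!: restrict_ext)
qed

lemma cochain_1_value:
  assumes "c \<in> cochains 1 X" "pathin X L"
  shows "c (path_simplex L) = 1 \<or> c (path_simplex L) = -1"
  using assms singular_simplex_path_simplex[OF assms(2)] by (auto simp: cochains_def PiE_iff)

lemma cocycle_imp_cochain: "c \<in> cocycles p X \<Longrightarrow> c \<in> cochains p X"
  by (simp add: cocycles_def)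

lemma coboundary_1_apply:
  assumes "singular_simplex 2 X \<sigma>"
  shows "coboundary 1 X c \<sigma> =
      c (path_simplex (\<lambda>s. \<sigma> (tri 0 (1 - s) s))) * c (path_simplex (\<lambda>s. \<sigma> (tri (1 - s) 0 s)))
       * c (path_simplex (\<lambda>s. \<sigma> (tri (1 - s) s 0)))"
proof -
  have "{..2::nat} = {0, Suc 0, 2}" by auto
  then show ?thesis
    using assms singular_face_2[of \<sigma> \<sigma>] by (simp add: coboundary_def numeral_2_eq_2[symmetric])
qed

text \<open>The cocycle condition for a triangle whose vertices are \<open>0, 1, 2\<close>, with its three edges as paths.
  The map need not be extensional.\<close>

lemma cocycle_triangle:
  assumes c: "c \<in> cocycles 1 X" and f: "continuous_map (simplex_top 2) X f"
  shows "c (path_simplex (\<lambda>s. f (tri 0 (1 - s) s))) * c (path_simplex (\<lambda>s. f (tri (1 - s) 0 s)))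
       * c (path_simplex (\<lambda>s. f (tri (1 - s) s 0))) = 1"
proof -
  let ?\<sigma> = "restrict f (standard_simplex 2)"
  have "continuous_map (simplex_top 2) X ?\<sigma>"
    by (rule continuous_map_eq[OF f]) simp
  then have \<sigma>: "singular_simplex 2 X ?\<sigma>"
    by (simp add: singular_simplex_def)
  have "coboundary 1 X c ?\<sigma> = 1"
    using c \<sigma> by (auto simp: cocycles_def numeral_2_eq_2)
  moreover have "path_simplex (\<lambda>s. ?\<sigma> (tri 0 (1 - s) s)) = path_simplex (\<lambda>s. f (tri 0 (1 - s) s))"
    "path_simplex (\<lambda>s. ?\<sigma> (tri (1 - s) 0 s)) = path_simplex (\<lambda>s. f (tri (1 - s) 0 s))"
    "path_simplex (\<lambda>s. ?\<sigma> (tri (1 - s) s 0)) = path_simplex (\<lambda>s. f (tri (1 - s) s 0))"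
    by (rule path_simplex_cong, simp add: tri_in_simplex)+
  ultimately show ?thesis
    using coboundary_1_apply[OF \<sigma>] by simp
qed

lemma cocycle_const:
  assumes "c \<in> cocycles 1 X" "x \<in> topspace X"
  shows "c (path_simplex (\<lambda>_. x)) = 1"
  using cocycle_triangle[of c X "\<lambda>_. x"] assms
    cochain_1_value[OF cocycle_imp_cochain[OF assms(1)], of "\<lambda>_. x"]
  by auto

lemma cocycle_concat:
  assumes c: "c \<in> cocycles 1 X" and pq: "pathin X p" "pathin X q" "p 1 = q 0"
  shows "c (path_simplex (path_concat p q)) = c (path_simplex p) * c (path_simplex q)"
proof -
  let ?f = "\<lambda>t::nat\<Rightarrow>real. path_concat p q (t 1 / 2 + t 2)"
  have "continuous_map (simplex_top 2) unit_interval (\<lambda>t. t 1 / 2 + t 2)"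
    unfolding continuous_map_in_subtopology
  proof
    show "continuous_map (simplex_top 2) euclideanreal (\<lambda>t. t 1 / 2 + t 2)"
      by (intro continuous_intros continuous_map_simplex_coord) simp
    show "(\<lambda>t. t 1 / 2 + t 2) \<in> topspace (simplex_top 2) \<rightarrow> {0..1}"
      by (auto simp: standard_simplex_def numeral_2_eq_2)
         (smt (verit, best) field_sum_of_halves)
  qed
  then have f: "continuous_map (simplex_top 2) X ?f"
    using continuous_map_compose pathin_path_concat[OF pq] unfolding pathin_def o_def by fast
  have "path_simplex (\<lambda>s. ?f (tri 0 (1 - s) s)) = path_simplex q"
    by (rule path_simplex_cong)
       (use pq(3) in \<open>auto simp: path_concat_def field_simps\<close>)
  moreover have "path_simplex (\<lambda>s. ?f (tri (1 - s) 0 s)) = path_simplex (path_concat p q)"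
    "path_simplex (\<lambda>s. ?f (tri (1 - s) s 0)) = path_simplex p"
    by (rule path_simplex_cong, auto simp: path_concat_def)+
  ultimately have "c (path_simplex q) * c (path_simplex (path_concat p q)) * c (path_simplex p) = 1"
    using cocycle_triangle[OF c f] by simp
  then show ?thesis
    using cochain_1_value[OF cocycle_imp_cochain[OF c] pq(1)]
      cochain_1_value[OF cocycle_imp_cochain[OF c] pq(2)] by auto
qed

lemma pathin_square_edge:
  assumes h: "continuous_map unit_square X h" and a: "a \<in> {0..1}"
  shows "pathin X (\<lambda>t. h (a, t))" "pathin X (\<lambda>t. h (t, a))"
proof -
  have "continuous_map unit_interval unit_square (\<lambda>t. (a, t))"
    "continuous_map unit_interval unit_square (\<lambda>t. (t, a))"
    by (intro continuous_map_pairedI; use a in simp)+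
  from this[THEN continuous_map_compose, OF h]
  show "pathin X (\<lambda>t. h (a, t))" "pathin X (\<lambda>t. h (t, a))"
    unfolding pathin_def o_def .
qed

text \<open>Cutting a square along its diagonal, the values of a cocycle on the two ways around agree.\<close>

lemma cocycle_square:
  assumes c: "c \<in> cocycles 1 X" and h: "continuous_map unit_square X h"
  shows "c (path_simplex (\<lambda>t. h (t, 0))) * c (path_simplex (\<lambda>t. h (1, t)))
       = c (path_simplex (\<lambda>t. h (0, t))) * c (path_simplex (\<lambda>t. h (t, 1)))"
proof -
  have coord: "continuous_map (simplex_top 2) unit_interval (\<lambda>t. t 1 + t 2)"
    "continuous_map (simplex_top 2) unit_interval (\<lambda>t. t 2)"
  proof -
    have "t 1 + t 2 \<in> {0..1}" "t 2 \<in> {0..1}" if "t \<in> standard_simplex 2" for t :: "nat \<Rightarrow> real"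
    proof -
      have "t 0 + t 1 + t 2 = 1" "0 \<le> t 0" "0 \<le> t 1" "0 \<le> t 2"
        using that by (auto simp: standard_simplex_def numeral_2_eq_2)
      then show "t 1 + t 2 \<in> {0..1}" "t 2 \<in> {0..1}" by auto
    qed
    then show "continuous_map (simplex_top 2) unit_interval (\<lambda>t. t 1 + t 2)"
      "continuous_map (simplex_top 2) unit_interval (\<lambda>t. t 2)"
      by (auto simp: continuous_map_in_subtopology intro!: continuous_map_simplex_coord
          continuous_map_add)
  qed
  have "continuous_map (simplex_top 2) unit_square (\<lambda>t. (t 1 + t 2, t 2))"
    "continuous_map (simplex_top 2) unit_square (\<lambda>t. (t 2, t 1 + t 2))"
    by (intro continuous_map_pairedI coord)+
  from this[THEN continuous_map_compose, OF h]
  have f: "continuous_map (simplex_top 2) X (\<lambda>t. h (t 1 + t 2, t 2))"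
    "continuous_map (simplex_top 2) X (\<lambda>t. h (t 2, t 1 + t 2))"
    unfolding o_def .
  note pm = cochain_1_value[OF cocycle_imp_cochain[OF c]]
  note edge = pathin_square_edge[OF h]
  have "c (path_simplex (\<lambda>t. h (1, t))) * c (path_simplex (\<lambda>t. h (t, t)))
      * c (path_simplex (\<lambda>t. h (t, 0))) = 1"
    using cocycle_triangle[OF c f(1)] by simp
  moreover have "c (path_simplex (\<lambda>t. h (t, 1))) * c (path_simplex (\<lambda>t. h (t, t)))
      * c (path_simplex (\<lambda>t. h (0, t))) = 1"
    using cocycle_triangle[OF c f(2)] by simp
  ultimately show ?thesis
    using pm[OF edge(1)[of 1]] pm[OF edge(2)[of 0]] pm[OF edge(1)[of 0]] pm[OF edge(2)[of 1]]
    by auto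
qed

section \<open>Systems and one-cocycles\<close>

text \<open>The system of a one-cocycle sends a path to the value of the cocycle on the path, seen as a singular
  simplex. On a class of paths it is computed from an arbitrary representative.\<close>

definition system_of :: "'a topology \<Rightarrow> 'a cochain \<Rightarrow> 'a sys" where
  "system_of X c = (\<lambda>a\<in>path_groupoid X. c (path_simplex (SOME p. p \<in> a)))"

lemma cocycle_path_class:
  assumes c: "c \<in> cocycles 1 X" and q: "q \<in> path_class X p"
  shows "c (path_simplex q) = c (path_simplex p)"
proof -
  obtain h where h: "continuous_map unit_square X h"
    "\<And>t. h (0, t) = p t" "\<And>t. h (1, t) = q t"
    "\<And>s. s \<in> {0..1} \<Longrightarrow> h (s, 0) = p 0 \<and> h (s, 1) = p 1"
    using path_classE[OF q] by metis
  note p = path_class_memD(1)[OF q]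
  have "path_simplex (\<lambda>t. h (t, 0)) = path_simplex (\<lambda>_. p 0)"
    "path_simplex (\<lambda>t. h (t, 1)) = path_simplex (\<lambda>_. p 1)"
    using h(4) by (auto intro!: path_simplex_cong)
  then show ?thesis
    using cocycle_square[OF c h(1)] h(2,3) cocycle_const[OF c] path_start_in_topspace[OF p]
      path_finish_in_topspace[OF p] by simp
qed

lemma system_of_path_class:
  assumes "c \<in> cocycles 1 X" "pathin X p"
  shows "system_of X c (path_class X p) = c (path_simplex p)"
proof -
  have "(SOME q. q \<in> path_class X p) \<in> path_class X p"
    using someI[of "\<lambda>q. q \<in> path_class X p", OF path_class_self[OF assms(2)]] .
  then show ?thesis
    using assms cocycle_path_class by (simp add: system_of_def)
qed

lemma Zt_system_system_of:
  assumes c: "c \<in> cocycles 1 X"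
  shows "Zt_system X (system_of X c)"
  unfolding Zt_system_def
proof (intro conjI allI impI PiE_I)
  show "system_of X c a \<in> {1, -1}" if a: "a \<in> path_groupoid X" for a
  proof -
    obtain p where "pathin X p" "a = path_class X p"
      using a by (auto simp: path_groupoid_def)
    then show ?thesis
      using system_of_path_class[OF c] cochain_1_value[OF cocycle_imp_cochain[OF c]] by auto
  qed
  show "system_of X c (class_concat X (path_class X p) (path_class X q)) =
      system_of X c (path_class X p) * system_of X c (path_class X q)"
    if "pathin X p" "pathin X q" "p 1 = q 0" for p q
    using that c by (simp add: class_concat_path_class system_of_path_class cocycle_concat
        pathin_path_concat)
qed (simp add: system_of_def)

text \<open>Conversely, the one-cocycle of a system evaluates the system on the path that traverses a singular
  \<open>1\<close>-simplex.\<close>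

definition cocycle_of :: "'a topology \<Rightarrow> 'a sys \<Rightarrow> 'a cochain" where
  "cocycle_of X \<Lambda> = (\<lambda>\<sigma>\<in>singular_simplex_set 1 X. \<Lambda> (path_class X (\<sigma> \<circ> seg)))"

lemma cocycle_of_path_simplex:
  assumes "pathin X L"
  shows "cocycle_of X \<Lambda> (path_simplex L) = \<Lambda> (path_class X L)"
proof -
  have "path_class X (path_simplex L \<circ> seg) = path_class X L"
    by (rule path_class_cong) (use singular_1_simplex_eq(1) singular_simplex_path_simplex[OF assms] in auto)
  then show ?thesis
    using singular_simplex_path_simplex[OF assms] by (simp add: cocycle_of_def)
qed

lemma Zt_system_value:
  "Zt_system X \<Lambda> \<Longrightarrow> pathin X p \<Longrightarrow> \<Lambda> (path_class X p) = 1 \<or> \<Lambda> (path_class X p) = -1"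
  by (auto simp: Zt_system_def PiE_iff)

lemma Zt_system_concat:
  "Zt_system X \<Lambda> \<Longrightarrow> pathin X p \<Longrightarrow> pathin X q \<Longrightarrow> p 1 = q 0 \<Longrightarrow>
    \<Lambda> (path_class X (path_concat p q)) = \<Lambda> (path_class X p) * \<Lambda> (path_class X q)"
  by (metis Zt_system_def class_concat_path_class)

text \<open>In a triangle, going through vertex \<open>1\<close> is homotopic to the edge from \<open>0\<close> to \<open>2\<close>; this is what makes
  \<open>cocycle_of X \<Lambda>\<close> a cocycle.\<close>

lemma path_class_triangle:
  assumes \<sigma>: "continuous_map (simplex_top 2) X \<sigma>"
  shows "path_class X (path_concat (\<lambda>s. \<sigma> (tri (1 - s) s 0)) (\<lambda>s. \<sigma> (tri 0 (1 - s) s)))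
      = path_class X (\<lambda>s. \<sigma> (tri (1 - s) 0 s))"
proof (rule path_class_eqI)
  \<comment> \<open>Linear interpolation from the broken line through vertex 1 to the edge \<open>02\<close>.\<close>
  define H where "H = (\<lambda>z::real\<times>real.
     tri ((1 - fst z) * max 0 (1 - 2 * snd z) + fst z * (1 - snd z))
         ((1 - fst z) * (1 - \<bar>1 - 2 * snd z\<bar>))
         ((1 - fst z) * max 0 (2 * snd z - 1) + fst z * snd z))"
  have "continuous_map unit_square (simplex_top 2) H"
  proof (rule continuous_map_into_simplex)
    fix i
    show "continuous_map unit_square euclideanreal (\<lambda>z. H z i)"
    proof -
      consider "i = 0" | "i = 1" | "i = 2" | "i > 2" by linarith
      then show ?thesis
        by cases (auto simp: H_def tri_def intro!: continuous_intros continuous_map_square_parts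
            continuous_map_real_max continuous_map_real_abs)
    qed
  next
    fix z assume "z \<in> topspace unit_square"
    then have z: "0 \<le> fst z" "fst z \<le> 1" "0 \<le> snd z" "snd z \<le> 1" by auto
    have sum: "max 0 (1 - 2 * snd z) + (1 - \<bar>1 - 2 * snd z\<bar>) + max 0 (2 * snd z - 1) = 1"
      by (simp add: abs_if max_def)
    have "((1 - fst z) * max 0 (1 - 2 * snd z) + fst z * (1 - snd z))
        + ((1 - fst z) * (1 - \<bar>1 - 2 * snd z\<bar>))
        + ((1 - fst z) * max 0 (2 * snd z - 1) + fst z * snd z)
        = (1 - fst z) * (max 0 (1 - 2 * snd z) + (1 - \<bar>1 - 2 * snd z\<bar>) + max 0 (2 * snd z - 1))
          + fst z"
      by (simp add: algebra_simps)
    also have "\<dots> = 1" unfolding sum by simp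
    finally show "H z \<in> standard_simplex 2"
      unfolding H_def using z by (intro tri_in_simplex add_nonneg_nonneg mult_nonneg_nonneg) auto
  qed
  then show "continuous_map unit_square X (\<sigma> \<circ> H)"
    by (rule continuous_map_compose[OF _ \<sigma>])
  show "(\<sigma> \<circ> H) (0, t) = path_concat (\<lambda>s. \<sigma> (tri (1 - s) s 0)) (\<lambda>s. \<sigma> (tri 0 (1 - s) s)) t"
    for t
    by (cases "2 * t = 1") (auto simp: H_def path_concat_def max_def)
qed (auto simp: path_concat_def)


lemma pathin_simplex_edges:
  assumes "singular_simplex 2 X \<sigma>"
  shows "pathin X (\<lambda>s. \<sigma> (tri 0 (1 - s) s))" "pathin X (\<lambda>s. \<sigma> (tri (1 - s) 0 s))"
    "pathin X (\<lambda>s. \<sigma> (tri (1 - s) s 0))"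
proof -
  have \<sigma>: "continuous_map (simplex_top 2) X \<sigma>" using assms by (simp add: singular_simplex_def)
  have edge: "pathin X (\<lambda>s. \<sigma> (tri (a s) (b s) (c s)))"
    if "continuous_map unit_interval euclideanreal a" "continuous_map unit_interval euclideanreal b"
      "continuous_map unit_interval euclideanreal c"
      "\<And>s. s \<in> {0..1} \<Longrightarrow> tri (a s) (b s) (c s) \<in> standard_simplex 2" for a b c
  proof -
    have "continuous_map unit_interval euclideanreal (\<lambda>s. tri (a s) (b s) (c s) i)" for i
      using that(1-3) by (cases "i = 0"; cases "i = 1"; cases "i = 2") (auto simp: tri_def)
    then have "continuous_map unit_interval (simplex_top 2) (\<lambda>s. tri (a s) (b s) (c s))"
      using that(4) by (intro continuous_map_into_simplex) simp_all
    then show ?thesis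
      unfolding pathin_def using continuous_map_compose[OF _ \<sigma>, unfolded o_def] by blast
  qed
  show "pathin X (\<lambda>s. \<sigma> (tri 0 (1 - s) s))" "pathin X (\<lambda>s. \<sigma> (tri (1 - s) 0 s))"
    "pathin X (\<lambda>s. \<sigma> (tri (1 - s) s 0))"
    by (rule edge; auto intro!: continuous_intros tri_in_simplex)+
qed

lemma cocycle_of_cocycle:
  assumes \<Lambda>: "Zt_system X \<Lambda>"
  shows "cocycle_of X \<Lambda> \<in> cocycles 1 X"
  unfolding cocycles_def
proof (intro CollectI conjI allI impI)
  show "cocycle_of X \<Lambda> \<in> cochains 1 X"
    unfolding cochains_def
  proof (rule PiE_I)
    fix \<sigma> assume "\<sigma> \<in> singular_simplex_set 1 X"
    then show "cocycle_of X \<Lambda> \<sigma> \<in> {1, -1}"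
      using Zt_system_value[OF \<Lambda> singular_1_simplex_eq(1)] by (simp add: cocycle_of_def)
  qed (simp add: cocycle_of_def)
next
  fix \<sigma> assume "singular_simplex (Suc 1) X \<sigma>"
  then have s2: "singular_simplex 2 X \<sigma>" by (simp add: numeral_2_eq_2)
  then have \<sigma>: "continuous_map (simplex_top 2) X \<sigma>" by (simp add: singular_simplex_def)
  note p = pathin_simplex_edges[OF s2]
  note v = Zt_system_value[OF \<Lambda>]
  show "coboundary 1 X (cocycle_of X \<Lambda>) \<sigma> = 1"
    using Zt_system_concat[OF \<Lambda> p(3) p(1)] path_class_triangle[OF \<sigma>] v[OF p(1)] v[OF p(3)]
    unfolding coboundary_1_apply[OF s2]
    by (auto simp: cocycle_of_path_simplex p)
qed

section \<open>Cohomology classes in degree one\<close>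

text \<open>Cohomology in degree one, on the level of paths: the values on a path differ by the product of the
  values of a function at its two endpoints.\<close>

definition cohomologous :: "'a topology \<Rightarrow> 'a cochain \<Rightarrow> 'a cochain \<Rightarrow> bool" where
  "cohomologous X c d \<longleftrightarrow> (\<exists>e \<in> topspace X \<rightarrow> {1, -1}. \<forall>L. pathin X L \<longrightarrow>
      d (path_simplex L) = c (path_simplex L) * (e (L 0) * e (L 1)))"

abbreviation point_simplex :: "'a \<Rightarrow> (nat \<Rightarrow> real) \<Rightarrow> 'a" where
  "point_simplex x \<equiv> \<lambda>s\<in>standard_simplex 0. x"

lemma singular_simplex_point_simplex: "x \<in> topspace X \<Longrightarrow> singular_simplex 0 X (point_simplex x)"
  unfolding singular_simplex_def
  using continuous_map_eq[of "simplex_top 0" X "\<lambda>_. x" "point_simplex x"] by simp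

lemma singular_face_path_simplex:
  "singular_face 1 0 (path_simplex L) = point_simplex (L 1)"
  "singular_face 1 1 (path_simplex L) = point_simplex (L 0)"
proof -
  have "simplical_face 0 s = seg 1" "simplical_face (Suc 0) s = seg 0"
    if "s \<in> standard_simplex 0" for s :: "nat \<Rightarrow> real"
    using that by (auto simp: simplical_face_def seg_def standard_simplex_0)
  then show "singular_face 1 0 (path_simplex L) = point_simplex (L 1)"
    "singular_face 1 1 (path_simplex L) = point_simplex (L 0)"
    unfolding singular_face_def by (auto intro!: restrict_ext)
qed

lemma coboundary_0_path_simplex:
  assumes "pathin X L"
  shows "coboundary 0 X b (path_simplex L) = b (point_simplex (L 0)) * b (point_simplex (L 1))"
  using singular_simplex_path_simplex[OF assms] singular_face_path_simplex[of L]
  by (simp add: coboundary_def)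

lemma cochains_1_eqI:
  assumes "c \<in> extensional (singular_simplex_set 1 X)" "d \<in> extensional (singular_simplex_set 1 X)"
    and "\<And>L. pathin X L \<Longrightarrow> c (path_simplex L) = d (path_simplex L)"
  shows "c = d"
proof (rule extensionalityI[OF assms(1,2)])
  fix \<sigma> assume "\<sigma> \<in> singular_simplex_set 1 X"
  then have \<sigma>: "singular_simplex 1 X \<sigma>" by simp
  show "c \<sigma> = d \<sigma>"
    using assms(3)[OF singular_1_simplex_eq(1)[OF \<sigma>]] unfolding singular_1_simplex_eq(2)[OF \<sigma>] .
qed

lemma cochains_extensional: "c \<in> cochains p X \<Longrightarrow> c \<in> extensional (singular_simplex_set p X)"
  by (simp add: cochains_def PiE_iff)

lemma mem_cohomology_class_iff:
  assumes c: "c \<in> cochains 1 X"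
  shows "d \<in> cohomology_class 1 X c \<longleftrightarrow> d \<in> cochains 1 X \<and> cohomologous X c d"
proof
  assume "d \<in> cohomology_class 1 X c"
  then obtain b where b: "b \<in> cochains 0 X"
    and d: "d = (\<lambda>\<sigma>\<in>singular_simplex_set 1 X. c \<sigma> * coboundary 0 X b \<sigma>)"
    by (auto simp: cohomology_class_def)
  have e: "(\<lambda>x. b (point_simplex x)) \<in> topspace X \<rightarrow> {1, -1}"
    using b singular_simplex_point_simplex by (fastforce simp: cochains_def PiE_iff)
  have val: "d (path_simplex L) = c (path_simplex L) * (b (point_simplex (L 0)) * b (point_simplex (L 1)))"
    if "pathin X L" for L
    using that coboundary_0_path_simplex[OF that] singular_simplex_path_simplex[OF that]
    by (simp add: d)
  have "d \<in> cochains 1 X"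
    unfolding cochains_def
  proof (rule PiE_I)
    fix \<sigma> assume "\<sigma> \<in> singular_simplex_set 1 X"
    then obtain L where L: "pathin X L" "\<sigma> = path_simplex L"
      using singular_1_simplex_eq by (metis mem_Collect_eq)
    have "b (point_simplex (L 0)) \<in> {1, -1}" "b (point_simplex (L 1)) \<in> {1, -1}"
      using e path_start_in_topspace[OF L(1)] path_finish_in_topspace[OF L(1)] by blast+
    then show "d \<sigma> \<in> {1, -1}"
      using val[OF L(1)] cochain_1_value[OF c L(1)] L(2) by auto
  qed (simp add: d)
  then show "d \<in> cochains 1 X \<and> cohomologous X c d"
    unfolding cohomologous_def using val by (intro conjI bexI[OF _ e]) auto
next
  assume "d \<in> cochains 1 X \<and> cohomologous X c d"
  then obtain e where d: "d \<in> cochains 1 X" and e: "e \<in> topspace X \<rightarrow> {1, -1}"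
    and val: "\<And>L. pathin X L \<Longrightarrow> d (path_simplex L) = c (path_simplex L) * (e (L 0) * e (L 1))"
    unfolding cohomologous_def by blast
  define b where "b = (\<lambda>\<sigma>\<in>singular_simplex_set 0 X. e (\<sigma> (\<lambda>j. if j = 0 then 1 else 0)))"
  have v0: "(\<lambda>j. if j = 0 then 1 else 0) \<in> standard_simplex 0"
    by (simp add: standard_simplex_0)
  have "b \<in> cochains 0 X"
    unfolding cochains_def
  proof (rule PiE_I)
    fix \<sigma> assume "\<sigma> \<in> singular_simplex_set 0 X"
    moreover from this have "\<sigma> (\<lambda>j. if j = 0 then 1 else 0) \<in> topspace X"
      using v0 by (auto simp: singular_simplex_def continuous_map_def)
    ultimately show "b \<sigma> \<in> {1, -1}" using e by (auto simp: b_def)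
  qed (simp add: b_def)
  moreover have "d = (\<lambda>\<sigma>\<in>singular_simplex_set 1 X. c \<sigma> * coboundary 0 X b \<sigma>)"
  proof (rule cochains_1_eqI)
    show "d \<in> extensional (singular_simplex_set 1 X)" by (rule cochains_extensional[OF d])
    fix L assume L: "pathin X L"
    have "b (point_simplex (L 0)) = e (L 0)" "b (point_simplex (L 1)) = e (L 1)"
      using singular_simplex_point_simplex[OF path_start_in_topspace[OF L]]
        singular_simplex_point_simplex[OF path_finish_in_topspace[OF L]] v0
      by (auto simp: b_def)
    then show "d (path_simplex L) = (\<lambda>\<sigma>\<in>singular_simplex_set 1 X. c \<sigma> * coboundary 0 X b \<sigma>) (path_simplex L)"
      using val[OF L] coboundary_0_path_simplex[OF L] singular_simplex_path_simplex[OF L] by simp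
  qed simp
  ultimately show "d \<in> cohomology_class 1 X c"
    by (auto simp: cohomology_class_def)
qed

lemma cohomologous_refl: "cohomologous X c c"
  unfolding cohomologous_def by (rule bexI[of _ "\<lambda>_. 1"]) auto

lemma cohomologous_sym:
  assumes "cohomologous X c d" shows "cohomologous X d c"
proof -
  obtain e where e: "e \<in> topspace X \<rightarrow> {1, -1}"
    and val: "\<And>L. pathin X L \<Longrightarrow> d (path_simplex L) = c (path_simplex L) * (e (L 0) * e (L 1))"
    using assms unfolding cohomologous_def by blast
  have "c (path_simplex L) = d (path_simplex L) * (e (L 0) * e (L 1))" if L: "pathin X L" for L
  proof -
    have "e (L 0) \<in> {1, -1}" "e (L 1) \<in> {1, -1}"
      using e path_start_in_topspace[OF L] path_finish_in_topspace[OF L] by blast+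
    then show ?thesis using val[OF L] by auto
  qed
  then show ?thesis unfolding cohomologous_def using e by blast
qed

lemma cohomologous_trans:
  assumes "cohomologous X c d" "cohomologous X d d'" shows "cohomologous X c d'"
proof -
  obtain e where e: "e \<in> topspace X \<rightarrow> {1, -1}"
    and val: "\<And>L. pathin X L \<Longrightarrow> d (path_simplex L) = c (path_simplex L) * (e (L 0) * e (L 1))"
    using assms(1) unfolding cohomologous_def by blast
  obtain f where f: "f \<in> topspace X \<rightarrow> {1, -1}"
    and val': "\<And>L. pathin X L \<Longrightarrow> d' (path_simplex L) = d (path_simplex L) * (f (L 0) * f (L 1))"
    using assms(2) unfolding cohomologous_def by blast
  have "(\<lambda>x. e x * f x) \<in> topspace X \<rightarrow> {1, -1}"
    using e f by (fastforce simp: Pi_iff)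
  then show ?thesis
    unfolding cohomologous_def
    by (rule bexI[rotated]) (simp add: val val' algebra_simps)
qed

lemma cohomology_class_eq_iff:
  assumes c: "c \<in> cochains 1 X" and d: "d \<in> cochains 1 X"
  shows "cohomology_class 1 X c = cohomology_class 1 X d \<longleftrightarrow> cohomologous X c d"
proof
  assume "cohomology_class 1 X c = cohomology_class 1 X d"
  then show "cohomologous X c d"
    using mem_cohomology_class_iff[OF d, of d] mem_cohomology_class_iff[OF c, of d]
      cohomologous_refl[of X d] d by blast
next
  assume "cohomologous X c d"
  then have "cohomologous X c b \<longleftrightarrow> cohomologous X d b" for b
    using cohomologous_sym cohomologous_trans by metis
  then show "cohomology_class 1 X c = cohomology_class 1 X d"
    using mem_cohomology_class_iff[OF c] mem_cohomology_class_iff[OF d] by blast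
qed

lemma cohomologous_cocycle:
  assumes c: "c \<in> cocycles 1 X" and d: "d \<in> cochains 1 X" and cd: "cohomologous X c d"
  shows "d \<in> cocycles 1 X"
  unfolding cocycles_def
proof (intro CollectI conjI allI impI d)
  fix \<sigma> assume s: "singular_simplex (Suc 1) X \<sigma>"
  obtain e where e: "e \<in> topspace X \<rightarrow> {1, -1}"
    and val: "\<And>L. pathin X L \<Longrightarrow> d (path_simplex L) = c (path_simplex L) * (e (L 0) * e (L 1))"
    using cd unfolding cohomologous_def by blast
  have s2: "singular_simplex 2 X \<sigma>" using s by (simp add: numeral_2_eq_2)
  have p: "pathin X (\<lambda>s. \<sigma> (tri 0 (1 - s) s))" "pathin X (\<lambda>s. \<sigma> (tri (1 - s) 0 s))"
    "pathin X (\<lambda>s. \<sigma> (tri (1 - s) s 0))"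
    using pathin_simplex_edges[OF s2] by auto
  have "\<sigma> t \<in> topspace X" if "t \<in> standard_simplex 2" for t
    using s2 that by (auto simp: singular_simplex_def continuous_map_def)
  then have "e (\<sigma> (tri 1 0 0)) \<in> {1, -1}" "e (\<sigma> (tri 0 1 0)) \<in> {1, -1}" "e (\<sigma> (tri 0 0 1)) \<in> {1, -1}"
    using e by (auto simp: Pi_iff tri_in_simplex)
  moreover have "coboundary 1 X c \<sigma> = 1" using c s by (simp add: cocycles_def)
  ultimately show "coboundary 1 X d \<sigma> = 1"
    unfolding coboundary_1_apply[OF s2] val[OF p(1)] val[OF p(2)] val[OF p(3)] by auto
qed

lemma H1E:
  assumes "w \<in> H1 X"
  obtains c where "c \<in> cocycles 1 X" "w = cohomology_class 1 X c"
  using assms by (auto simp: cohomology_def)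

lemma cocycle_mem_class: "c \<in> cocycles 1 X \<Longrightarrow> c \<in> cohomology_class 1 X c"
  using mem_cohomology_class_iff cohomologous_refl cocycle_imp_cochain by blast

lemma loop_value_class:
  assumes c: "c \<in> cocycles 1 X" and L: "pathin X L" "L 0 = L 1"
  shows "loop_value (cohomology_class 1 X c) L = c (path_simplex L)"
  unfolding loop_value_def
proof (rule the_equality)
  show "\<forall>d\<in>cohomology_class 1 X c. d (path_simplex L) = c (path_simplex L)"
  proof
    fix d assume "d \<in> cohomology_class 1 X c"
    then have "cohomologous X c d"
      using mem_cohomology_class_iff[OF cocycle_imp_cochain[OF c]] by simp
    then obtain e where e: "e \<in> topspace X \<rightarrow> {1, -1}"
      and val: "d (path_simplex L) = c (path_simplex L) * (e (L 0) * e (L 1))"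
      unfolding cohomologous_def using L(1) by blast
    have "e (L 1) \<in> {1, -1}" using e path_finish_in_topspace[OF L(1)] by blast
    then show "d (path_simplex L) = c (path_simplex L)" using val L(2) by auto
  qed
qed (use cocycle_mem_class[OF c] in auto)

text \<open>Injectivity of \<open>H\<^sup>1(X; \<int>/2) \<rightarrow> Hom(\<pi>\<^sub>1(X), {1, -1})\<close>.\<close>

lemma cohomologous_if_equal_on_loops:
  assumes X: "path_connected_space X" and c: "c \<in> cocycles 1 X" and d: "d \<in> cocycles 1 X"
    and loops: "\<And>L. pathin X L \<Longrightarrow> L 0 = L 1 \<Longrightarrow> c (path_simplex L) = d (path_simplex L)"
  shows "cohomologous X c d"
proof (cases "topspace X = {}")
  case True
  then show ?thesis
    unfolding cohomologous_def using path_start_in_topspace by fastforce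
next
  case False
  then obtain x0 where x0: "x0 \<in> topspace X" by blast
  note pmc = cochain_1_value[OF cocycle_imp_cochain[OF c]]
  note pmd = cochain_1_value[OF cocycle_imp_cochain[OF d]]
  have "\<exists>p. pathin X p \<and> p 0 = x0 \<and> p 1 = x" if "x \<in> topspace X" for x
    using X x0 that by (simp add: path_connected_space_def)
  then obtain P where P: "\<And>x. x \<in> topspace X \<Longrightarrow> pathin X (P x) \<and> P x 0 = x0 \<and> P x 1 = x"
    by metis
  define e where "e x = c (path_simplex (P x)) * d (path_simplex (P x))" for x
  have "e \<in> topspace X \<rightarrow> {1, -1}"
    using pmc pmd P by (fastforce simp: e_def)
  moreover have "d (path_simplex L) = c (path_simplex L) * (e (L 0) * e (L 1))" if L: "pathin X L" for L
  proof -
    let ?x = "L 0" and ?y = "L 1"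
    have xy: "?x \<in> topspace X" "?y \<in> topspace X"
      using L path_start_in_topspace path_finish_in_topspace by blast+
    note Px = P[OF xy(1)] and Py = P[OF xy(2)]
    obtain r where r: "pathin X r" "r 0 = ?y" "r 1 = x0"
      using X xy(2) x0 unfolding path_connected_space_def by blast
    \<comment> \<open>Close up both ways from \<open>x0\<close> to the end of \<open>L\<close> by the same path \<open>r\<close>.\<close>
    have PL: "pathin X (path_concat (P ?x) L)"
      using pathin_path_concat Px L by blast
    have loop: "c (path_simplex (path_concat p r)) = d (path_simplex (path_concat p r))"
      if "pathin X p" "p 0 = x0" "p 1 = ?y" for p
      by (rule loops[OF pathin_path_concat]) (use that r in \<open>auto simp: path_concat_def\<close>)
    have 1: "c (path_simplex p) * c (path_simplex r) = d (path_simplex p) * d (path_simplex r)"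
      if "pathin X p" "p 0 = x0" "p 1 = ?y" for p
      using loop[OF that] cocycle_concat[OF c that(1) r(1)] cocycle_concat[OF d that(1) r(1)] that(3) r(2)
      by simp
    have "c (path_simplex (P ?x)) * c (path_simplex L) * c (path_simplex r)
        = d (path_simplex (P ?x)) * d (path_simplex L) * d (path_simplex r)"
      using 1[OF PL] Px cocycle_concat[OF c _ L, of "P ?x"] cocycle_concat[OF d _ L, of "P ?x"]
      by (simp add: path_concat_def)
    moreover have "c (path_simplex (P ?y)) * c (path_simplex r)
        = d (path_simplex (P ?y)) * d (path_simplex r)"
      using 1[of "P ?y"] Py by simp
    ultimately show ?thesis
      unfolding e_def
      using pmc[OF L] pmd[OF L] pmc[OF r(1)] pmd[OF r(1)] pmc[of "P ?x"] pmd[of "P ?x"]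
        pmc[of "P ?y"] pmd[of "P ?y"] Px Py by auto
  qed
  ultimately show ?thesis unfolding cohomologous_def by blast
qed

lemma twist_eq:
  assumes X: "path_connected_space X" and \<Lambda>: "Zt_system X \<Lambda>"
  shows "twist X \<Lambda> = cohomology_class 1 X (cocycle_of X \<Lambda>)"
  unfolding twist_def
proof (rule the_equality)
  note c = cocycle_of_cocycle[OF \<Lambda>]
  show "cohomology_class 1 X (cocycle_of X \<Lambda>) \<in> H1 X \<and>
      (\<forall>L. pathin X L \<longrightarrow> L 0 = L 1 \<longrightarrow>
        loop_value (cohomology_class 1 X (cocycle_of X \<Lambda>)) L = \<Lambda> (path_class X L))"
    using c by (simp add: cohomology_def loop_value_class[OF c, unfolded One_nat_def] cocycle_of_path_simplex)
  fix w assume w: "w \<in> H1 X \<and> (\<forall>L. pathin X L \<longrightarrow> L 0 = L 1 \<longrightarrow> loop_value w L = \<Lambda> (path_class X L))"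
  then obtain d where d: "d \<in> cocycles 1 X" "w = cohomology_class 1 X d"
    using H1E by metis
  have "cohomologous X d (cocycle_of X \<Lambda>)"
  proof (rule cohomologous_if_equal_on_loops[OF X d(1) c])
    fix L assume L: "pathin X L" "L 0 = L 1"
    then show "d (path_simplex L) = cocycle_of X \<Lambda> (path_simplex L)"
      using w loop_value_class[OF d(1) L] by (simp add: cocycle_of_path_simplex d(2))
  qed
  then show "w = cohomology_class 1 X (cocycle_of X \<Lambda>)"
    using cohomology_class_eq_iff d c cocycle_imp_cochain by blast
qed

lemma twist_loop_value:
  assumes "path_connected_space X" "Zt_system X \<Lambda>" "pathin X L" "L 0 = L 1"
  shows "loop_value (twist X \<Lambda>) L = \<Lambda> (path_class X L)"
  using loop_value_class[OF cocycle_of_cocycle[OF assms(2)] assms(3,4)]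
  by (simp only: twist_eq[OF assms(1,2)] cocycle_of_path_simplex[OF assms(3)])

lemma simplex_map_path_simplex: "simplex_map 1 f (path_simplex L) = path_simplex (f \<circ> L)"
  by (auto simp: simplex_map_def path_simplex_def intro!: restrict_ext)

text \<open>Pulling back a cohomology class, which is defined as a union over all its cocycles, can be computed
  with a single cocycle.\<close>

lemma cohomology_pullback_class:
  fixes X :: "'a topology" and Y :: "'b topology"
  assumes f: "continuous_map X Y f" and c: "c \<in> cocycles 1 Y"
  obtains c' where "c' \<in> cocycles 1 X"
    "cohomology_pullback 1 X f (cohomology_class 1 Y c) = cohomology_class 1 X c'"
    "\<And>L. pathin X L \<Longrightarrow> c' (path_simplex L) = c (path_simplex (f \<circ> L))"
proof -
  define pull :: "'b cochain \<Rightarrow> 'a cochain"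
    where "pull = (\<lambda>d. \<lambda>\<sigma>\<in>singular_simplex_set 1 X. d (simplex_map 1 f \<sigma>))"
  have val: "pull d (path_simplex L) = d (path_simplex (f \<circ> L))" if "pathin X L" for d L
    using singular_simplex_path_simplex[OF that] by (simp add: pull_def simplex_map_path_simplex flip: One_nat_def)
  have coch: "pull d \<in> cochains 1 X" if "d \<in> cochains 1 Y" for d
    unfolding cochains_def
  proof (rule PiE_I)
    fix \<sigma> assume "\<sigma> \<in> singular_simplex_set 1 X"
    then show "pull d \<sigma> \<in> {1, -1}"
      using that singular_simplex_simplex_map[OF _ f] by (auto simp: pull_def cochains_def PiE_iff)
  qed (simp add: pull_def)
  have cocyc: "pull d \<in> cocycles 1 X" if "d \<in> cocycles 1 Y" for d
    unfolding cocycles_def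
  proof (intro CollectI conjI allI impI coch cocycle_imp_cochain that)
    fix \<sigma> assume "singular_simplex (Suc 1) X \<sigma>"
    then have s2: "singular_simplex 2 X \<sigma>" by (simp add: numeral_2_eq_2)
    then have "continuous_map (simplex_top 2) Y (f \<circ> \<sigma>)"
      using f continuous_map_compose by (auto simp: singular_simplex_def)
    then show "coboundary 1 X (pull d) \<sigma> = 1"
      using cocycle_triangle[OF that, of "f \<circ> \<sigma>"] pathin_simplex_edges[OF s2]
      by (simp add: coboundary_1_apply[OF s2] val o_def flip: One_nat_def)
  qed
  have coho: "cohomologous X (pull c) (pull d)" if "cohomologous Y c d" for d
  proof -
    obtain e where e: "e \<in> topspace Y \<rightarrow> {1, -1}"
      and v: "\<And>L. pathin Y L \<Longrightarrow> d (path_simplex L) = c (path_simplex L) * (e (L 0) * e (L 1))"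
      using \<open>cohomologous Y c d\<close> unfolding cohomologous_def by blast
    have "e \<circ> f \<in> topspace X \<rightarrow> {1, -1}"
      using e f by (auto simp: continuous_map_def Pi_iff)
    moreover have "pull d (path_simplex L) = pull c (path_simplex L) * ((e \<circ> f) (L 0) * (e \<circ> f) (L 1))"
      if "pathin X L" for L
      using v[OF pathin_compose[OF that f]] val[OF that] by simp
    ultimately show ?thesis unfolding cohomologous_def by blast
  qed
  have eq: "cohomology_class 1 X (pull d) = cohomology_class 1 X (pull c)"
    if "d \<in> cohomology_class 1 Y c" for d
  proof -
    have d: "d \<in> cochains 1 Y" "cohomologous Y c d"
      using that mem_cohomology_class_iff[OF cocycle_imp_cochain[OF c]] by auto
    show ?thesis
      using cohomology_class_eq_iff[OF coch[OF cocycle_imp_cochain[OF c]] coch[OF d(1)]] coho[OF d(2)]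
      by simp
  qed
  have ne: "cohomology_class 1 Y c \<noteq> {}" using cocycle_mem_class[OF c] by blast
  have "cohomology_pullback 1 X f (cohomology_class 1 Y c) = cohomology_class 1 X (pull c)"
    unfolding cohomology_pullback_def
    by (rule SUP_eq_const[OF ne]) (use eq in \<open>simp add: pull_def\<close>)
  then show thesis
    using that cocyc[OF c] val by blast
qed

text \<open>A map which does not change the value of any loop acts trivially on \<open>H\<^sup>1\<close>.\<close>

lemma cohomology_pullback_id:
  assumes X: "path_connected_space X" and f: "continuous_map X X f" and w: "w \<in> H1 X"
    and loops: "\<And>c L. c \<in> cocycles 1 X \<Longrightarrow> pathin X L \<Longrightarrow> L 0 = L 1 \<Longrightarrow>
        c (path_simplex (f \<circ> L)) = c (path_simplex L)"
  shows "cohomology_pullback 1 X f w = w"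
proof -
  obtain c where c: "c \<in> cocycles 1 X" "w = cohomology_class 1 X c" using H1E[OF w] .
  obtain c' where c': "c' \<in> cocycles 1 X"
    "cohomology_pullback 1 X f (cohomology_class 1 X c) = cohomology_class 1 X c'"
    "\<And>L. pathin X L \<Longrightarrow> c' (path_simplex L) = c (path_simplex (f \<circ> L))"
    using cohomology_pullback_class[OF f c(1)] by blast
  have "cohomologous X c' c"
    by (rule cohomologous_if_equal_on_loops[OF X c'(1) c(1)]) (simp add: c'(3) loops[OF c(1)])
  then show ?thesis
    using cohomology_class_eq_iff c(1) c'(1) cocycle_imp_cochain c(2) c'(2) by metis
qed

section \<open>Simplices of the nerve and their vertex labels\<close>

text \<open>The edges of a simplex \<open>[g\<^sub>1, \<dots>, g\<^sub>k]\<close> of the nerve integrate to labels of its vertices: the label of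
  vertex \<open>i\<close> is \<open>g\<^sub>1 \<cdots> g\<^sub>i\<close>.\<close>

definition vlabel :: "('g, 'x) monoid_scheme \<Rightarrow> 'g list \<Rightarrow> nat \<Rightarrow> 'g" where
  "vlabel G gs i = foldr (mult G) (take i gs) \<one>\<^bsub>G\<^esub>"

text \<open>The simplex of the nerve whose vertices are labelled by \<open>V 0, \<dots>, V k\<close>. It determines the labels up to
  multiplication from the left (\<open>simplex_of_left_mult\<close>), and simplicial operators act on the labels by
  precomposition (\<open>nerve_pull_simplex_of\<close>).\<close>

definition simplex_of :: "('g, 'x) monoid_scheme \<Rightarrow> nat \<Rightarrow> (nat \<Rightarrow> 'g) \<Rightarrow> 'g list" where
  "simplex_of G k V = map (\<lambda>j. inv\<^bsub>G\<^esub> V j \<otimes>\<^bsub>G\<^esub> V (Suc j)) [0..<k]"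

lemma length_simplex_of [simp]: "length (simplex_of G k V) = k"
  by (simp add: simplex_of_def)

lemma nth_simplex_of [simp]: "j < k \<Longrightarrow> simplex_of G k V ! j = inv\<^bsub>G\<^esub> V j \<otimes>\<^bsub>G\<^esub> V (Suc j)"
  by (simp add: simplex_of_def)

lemma length_nerve_pull [simp]: "length (nerve_pull G m \<alpha> gs) = m"
  by (simp add: nerve_pull_def)

lemma simplex_of_cong:
  "(\<And>j. j \<le> k \<Longrightarrow> V j = W j) \<Longrightarrow> simplex_of G k V = simplex_of G k W"
  by (simp add: simplex_of_def)

context group
begin

lemma foldr_mult_closed: "set gs \<subseteq> carrier G \<Longrightarrow> foldr (\<otimes>) gs \<one> \<in> carrier G"
  by (induction gs) auto

lemma foldr_mult_append:
  "set gs \<subseteq> carrier G \<Longrightarrow> set hs \<subseteq> carrier G \<Longrightarrow>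
    foldr (\<otimes>) (gs @ hs) \<one> = foldr (\<otimes>) gs \<one> \<otimes> foldr (\<otimes>) hs \<one>"
  by (induction gs) (auto simp: foldr_mult_closed m_assoc)

lemma vlabel_closed [simp]: "set gs \<subseteq> carrier G \<Longrightarrow> vlabel G gs i \<in> carrier G"
  unfolding vlabel_def by (rule foldr_mult_closed) (meson set_take_subset subset_trans)

lemma vlabel_0 [simp]: "vlabel G gs 0 = \<one>"
  by (simp add: vlabel_def)

lemma vlabel_mult_segment:
  assumes "set gs \<subseteq> carrier G" "a \<le> b"
  shows "vlabel G gs a \<otimes> foldr (\<otimes>) (take (b - a) (drop a gs)) \<one> = vlabel G gs b"
proof -
  have "take b gs = take a gs @ take (b - a) (drop a gs)"
    using assms(2) by (metis le_add_diff_inverse take_add)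
  then show ?thesis
    unfolding vlabel_def using assms(1) foldr_mult_append
    by (metis (no_types, lifting) set_drop_subset set_take_subset subset_trans)
qed

lemma foldr_segment:
  assumes "set gs \<subseteq> carrier G" "a \<le> b"
  shows "foldr (\<otimes>) (take (b - a) (drop a gs)) \<one> = inv (vlabel G gs a) \<otimes> vlabel G gs b"
proof -
  have "foldr (\<otimes>) (take (b - a) (drop a gs)) \<one> \<in> carrier G"
    by (rule foldr_mult_closed) (meson assms(1) set_drop_subset set_take_subset subset_trans)
  then show ?thesis
    using vlabel_mult_segment[OF assms] assms(1) by (metis inv_solve_left vlabel_closed)
qed

lemma vlabel_Suc:
  assumes "set gs \<subseteq> carrier G" "i < length gs"
  shows "vlabel G gs (Suc i) = vlabel G gs i \<otimes> gs ! i"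
proof -
  have "gs ! i \<in> carrier G" using assms by auto
  then show ?thesis
    using vlabel_mult_segment[OF assms(1), of i "Suc i"] assms(2)
    by (simp add: take_Suc_conv_app_nth Suc_diff_le hd_drop_conv_nth take_Suc)
qed

lemma nerve_pull_eq_simplex_of:
  assumes gs: "set gs \<subseteq> carrier G" and \<alpha>: "mono_on {..m} \<alpha>"
  shows "nerve_pull G m \<alpha> gs = simplex_of G m (\<lambda>j. vlabel G gs (\<alpha> j))"
  unfolding nerve_pull_def simplex_of_def
  using \<alpha> by (auto intro!: foldr_segment[OF gs] simp: monotone_on_def)

lemma simplex_of_vlabel:
  assumes "set gs \<subseteq> carrier G"
  shows "simplex_of G (length gs) (vlabel G gs) = gs"
proof (rule nth_equalityI)
  fix i assume "i < length (simplex_of G (length gs) (vlabel G gs))"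
  then have i: "i < length gs" by simp
  then have "gs ! i \<in> carrier G" using assms by auto
  then show "simplex_of G (length gs) (vlabel G gs) ! i = gs ! i"
    using i assms by (simp add: vlabel_Suc m_assoc[symmetric])
qed simp

lemma simplex_of_closed:
  assumes "\<And>j. j \<le> k \<Longrightarrow> V j \<in> carrier G"
  shows "set (simplex_of G k V) \<subseteq> carrier G"
  using assms by (auto simp: simplex_of_def)

lemma vlabel_simplex_of:
  assumes V: "\<And>j. j \<le> k \<Longrightarrow> V j \<in> carrier G" and "i \<le> k"
  shows "vlabel G (simplex_of G k V) i = inv (V 0) \<otimes> V i"
  using \<open>i \<le> k\<close>
proof (induction i)
  case (Suc i)
  have "inv (V 0) \<otimes> V i \<otimes> (inv (V i) \<otimes> V (Suc i)) = inv (V 0) \<otimes> V (Suc i)"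
    using Suc.prems by (simp add: V m_assoc inv_solve_left' m_assoc[symmetric])
  then show ?case
    using Suc vlabel_Suc[of "simplex_of G k V" i] simplex_of_closed[of k V]  V by simp
qed (simp add: V)

lemma simplex_of_left_mult:
  assumes "h \<in> carrier G" "\<And>j. j \<le> k \<Longrightarrow> V j \<in> carrier G"
  shows "simplex_of G k (\<lambda>j. h \<otimes> V j) = simplex_of G k V"
proof -
  have "inv (h \<otimes> x) \<otimes> (h \<otimes> y) = inv x \<otimes> y" if "x \<in> carrier G" "y \<in> carrier G" for x y
  proof -
    have "inv (h \<otimes> x) \<otimes> (h \<otimes> y) = inv x \<otimes> ((inv h \<otimes> h) \<otimes> y)"
      using assms(1) that by (simp only: inv_mult_group m_assoc m_closed inv_closed)
    then show ?thesis using assms(1) that by simp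
  qed
  then show ?thesis using assms(2) by (simp add: simplex_of_def)
qed

lemma nerve_pull_simplex_of:
  assumes V: "\<And>j. j \<le> k \<Longrightarrow> V j \<in> carrier G"
    and \<alpha>: "mono_on {..m} \<alpha>" "\<alpha> ` {..m} \<subseteq> {..k}"
  shows "nerve_pull G m \<alpha> (simplex_of G k V) = simplex_of G m (\<lambda>j. V (\<alpha> j))"
proof -
  have "nerve_pull G m \<alpha> (simplex_of G k V) = simplex_of G m (\<lambda>j. inv (V 0) \<otimes> V (\<alpha> j))"
    using \<alpha> vlabel_simplex_of[of k V] V simplex_of_closed[of k V]
    by (subst nerve_pull_eq_simplex_of) (auto intro!: simplex_of_cong)
  also have "\<dots> = simplex_of G m (\<lambda>j. V (\<alpha> j))"
    by (rule simplex_of_left_mult) (use V \<alpha>(2) in auto)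
  finally show ?thesis .
qed

lemma vlabel_nerve_pull:
  assumes "set gs \<subseteq> carrier G" "mono_on {..m} \<alpha>" "j \<le> m"
  shows "vlabel G (nerve_pull G m \<alpha> gs) j = inv (vlabel G gs (\<alpha> 0)) \<otimes> vlabel G gs (\<alpha> j)"
  using assms by (simp add: nerve_pull_eq_simplex_of vlabel_simplex_of)

lemma nerve_pull_closed:
  assumes "set gs \<subseteq> carrier G" "mono_on {..m} \<alpha>"
  shows "set (nerve_pull G m \<alpha> gs) \<subseteq> carrier G"
  using assms by (simp add: nerve_pull_eq_simplex_of simplex_of_closed)

end

lemma simplex_push_eq:
  "simplex_push m \<alpha> t j = (\<Sum>i\<le>m. if \<alpha> i = j then t i else 0)"
proof -
  have "{..m} \<inter> {i. \<alpha> i = j} = {i. i \<le> m \<and> \<alpha> i = j}" by auto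
  then show ?thesis
    unfolding simplex_push_def by (simp flip: sum.inter_filter)
qed

lemma simplex_push_in_simplex:
  assumes "t \<in> standard_simplex m" "\<alpha> ` {..m} \<subseteq> {..k}"
  shows "simplex_push m \<alpha> t \<in> standard_simplex k"
proof -
  have t: "\<And>i. 0 \<le> t i" "sum t {..m} = 1"
    using assms(1) by (auto simp: standard_simplex_def)
  have nn: "0 \<le> simplex_push m \<alpha> t j" for j
    unfolding simplex_push_def by (rule sum_nonneg) (simp add: t)
  have z: "simplex_push m \<alpha> t j = 0" if "j > k" for j
    unfolding simplex_push_eq using assms(2) that by (intro sum.neutral) force
  have "(\<Sum>j\<le>k. simplex_push m \<alpha> t j) = (\<Sum>i\<le>m. \<Sum>j\<le>k. if \<alpha> i = j then t i else 0)"
    unfolding simplex_push_eq by (rule sum.swap)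
  also have "\<dots> = (\<Sum>i\<le>m. t i)"
    by (rule sum.cong) (use assms(2) in auto)
  finally have s: "(\<Sum>j\<le>k. simplex_push m \<alpha> t j) = 1" using t(2) by simp
  have "simplex_push m \<alpha> t j \<le> 1" for j
  proof (cases "j \<le> k")
    case True
    then have "simplex_push m \<alpha> t j \<le> (\<Sum>j\<le>k. simplex_push m \<alpha> t j)"
      by (intro member_le_sum) (auto simp: nn)
    then show ?thesis using s by simp
  qed (simp add: z)
  then show ?thesis using nn z s by (simp add: standard_simplex_def)
qed

section \<open>Points of the geometric realization\<close>

lemma topspace_pre_realization:
  "topspace (pre_realization G) = {(gs, t). set gs \<subseteq> carrier G \<and> t \<in> standard_simplex (length gs)}"
  by (auto simp: pre_realization_def in_lists_conv_set subset_iff)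

text \<open>\<open>\<Phi>\<close> is compatible with the relation that generates the gluing of the geometric realization.\<close>

definition respects_rel :: "('g, 'x) monoid_scheme \<Rightarrow> ('g list \<times> (nat \<Rightarrow> real) \<Rightarrow> 'b) \<Rightarrow> bool" where
  "respects_rel G \<Phi> \<longleftrightarrow> (\<forall>(z, w) \<in> realization_rel G. \<Phi> z = \<Phi> w)"

lemma respects_relI:
  assumes "\<And>m \<alpha> gs t. set gs \<subseteq> carrier G \<Longrightarrow> t \<in> standard_simplex m \<Longrightarrow> mono_on {..m} \<alpha> \<Longrightarrow>
    \<alpha> ` {..m} \<subseteq> {..length gs} \<Longrightarrow> \<Phi> (nerve_pull G m \<alpha> gs, t) = \<Phi> (gs, simplex_push m \<alpha> t)"
  shows "respects_rel G \<Phi>"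
  using assms unfolding respects_rel_def realization_rel_def
  by (auto simp: in_lists_conv_set subset_iff)

lemma respects_rel_equiv:
  assumes "respects_rel G \<Phi>" "(z, w) \<in> realization_equiv G"
  shows "\<Phi> z = \<Phi> w"
  using assms(2) unfolding realization_equiv_def
proof (induction rule: rtrancl_induct)
  case (step y w)
  then show ?case using assms(1) unfolding respects_rel_def by auto
qed simp

lemma realization_equiv_sym: "(z, w) \<in> realization_equiv G \<Longrightarrow> (w, z) \<in> realization_equiv G"
  unfolding realization_equiv_def by (rule symD[OF sym_rtrancl]) (auto simp: sym_def)

lemma realization_equiv_trans:
  "(z, w) \<in> realization_equiv G \<Longrightarrow> (w, y) \<in> realization_equiv G \<Longrightarrow> (z, y) \<in> realization_equiv G"
  unfolding realization_equiv_def by simp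

lemma BG_point_cell:
  obtains gs t where "BG_point G z = Cell gs t" "(z, (gs, t)) \<in> realization_equiv G"
proof -
  let ?w = "SOME w. (z, w) \<in> realization_equiv G"
  have "(z, z) \<in> realization_equiv G" by (simp add: realization_equiv_def)
  then have "(z, ?w) \<in> realization_equiv G" by (rule someI)
  then show thesis
    using that[of "fst ?w" "snd ?w"] by (simp add: BG_point_def case_prod_beta)
qed

lemma BG_point_eq_if_equiv:
  assumes "(z, w) \<in> realization_equiv G"
  shows "BG_point G z = BG_point G w"
proof -
  have "(z, y) \<in> realization_equiv G \<longleftrightarrow> (w, y) \<in> realization_equiv G" for y
    using assms realization_equiv_sym realization_equiv_trans by metis
  then show ?thesis by (simp add: BG_point_def)
qed

lemma BG_point_eq_imp:
  assumes "respects_rel G \<Phi>" "BG_point G z = BG_point G w"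
  shows "\<Phi> z = \<Phi> w"
proof -
  obtain gs t where 1: "BG_point G z = Cell gs t" "(z, (gs, t)) \<in> realization_equiv G"
    using BG_point_cell .
  obtain hs u where 2: "BG_point G w = Cell hs u" "(w, (hs, u)) \<in> realization_equiv G"
    using BG_point_cell .
  show ?thesis
    using 1 2 assms(2) respects_rel_equiv[OF assms(1)] by (metis point.inject(3))
qed

lemma BG_point_nerve_pull:
  assumes "set gs \<subseteq> carrier G" "t \<in> standard_simplex m" "mono_on {..m} \<alpha>" "\<alpha> ` {..m} \<subseteq> {..length gs}"
  shows "BG_point G (nerve_pull G m \<alpha> gs, t) = BG_point G (gs, simplex_push m \<alpha> t)"
proof (rule BG_point_eq_if_equiv)
  have "((nerve_pull G m \<alpha> gs, t), (gs, simplex_push m \<alpha> t)) \<in> realization_rel G"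
    unfolding realization_rel_def using assms by (auto simp: in_lists_conv_set)
  then show "((nerve_pull G m \<alpha> gs, t), (gs, simplex_push m \<alpha> t)) \<in> realization_equiv G"
    unfolding realization_equiv_def by blast
qed

text \<open>The function on \<open>BG\<close> induced by a function on pairs of a simplex and a point in it: a point of \<open>BG\<close> is
  itself written as a representative of its class.\<close>

definition descend :: "('a point list \<times> (nat \<Rightarrow> real) \<Rightarrow> 'b) \<Rightarrow> 'a point \<Rightarrow> 'b" where
  "descend \<Phi> x = (case x of Cell gs t \<Rightarrow> \<Phi> (gs, t))"

lemma descend_BG_point:
  assumes "respects_rel G \<Phi>"
  shows "descend \<Phi> (BG_point G z) = \<Phi> z"
proof -
  obtain gs t where "BG_point G z = Cell gs t" "(z, (gs, t)) \<in> realization_equiv G"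
    using BG_point_cell .
  then show ?thesis
    using respects_rel_equiv[OF assms] by (simp add: descend_def)
qed

lemma topspace_quot_topology: "topspace (quot_topology X q) = q ` topspace X"
proof -
  have "{x \<in> topspace X. q x \<in> q ` topspace X} = topspace X" by auto
  then have "openin (quot_topology X q) (q ` topspace X)"
    by (simp add: openin_quot_topology)
  moreover have "topspace (quot_topology X q) \<subseteq> q ` topspace X"
    using openin_topspace[of "quot_topology X q"] by (simp only: openin_quot_topology)
  ultimately show ?thesis
    by (simp add: openin_subset subset_antisym)
qed

lemma quotient_map_quot_topology: "quotient_map X (quot_topology X q) q"
  unfolding quotient_map_def by (auto simp: topspace_quot_topology openin_quot_topology)

lemma topspace_BG: "topspace (BG G) = BG_point G ` topspace (pre_realization G)"
  by (simp add: BG_def topspace_quot_topology)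

lemma quotient_map_BG_point: "quotient_map (pre_realization G) (BG G) (BG_point G)"
  by (simp add: BG_def quotient_map_quot_topology)

lemma continuous_map_BG_point: "continuous_map (pre_realization G) (BG G) (BG_point G)"
  by (rule quotient_imp_continuous_map[OF quotient_map_BG_point])

lemma continuous_map_into_cell:
  assumes "set gs \<subseteq> carrier G" "continuous_map Y (simplex_top (length gs)) f"
  shows "continuous_map Y (BG G) (\<lambda>y. BG_point G (gs, f y))"
proof -
  have "continuous_map (simplex_top (length gs)) (pre_realization G) (\<lambda>t. (gs, t))"
    unfolding pre_realization_def
    using continuous_map_component_injection[of gs "lists (carrier G)" "\<lambda>gs. simplex_top (length gs)"] assms(1)
    by (auto simp: in_lists_conv_set)
  then have "continuous_map Y (BG G) (BG_point G \<circ> ((\<lambda>t. (gs, t)) \<circ> f))"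
    using assms(2) continuous_map_BG_point by (intro continuous_map_compose)
  then show ?thesis by (simp add: o_def)
qed

lemma respects_rel_topspace:
  assumes "group G"
  shows "respects_rel G (\<lambda>z. z \<in> topspace (pre_realization G))"
proof (rule respects_relI)
  interpret group G by fact
  fix m \<alpha> gs t
  assume "set gs \<subseteq> carrier G" "t \<in> standard_simplex m" "mono_on {..m} \<alpha>" "\<alpha> ` {..m} \<subseteq> {..length gs}"
  then show "((nerve_pull G m \<alpha> gs, t) \<in> topspace (pre_realization G))
      = ((gs, simplex_push m \<alpha> t) \<in> topspace (pre_realization G))"
    using nerve_pull_closed simplex_push_in_simplex by (auto simp: topspace_pre_realization)
qed

section \<open>Conjugation is homotopic to the identity\<close>

text \<open>The labels \<open>v\<^sub>0, \<dots>, v\<^sub>k, v\<^sub>0 h, \<dots>, v\<^sub>k h\<close> of the \<open>(2k+1)\<close>-simplex that contains the homotopy from the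
  simplex \<open>gs\<close> to its conjugate.\<close>

definition join_labels :: "('g, 'x) monoid_scheme \<Rightarrow> 'g \<Rightarrow> 'g list \<Rightarrow> nat \<Rightarrow> 'g" where
  "join_labels G h gs j =
     (if j \<le> length gs then vlabel G gs j else vlabel G gs (j - Suc (length gs)) \<otimes>\<^bsub>G\<^esub> h)"

definition join_simplex :: "('g, 'x) monoid_scheme \<Rightarrow> 'g \<Rightarrow> 'g list \<Rightarrow> 'g list" where
  "join_simplex G h gs = simplex_of G (Suc (2 * length gs)) (join_labels G h gs)"

text \<open>The barycentric coordinates \<open>((1 - s) t, s t)\<close> in this simplex, where the second block starts at the
  vertex \<open>k + 1\<close>.\<close>

definition join_weights :: "nat \<Rightarrow> real \<Rightarrow> (nat \<Rightarrow> real) \<Rightarrow> nat \<Rightarrow> real" where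
  "join_weights k s t i = (if i \<le> k then (1 - s) * t i else s * t (i - Suc k))"

text \<open>A monotone map \<open>\<alpha> : {0..m} \<rightarrow> {0..k}\<close>, applied to both blocks of vertices simultaneously.\<close>

definition join_map :: "nat \<Rightarrow> nat \<Rightarrow> (nat \<Rightarrow> nat) \<Rightarrow> nat \<Rightarrow> nat" where
  "join_map m k \<alpha> i = (if i \<le> m then \<alpha> i else Suc k + \<alpha> (i - Suc m))"

text \<open>The homotopy from the identity to conjugation by \<open>h\<close>, at time \<open>s\<close>.\<close>

definition conj_homotopy ::
  "('a point, 'x) monoid_scheme \<Rightarrow> 'a point \<Rightarrow> real \<Rightarrow> 'a point list \<times> (nat \<Rightarrow> real) \<Rightarrow> 'a point" where
  "conj_homotopy G h s z =
     BG_point G (join_simplex G h (fst z), join_weights (length (fst z)) s (snd z))"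

lemma sum_join: "(\<Sum>i\<le>Suc (2 * m). F i) = (\<Sum>i\<le>m. F i) + (\<Sum>i\<le>m. F (Suc m + i) :: 'b::comm_monoid_add)"
proof -
  have "{..Suc (2 * m)} = {..m} \<union> (+) (Suc m) ` {..m}"
  proof (intro equalityI subsetI)
    fix i assume i: "i \<in> {..Suc (2 * m)}"
    show "i \<in> {..m} \<union> (+) (Suc m) ` {..m}"
    proof (cases "i \<le> m")
      case False
      then have "i = Suc m + (i - Suc m)" "i - Suc m \<in> {..m}" using i by auto
      then show ?thesis by blast
    qed simp
  qed auto
  moreover have "{..m} \<inter> (+) (Suc m) ` {..m} = {}" by auto
  moreover have "sum F ((+) (Suc m) ` {..m}) = (\<Sum>i\<le>m. F (Suc m + i))"
    using sum.reindex[of "(+) (Suc m)" "{..m}" F] by (simp add: o_def)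
  ultimately show ?thesis
    by (simp only: sum.union_disjoint finite_atMost finite_imageI)
qed

lemma join_weights_in_simplex:
  assumes "t \<in> standard_simplex k" "s \<in> {0..1}"
  shows "join_weights k s t \<in> standard_simplex (Suc (2 * k))"
proof -
  have t: "\<And>i. 0 \<le> t i" "\<And>i. t i \<le> 1" "\<And>i. i > k \<Longrightarrow> t i = 0" "sum t {..k} = 1"
    using assms(1) by (auto simp: standard_simplex_def)
  have "sum (join_weights k s t) {..Suc (2 * k)} = (1 - s) * sum t {..k} + s * sum t {..k}"
    unfolding sum_join by (simp add: join_weights_def sum_distrib_left)
  then show ?thesis
    using assms(2) t by (auto simp: standard_simplex_def join_weights_def mult_le_one)
qed

lemma join_map_mono:
  assumes "mono_on {..m} \<alpha>" "\<alpha> ` {..m} \<subseteq> {..k}"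
  shows "mono_on {..Suc (2 * m)} (join_map m k \<alpha>)"
    "join_map m k \<alpha> ` {..Suc (2 * m)} \<subseteq> {..Suc (2 * k)}"
proof -
  show "mono_on {..Suc (2 * m)} (join_map m k \<alpha>)"
  proof (rule monotone_onI)
    fix i j assume ij: "i \<in> {..Suc (2 * m)}" "j \<in> {..Suc (2 * m)}" "i \<le> j"
    consider "j \<le> m" | "i \<le> m" "m < j" | "m < i" using ij by linarith
    then show "join_map m k \<alpha> i \<le> join_map m k \<alpha> j"
    proof cases
      case 1 then show ?thesis using ij monotone_onD[OF assms(1)] by (simp add: join_map_def)
    next
      case 2
      then have "\<alpha> i \<le> k" using assms(2) by auto
      then show ?thesis using 2 by (simp add: join_map_def)
    next
      case 3
      then have "\<alpha> (i - Suc m) \<le> \<alpha> (j - Suc m)"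
        using ij by (intro monotone_onD[OF assms(1)]) auto
      then show ?thesis using 3 ij by (simp add: join_map_def)
    qed
  qed
  show "join_map m k \<alpha> ` {..Suc (2 * m)} \<subseteq> {..Suc (2 * k)}"
  proof
    fix y assume "y \<in> join_map m k \<alpha> ` {..Suc (2 * m)}"
    then obtain i where i: "i \<le> Suc (2 * m)" "y = join_map m k \<alpha> i" by auto
    have "(if i \<le> m then i else i - Suc m) \<in> {..m}" using i(1) by auto
    then have "\<alpha> (if i \<le> m then i else i - Suc m) \<le> k" using assms(2) by blast
    then show "y \<in> {..Suc (2 * k)}" using i(2) by (auto simp: join_map_def split: if_splits)
  qed
qed

lemma simplex_push_join:
  assumes "\<alpha> ` {..m} \<subseteq> {..k}"
  shows "simplex_push (Suc (2 * m)) (join_map m k \<alpha>) (join_weights m s t)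
       = join_weights k s (simplex_push m \<alpha> t)"
proof
  fix j
  have \<alpha>: "\<alpha> i \<le> k" if "i \<le> m" for i using assms that by auto
  have "(\<Sum>i\<le>m. if join_map m k \<alpha> i = j then join_weights m s t i else 0)
      = (if j \<le> k then (1 - s) * simplex_push m \<alpha> t j else 0)"
  proof (cases "j \<le> k")
    case True
    then show ?thesis
      by (auto simp: simplex_push_eq join_map_def join_weights_def sum_distrib_left intro!: sum.cong)
  next
    case False
    then show ?thesis
      using \<alpha> by (auto simp: join_map_def intro!: sum.neutral)
  qed
  moreover have "(\<Sum>i\<le>m. if join_map m k \<alpha> (Suc m + i) = j then join_weights m s t (Suc m + i) else 0)
      = (if j \<le> k then 0 else s * simplex_push m \<alpha> t (j - Suc k))"
  proof (cases "j \<le> k")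
    case True
    then show ?thesis by (auto simp: join_map_def intro!: sum.neutral)
  next
    case False
    then show ?thesis
      by (auto simp: simplex_push_eq join_map_def join_weights_def sum_distrib_left intro!: sum.cong)
  qed
  ultimately show "simplex_push (Suc (2 * m)) (join_map m k \<alpha>) (join_weights m s t) j
       = join_weights k s (simplex_push m \<alpha> t) j"
    unfolding simplex_push_eq[of "Suc (2 * m)"] sum_join by (simp add: join_weights_def)
qed

lemma length_join_simplex [simp]: "length (join_simplex G h gs) = Suc (2 * length gs)"
  by (simp add: join_simplex_def)

context group
begin

lemma join_labels_closed:
  "set gs \<subseteq> carrier G \<Longrightarrow> h \<in> carrier G \<Longrightarrow> join_labels G h gs j \<in> carrier G"
  by (simp add: join_labels_def)

lemma join_simplex_closed:
  "set gs \<subseteq> carrier G \<Longrightarrow> h \<in> carrier G \<Longrightarrow> set (join_simplex G h gs) \<subseteq> carrier G"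
  unfolding join_simplex_def by (rule simplex_of_closed) (rule join_labels_closed)

lemma nerve_pull_join_simplex:
  assumes gs: "set gs \<subseteq> carrier G" and h: "h \<in> carrier G"
    and \<alpha>: "mono_on {..m} \<alpha>" "\<alpha> ` {..m} \<subseteq> {..length gs}"
  shows "nerve_pull G (Suc (2 * m)) (join_map m (length gs) \<alpha>) (join_simplex G h gs)
       = join_simplex G h (nerve_pull G m \<alpha> gs)"
proof -
  let ?V = "join_labels G h gs" and ?u = "inv (vlabel G gs (\<alpha> 0))"
  note j = join_map_mono[OF \<alpha>]
  have V: "?V i \<in> carrier G" for i by (rule join_labels_closed[OF gs h])
  have "nerve_pull G (Suc (2 * m)) (join_map m (length gs) \<alpha>) (join_simplex G h gs)
      = simplex_of G (Suc (2 * m)) (\<lambda>i. ?V (join_map m (length gs) \<alpha> i))"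
    unfolding join_simplex_def by (rule nerve_pull_simplex_of[OF V j])
  also have "\<dots> = simplex_of G (Suc (2 * m)) (\<lambda>i. ?u \<otimes> ?V (join_map m (length gs) \<alpha> i))"
    by (rule simplex_of_left_mult[symmetric]) (simp_all add: V gs)
  also have "\<dots> = join_simplex G h (nerve_pull G m \<alpha> gs)"
    unfolding join_simplex_def length_nerve_pull
  proof (rule simplex_of_cong)
    fix i assume i: "i \<le> Suc (2 * m)"
    have \<alpha>': "\<alpha> l \<le> length gs" if "l \<le> m" for l using \<alpha>(2) that by auto
    show "?u \<otimes> ?V (join_map m (length gs) \<alpha> i) = join_labels G h (nerve_pull G m \<alpha> gs) i"
    proof (cases "i \<le> m")
      case True
      then show ?thesis
        using vlabel_nerve_pull[OF gs \<alpha>(1), of i] \<alpha>' by (simp add: join_labels_def join_map_def)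
    next
      case False
      then have "i - Suc m \<le> m" using i by linarith
      then show ?thesis
        using False vlabel_nerve_pull[OF gs \<alpha>(1), of "i - Suc m"] gs h
        by (simp add: join_labels_def join_map_def m_assoc)
    qed
  qed
  finally show ?thesis .
qed

end

lemma conj_homotopy_respects:
  assumes "group G" "h \<in> carrier G" "s \<in> {0..1}"
  shows "respects_rel G (conj_homotopy G h s)"
proof (rule respects_relI)
  interpret group G by fact
  fix m \<alpha> gs t
  assume gs: "set gs \<subseteq> carrier G" and t: "t \<in> standard_simplex m" and \<alpha>: "mono_on {..m} \<alpha>"
    "\<alpha> ` {..m} \<subseteq> {..length gs}"
  note j = join_map_mono[OF \<alpha>]
  show "conj_homotopy G h s (nerve_pull G m \<alpha> gs, t) = conj_homotopy G h s (gs, simplex_push m \<alpha> t)"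
    using BG_point_nerve_pull[OF join_simplex_closed[OF gs assms(2)] join_weights_in_simplex[OF t assms(3)] j(1)]
      j(2) simplex_push_join[OF \<alpha>(2)] nerve_pull_join_simplex[OF gs assms(2) \<alpha>]
    by (simp add: conj_homotopy_def)
qed

lemma conj_homotopy_0:
  assumes "group G" "h \<in> carrier G" "z \<in> topspace (pre_realization G)"
  shows "conj_homotopy G h 0 z = BG_point G z"
proof -
  interpret group G by fact
  obtain gs t where z: "z = (gs, t)" and gs: "set gs \<subseteq> carrier G" and t: "t \<in> standard_simplex (length gs)"
    using assms(3) by (auto simp: topspace_pre_realization)
  let ?k = "length gs"
  have "nerve_pull G ?k (\<lambda>i. i) (join_simplex G h gs) = simplex_of G ?k (join_labels G h gs)"
    unfolding join_simplex_def
    by (rule nerve_pull_simplex_of) (auto simp: join_labels_closed gs assms(2) monotone_on_def)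
  also have "\<dots> = simplex_of G ?k (vlabel G gs)"
    by (rule simplex_of_cong) (simp add: join_labels_def)
  also have "\<dots> = gs" by (rule simplex_of_vlabel[OF gs])
  finally have n: "nerve_pull G ?k (\<lambda>i. i) (join_simplex G h gs) = gs" .
  have "simplex_push ?k (\<lambda>i. i) t = join_weights ?k 0 t"
    by (auto simp: simplex_push_eq join_weights_def)
  then show ?thesis
    using BG_point_nerve_pull[OF join_simplex_closed[OF gs assms(2)] t, of "\<lambda>i. i"] n
    by (auto simp: conj_homotopy_def z monotone_on_def)
qed

lemma conj_homotopy_1:
  assumes "group G" "h \<in> carrier G" "z \<in> topspace (pre_realization G)"
  shows "conj_homotopy G h 1 z = BG_point G (map (inner_aut G h) (fst z), snd z)"
proof -
  interpret group G by fact
  obtain gs t where z: "z = (gs, t)" and gs: "set gs \<subseteq> carrier G" and t: "t \<in> standard_simplex (length gs)"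
    using assms(3) by (auto simp: topspace_pre_realization)
  let ?k = "length gs"
  have "nerve_pull G ?k ((+) (Suc ?k)) (join_simplex G h gs)
      = simplex_of G ?k (\<lambda>j. join_labels G h gs (Suc ?k + j))"
    unfolding join_simplex_def
    by (rule nerve_pull_simplex_of) (auto simp: join_labels_closed gs assms(2) monotone_on_def)
  also have "\<dots> = simplex_of G ?k (\<lambda>j. vlabel G gs j \<otimes>\<^bsub>G\<^esub> h)"
    by (rule simplex_of_cong) (simp add: join_labels_def)
  also have "\<dots> = map (inner_aut G h) gs"
  proof (rule nth_equalityI)
    fix j assume "j < length (simplex_of G ?k (\<lambda>j. vlabel G gs j \<otimes>\<^bsub>G\<^esub> h))"
    then have j: "j < ?k" by simp
    then have gj: "gs ! j \<in> carrier G" using gs by auto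
    have "inv\<^bsub>G\<^esub> (v \<otimes>\<^bsub>G\<^esub> h) \<otimes>\<^bsub>G\<^esub> (v \<otimes>\<^bsub>G\<^esub> x \<otimes>\<^bsub>G\<^esub> h) = inv\<^bsub>G\<^esub> h \<otimes>\<^bsub>G\<^esub> x \<otimes>\<^bsub>G\<^esub> h"
      if "v \<in> carrier G" "x \<in> carrier G" for v x
    proof -
      have "inv\<^bsub>G\<^esub> (v \<otimes>\<^bsub>G\<^esub> h) \<otimes>\<^bsub>G\<^esub> (v \<otimes>\<^bsub>G\<^esub> x \<otimes>\<^bsub>G\<^esub> h)
          = inv\<^bsub>G\<^esub> h \<otimes>\<^bsub>G\<^esub> ((inv\<^bsub>G\<^esub> v \<otimes>\<^bsub>G\<^esub> v) \<otimes>\<^bsub>G\<^esub> (x \<otimes>\<^bsub>G\<^esub> h))"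
        using that assms(2) by (simp only: inv_mult_group m_assoc m_closed inv_closed)
      then show ?thesis using that assms(2) by (simp add: m_assoc)
    qed
    then show "simplex_of G ?k (\<lambda>j. vlabel G gs j \<otimes>\<^bsub>G\<^esub> h) ! j = map (inner_aut G h) gs ! j"
      using j gj gs by (simp add: vlabel_Suc inner_aut_def)
  qed simp
  finally have n: "nerve_pull G ?k ((+) (Suc ?k)) (join_simplex G h gs) = map (inner_aut G h) gs" .
  have "simplex_push ?k ((+) (Suc ?k)) t = join_weights ?k 1 t"
  proof
    fix i
    have "t (i - Suc ?k) = 0" if "i > Suc (2 * ?k)"
      using t that by (auto simp: standard_simplex_def)
    moreover have "(\<Sum>l\<le>?k. if Suc ?k + l = i then t l else 0)
        = (\<Sum>l\<le>?k. if l = i - Suc ?k \<and> i > ?k then t l else 0)"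
      by (rule sum.cong) auto
    ultimately show "simplex_push ?k ((+) (Suc ?k)) t i = join_weights ?k 1 t i"
      by (auto simp: simplex_push_eq join_weights_def)
  qed
  moreover have "(+) (Suc ?k) ` {..?k} \<subseteq> {..length (join_simplex G h gs)}" by auto
  ultimately show ?thesis
    using BG_point_nerve_pull[OF join_simplex_closed[OF gs assms(2)] t, of "(+) (Suc ?k)"] n
    by (simp add: conj_homotopy_def z monotone_on_def)
qed

lemma conj_homotopy_base:
  assumes "group G" "h \<in> carrier G"
  shows "conj_homotopy G h s ([], \<lambda>i. if i = 0 then 1 else 0)
      = BG_point G ([h], \<lambda>i. if i = 0 then 1 - s else if i = 1 then s else 0)"
proof -
  interpret group G by fact
  have "join_simplex G h [] = [h]"
    using assms(2) by (simp add: join_simplex_def simplex_of_def join_labels_def)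
  moreover have "join_weights 0 s (\<lambda>i. if i = 0 then 1 else 0)
      = (\<lambda>i. if i = 0 then 1 - s else if i = 1 then s else 0)"
    by (auto simp: join_weights_def)
  ultimately show ?thesis by (simp add: conj_homotopy_def)
qed

lemma continuous_map_snd_pre_realization:
  "continuous_map (pre_realization G) (powertop_real UNIV) snd"
proof -
  have "openin (pre_realization G) {z \<in> topspace (pre_realization G). snd z \<in> U}"
    if U: "openin (powertop_real UNIV) U" for U
  proof -
    have "{x. (gs, x) \<in> {z \<in> topspace (pre_realization G). snd z \<in> U}}
        = U \<inter> standard_simplex (length gs)" if "gs \<in> lists (carrier G)" for gs
      using that by (auto simp: topspace_pre_realization in_lists_conv_set)
    then show ?thesis
      using U unfolding pre_realization_def openin_sum_topology
      by (auto simp: openin_subtopology)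
  qed
  then show ?thesis by (simp add: continuous_map_def)
qed

text \<open>Over a fixed simplex the homotopy has values in a fixed simplex and depends polynomially on the
  coordinates; these pieces are open in the disjoint union.\<close>

lemma continuous_map_conj_homotopy:
  assumes "group G" "h \<in> carrier G"
  shows "continuous_map (prod_topology (pre_realization G) unit_interval) (BG G)
    (\<lambda>z. conj_homotopy G h (snd z) (fst z))"
proof (rule pasting_lemma[where I = "lists (carrier G)"
      and T = "\<lambda>gs. (Pair gs ` standard_simplex (length gs)) \<times> {0..1}"
      and f = "\<lambda>gs z. BG_point G (join_simplex G h gs, join_weights (length gs) (snd z) (snd (fst z)))"])
  interpret group G by fact
  let ?P = "prod_topology (pre_realization G) unit_interval"
  fix gs assume "gs \<in> lists (carrier G)"
  then have gs: "gs \<in> lists (carrier G)" "set gs \<subseteq> carrier G" by auto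
  let ?T = "(Pair gs ` standard_simplex (length gs)) \<times> {0..1::real}"
  have "openin (pre_realization G) (Pair gs ` standard_simplex (length gs))"
    using open_map_component_injection[OF gs(1), of "\<lambda>gs. simplex_top (length gs)"]
    unfolding open_map_def pre_realization_def by (metis openin_topspace topspace_standard_simplex)
  moreover have "openin unit_interval {0..1::real}"
    by (metis openin_topspace topspace_euclidean_subtopology)
  ultimately show "openin ?P ?T"
    by (simp add: openin_prod_Times_iff)
  have coord: "continuous_map ?P euclideanreal (\<lambda>z. snd (fst z) i)" for i
  proof -
    have "continuous_map ?P (powertop_real UNIV) (\<lambda>z. snd (fst z))"
      using continuous_map_compose[OF continuous_map_fst continuous_map_snd_pre_realization]
      by (simp add: o_def)
    then show ?thesis
      by (simp add: continuous_map_componentwise_UNIV)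
  qed
  have time: "continuous_map ?P euclideanreal snd"
    using continuous_map_snd continuous_map_in_subtopology by blast
  show "continuous_map (subtopology ?P ?T) (BG G)
      (\<lambda>z. BG_point G (join_simplex G h gs, join_weights (length gs) (snd z) (snd (fst z))))"
  proof (rule continuous_map_into_cell[OF join_simplex_closed[OF gs(2) assms(2)]])
    show "continuous_map (subtopology ?P ?T) (simplex_top (length (join_simplex G h gs)))
        (\<lambda>z. join_weights (length gs) (snd z) (snd (fst z)))"
    proof (rule continuous_map_into_simplex)
      fix i show "continuous_map (subtopology ?P ?T) euclideanreal
          (\<lambda>z. join_weights (length gs) (snd z) (snd (fst z)) i)"
        by (cases "i \<le> length gs")
           (simp_all add: join_weights_def continuous_map_from_subtopology continuous_map_real_mult
             continuous_map_diff coord time)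
    qed (auto intro!: join_weights_in_simplex)
  qed
next
  fix z assume "z \<in> topspace (prod_topology (pre_realization G) unit_interval)"
  then show "\<exists>gs. gs \<in> lists (carrier G) \<and> z \<in> (Pair gs ` standard_simplex (length gs)) \<times> {0..1} \<and>
      conj_homotopy G h (snd z) (fst z)
        = BG_point G (join_simplex G h gs, join_weights (length gs) (snd z) (snd (fst z)))"
    by (auto simp: topspace_pre_realization conj_homotopy_def)
qed auto

lemma quotient_map_cylinder:
  "quotient_map (prod_topology X unit_interval) (cylinder X) (\<lambda>(x, t). Cyl x t)"
  by (simp add: cylinder_def quotient_map_quot_topology)

lemma topspace_cylinder: "topspace (cylinder X) = (\<lambda>(x, t). Cyl x t) ` (topspace X \<times> {0..1})"
  by (simp add: cylinder_def topspace_quot_topology)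

text \<open>The same homotopy, as a map on the cylinder over \<open>BG\<close>.\<close>

definition conj_cylinder :: "('a point, 'x) monoid_scheme \<Rightarrow> 'a point \<Rightarrow> 'a point \<Rightarrow> 'a point" where
  "conj_cylinder G h = (\<lambda>z\<in>topspace (cylinder (BG G)).
     case z of Cyl x s \<Rightarrow> descend (conj_homotopy G h s) x)"

lemma conj_cylinder_apply:
  assumes "group G" "h \<in> carrier G" "z \<in> topspace (pre_realization G)" "s \<in> {0..1}"
  shows "conj_cylinder G h (Cyl (BG_point G z) s) = conj_homotopy G h s z"
proof -
  have "Cyl (BG_point G z) s \<in> topspace (cylinder (BG G))"
    using assms(3,4) by (auto simp: topspace_cylinder topspace_BG)
  then show ?thesis
    using conj_homotopy_respects[OF assms(1,2,4)] by (simp add: conj_cylinder_def descend_BG_point)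
qed

lemma B_map_inner_aut:
  assumes "group G" "h \<in> carrier G" "z \<in> topspace (pre_realization G)"
  shows "B_map G G (inner_aut G h) (BG_point G z) = BG_point G (map (inner_aut G h) (fst z), snd z)"
proof -
  obtain gs t where w: "BG_point G z = Cell gs t" "(z, (gs, t)) \<in> realization_equiv G"
    using BG_point_cell .
  have "(gs, t) \<in> topspace (pre_realization G)"
    using respects_rel_equiv[OF respects_rel_topspace[OF assms(1)] w(2)] assms(3) by simp
  then have "BG_point G (map (inner_aut G h) gs, t) = conj_homotopy G h 1 (gs, t)"
    using conj_homotopy_1[OF assms(1,2)] by simp
  also have "\<dots> = conj_homotopy G h 1 z"
    using respects_rel_equiv[OF conj_homotopy_respects[OF assms(1,2)] w(2), of 1] by simp
  also have "\<dots> = BG_point G (map (inner_aut G h) (fst z), snd z)"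
    by (rule conj_homotopy_1[OF assms])
  finally have "BG_point G (map (inner_aut G h) gs, t) = BG_point G (map (inner_aut G h) (fst z), snd z)" .
  moreover have "Cell gs t \<in> topspace (BG G)"
    unfolding w(1)[symmetric] topspace_BG using assms(3) by (rule imageI)
  ultimately show ?thesis
    unfolding B_map_def w(1) by simp
qed

lemma continuous_map_conj_cylinder:
  assumes "group G" "h \<in> carrier G"
  shows "continuous_map (cylinder (BG G)) (BG G) (conj_cylinder G h)"
proof -
  let ?q = "\<lambda>(z, s). (BG_point G z, s)" and ?c = "\<lambda>(x, t). Cyl x t"
  have "quotient_map (prod_topology (pre_realization G) unit_interval) (prod_topology (BG G) unit_interval) ?q"
    by (rule quotient_map_prod_left[OF _ _ quotient_map_BG_point])
       (auto intro!: compact_imp_locally_compact_space Hausdorff_space_subtopology simp: compact_space_subtopology)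
  then have "quotient_map (prod_topology (pre_realization G) unit_interval) (cylinder (BG G)) (?c \<circ> ?q)"
    by (rule quotient_map_compose[OF _ quotient_map_cylinder])
  moreover have "continuous_map (prod_topology (pre_realization G) unit_interval) (BG G)
      (conj_cylinder G h \<circ> (?c \<circ> ?q))"
    by (rule continuous_map_eq[OF continuous_map_conj_homotopy[OF assms]])
       (auto simp: conj_cylinder_apply[OF assms])
  ultimately show ?thesis
    by (rule continuous_compose_quotient_map)
qed

lemma homotopy_conj_cylinder:
  assumes "group G" "h \<in> carrier G"
  shows "homotopy_from_to (BG G) (BG G) (conj_cylinder G h) (id_fn (BG G)) (B_map G G (inner_aut G h))"
  unfolding homotopy_from_to_def
proof (intro conjI ballI)
  show "conj_cylinder G h \<in> extensional (topspace (cylinder (BG G)))"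
    by (simp add: conj_cylinder_def)
  fix x assume x: "x \<in> topspace (BG G)"
  then obtain z where z: "z \<in> topspace (pre_realization G)" "x = BG_point G z"
    by (auto simp: topspace_BG)
  show "conj_cylinder G h (Cyl x 0) = id_fn (BG G) x"
    using x by (simp add: z conj_cylinder_apply[OF assms] conj_homotopy_0[OF assms])
  show "conj_cylinder G h (Cyl x 1) = B_map G G (inner_aut G h) x"
    by (simp add: z conj_cylinder_apply[OF assms] conj_homotopy_1[OF assms] B_map_inner_aut[OF assms])
qed (rule continuous_map_conj_cylinder[OF assms])

section \<open>Lines to the base point\<close>

text \<open>The first vertex of the face in whose interior the point \<open>t\<close> lies.\<close>

definition first_vertex :: "(nat \<Rightarrow> real) \<Rightarrow> nat" where
  "first_vertex t = (LEAST i. 0 < t i)"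

text \<open>The point at time \<open>s\<close> of the straight line from \<open>t\<close> to this vertex.\<close>

definition line_weights :: "(nat \<Rightarrow> real) \<Rightarrow> real \<Rightarrow> nat \<Rightarrow> real" where
  "line_weights t s = (\<lambda>i. (1 - s) * t i + s * (if i = first_vertex t then 1 else 0))"

text \<open>The straight line to the first vertex with positive coordinate. Unlike the line to the vertex \<open>0\<close>, it
  is independent of the representative of a point of \<open>BG\<close> (\<open>vertex_line_respects\<close>), and for a
  nondegenerate representative it is the line to the vertex \<open>0\<close>.\<close>

definition vertex_line ::
  "('a point, 'x) monoid_scheme \<Rightarrow> 'a point list \<times> (nat \<Rightarrow> real) \<Rightarrow> real \<Rightarrow> 'a point" where
  "vertex_line G z s = BG_point G (fst z, line_weights (snd z) s)"

abbreviation BG_base :: "('a point, 'x) monoid_scheme \<Rightarrow> 'a point" where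
  "BG_base G \<equiv> BG_point G ([], \<lambda>i. if i = 0 then 1 else 0)"

lemma first_vertex:
  assumes "t \<in> standard_simplex m"
  shows "first_vertex t \<le> m" "0 < t (first_vertex t)" "\<And>i. i < first_vertex t \<Longrightarrow> t i = 0"
proof -
  have t: "\<And>i. 0 \<le> t i" "sum t {..m} = 1"
    using assms by (auto simp: standard_simplex_def)
  obtain i where i: "i \<le> m" "0 < t i"
  proof -
    have "sum t {..m} \<noteq> 0" using t(2) by simp
    then obtain i where "i \<in> {..m}" "t i \<noteq> 0" by (rule sum.not_neutral_contains_not_neutral)
    then show thesis using that[of i] t(1)[of i] by simp
  qed
  show "0 < t (first_vertex t)" unfolding first_vertex_def using i(2) by (rule LeastI)
  show "first_vertex t \<le> m" unfolding first_vertex_def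
    by (rule order_trans[OF Least_le[of "\<lambda>i. 0 < t i", OF i(2)] i(1)])
  show "t i = 0" if "i < first_vertex t" for i
    using not_less_Least[of i "\<lambda>i. 0 < t i"] that t(1)[of i] unfolding first_vertex_def by simp
qed

lemma line_weights_in_simplex:
  assumes "t \<in> standard_simplex m" "s \<in> {0..1}"
  shows "line_weights t s \<in> standard_simplex m"
  unfolding line_weights_def
  using convex_standard_simplex[OF assms(1), of "\<lambda>i. if i = first_vertex t then 1 else 0" s]
    first_vertex(1)[OF assms(1)] assms(2) by simp

lemma first_vertex_push:
  assumes t: "t \<in> standard_simplex m" and \<alpha>: "mono_on {..m} \<alpha>"
  shows "first_vertex (simplex_push m \<alpha> t) = \<alpha> (first_vertex t)"
  unfolding first_vertex_def[of "simplex_push m \<alpha> t"]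
proof (rule Least_equality)
  note f = first_vertex[OF t]
  have nn: "\<And>i. 0 \<le> t i" using t by (simp add: standard_simplex_def)
  have "t (first_vertex t) \<le> simplex_push m \<alpha> t (\<alpha> (first_vertex t))"
    unfolding simplex_push_def using f(1) by (intro member_le_sum) (auto simp: nn)
  then show "0 < simplex_push m \<alpha> t (\<alpha> (first_vertex t))" using f(2) by simp
  fix j assume j: "0 < simplex_push m \<alpha> t j"
  show "\<alpha> (first_vertex t) \<le> j"
  proof (rule ccontr)
    assume "\<not> \<alpha> (first_vertex t) \<le> j"
    then have "i < first_vertex t" if "i \<le> m" "\<alpha> i = j" for i
      using monotone_onD[OF \<alpha>, of "first_vertex t" i] f(1) that by (metis atMost_iff not_le)
    then have "simplex_push m \<alpha> t j = 0"
      unfolding simplex_push_def using f(3) by (intro sum.neutral) auto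
    then show False using j by simp
  qed
qed

lemma simplex_push_line_weights:
  assumes t: "t \<in> standard_simplex m" and \<alpha>: "mono_on {..m} \<alpha>"
  shows "simplex_push m \<alpha> (line_weights t s) = line_weights (simplex_push m \<alpha> t) s"
proof
  fix j
  have "simplex_push m \<alpha> (line_weights t s) j
      = (\<Sum>i\<le>m. (1 - s) * (if \<alpha> i = j then t i else 0)
          + (if i = first_vertex t then (if \<alpha> (first_vertex t) = j then s else 0) else 0))"
    unfolding simplex_push_eq by (rule sum.cong) (auto simp: line_weights_def)
  also have "\<dots> = (1 - s) * simplex_push m \<alpha> t j + (if \<alpha> (first_vertex t) = j then s else 0)"
    using first_vertex(1)[OF t] by (simp add: sum.distrib simplex_push_eq flip: sum_distrib_left)
  finally show "simplex_push m \<alpha> (line_weights t s) j = line_weights (simplex_push m \<alpha> t) s j"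
    by (simp add: line_weights_def first_vertex_push[OF t \<alpha>])
qed

lemma vertex_line_respects:
  assumes "s \<in> {0..1}"
  shows "respects_rel G (\<lambda>z. vertex_line G z s)"
proof (rule respects_relI)
  fix m \<alpha> gs t
  assume gs: "set gs \<subseteq> carrier G" and t: "t \<in> standard_simplex m" and \<alpha>: "mono_on {..m} \<alpha>"
    "\<alpha> ` {..m} \<subseteq> {..length gs}"
  show "vertex_line G (nerve_pull G m \<alpha> gs, t) s = vertex_line G (gs, simplex_push m \<alpha> t) s"
    using BG_point_nerve_pull[OF gs line_weights_in_simplex[OF t assms] \<alpha>]
    by (simp add: vertex_line_def simplex_push_line_weights[OF t \<alpha>(1)])
qed

lemma pathin_vertex_line:
  assumes "z \<in> topspace (pre_realization G)"
  shows "pathin (BG G) (vertex_line G z)"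
proof -
  obtain gs t where z: "z = (gs, t)" and gs: "set gs \<subseteq> carrier G" and t: "t \<in> standard_simplex (length gs)"
    using assms by (auto simp: topspace_pre_realization)
  have "continuous_map unit_interval euclideanreal (\<lambda>s. line_weights t s i)" for i
    unfolding line_weights_def by (auto intro!: continuous_intros)
  then have "continuous_map unit_interval (BG G) (\<lambda>s. BG_point G (gs, line_weights t s))"
    by (intro continuous_map_into_cell[OF gs] continuous_map_into_simplex)
       (auto intro!: line_weights_in_simplex[OF t])
  then show ?thesis
    by (simp add: pathin_def vertex_line_def[abs_def] z)
qed

lemma vertex_line_0: "vertex_line G z 0 = BG_point G z"
  by (simp add: vertex_line_def line_weights_def)

lemma vertex_line_1:
  assumes "z \<in> topspace (pre_realization G)"
  shows "vertex_line G z 1 = BG_base G"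
proof -
  obtain gs t where z: "z = (gs, t)" and gs: "set gs \<subseteq> carrier G" and t: "t \<in> standard_simplex (length gs)"
    using assms by (auto simp: topspace_pre_realization)
  have e: "(\<lambda>i. if i = 0 then 1 else 0) \<in> standard_simplex 0" by (simp add: standard_simplex_0)
  have "simplex_push 0 (\<lambda>_. first_vertex t) (\<lambda>i. if i = 0 then 1 else 0) = line_weights t 1"
    by (auto simp: simplex_push_eq line_weights_def)
  then show ?thesis
    using BG_point_nerve_pull[OF gs e, of "\<lambda>_. first_vertex t"] first_vertex(1)[OF t]
    by (simp add: vertex_line_def z monotone_on_def nerve_pull_def)
qed

lemma vertex_line_base: "vertex_line G ([], \<lambda>i. if i = 0 then 1 else 0) s = BG_base G"
proof -
  have "first_vertex (\<lambda>i. if i = 0 then 1 else 0) = 0"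
    unfolding first_vertex_def by (rule Least_equality) auto
  then have "line_weights (\<lambda>i. if i = 0 then 1 else 0) s = (\<lambda>i. if i = 0 then 1 else 0)"
    by (auto simp: line_weights_def)
  then show ?thesis by (simp add: vertex_line_def)
qed

lemma base_in_pre_realization: "([], \<lambda>i. if i = 0 then 1 else 0) \<in> topspace (pre_realization G)"
  by (simp add: topspace_pre_realization standard_simplex_0)

lemma BG_base_in_topspace: "BG_base G \<in> topspace (BG G)"
  using base_in_pre_realization topspace_BG by blast

lemma path_connected_BG: "path_connected_space (BG G)"
proof -
  have "path_component_of (BG G) x (BG_base G)" if x: "x \<in> topspace (BG G)" for x
  proof -
    obtain z where z: "z \<in> topspace (pre_realization G)" "x = BG_point G z"
      using x by (auto simp: topspace_BG)
    show ?thesis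
      unfolding path_component_of_def
      by (rule exI[of _ "vertex_line G z"])
         (simp add: pathin_vertex_line[OF z(1)] vertex_line_0 vertex_line_1[OF z(1)] z(2))
  qed
  then show ?thesis
    unfolding path_connected_space_iff_path_component
    by (blast intro: path_component_of_sym path_component_of_trans)
qed

section \<open>Nondegenerate representatives\<close>

text \<open>The pairs of a nondegenerate simplex and a point in its interior, among which \<open>interior_rep\<close> selects.\<close>

definition nondegenerate :: "('g, 'x) monoid_scheme \<Rightarrow> 'g list \<times> (nat \<Rightarrow> real) \<Rightarrow> bool" where
  "nondegenerate G = (\<lambda>(gs, t). gs \<in> lists (carrier G) \<and> \<one>\<^bsub>G\<^esub> \<notin> set gs \<and>
      t \<in> standard_simplex (length gs) \<and> (\<forall>i\<le>length gs. 0 < t i))"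

lemma nondegenerate_exists:
  assumes "group G" "set gs \<subseteq> carrier G" "t \<in> standard_simplex (length gs)"
  shows "\<exists>w. nondegenerate G w \<and> BG_point G w = BG_point G (gs, t)"
  using assms(2,3)
proof (induction "length gs" arbitrary: gs t)
  interpret group G by fact
  case 0
  then have "t 0 = 1" "gs = []" by (auto simp: standard_simplex_0)
  then show ?case using 0 by (intro exI[of _ "(gs, t)"]) (simp add: nondegenerate_def)
next
  interpret group G by fact
  case (Suc k)
  note gs = Suc.prems(1) and k = Suc.hyps(2)
  have t: "t \<in> standard_simplex (Suc k)" using Suc.prems(2) k by simp
  consider "nondegenerate G (gs, t)" | i where "i \<le> Suc k" "t i = 0" | j where "j \<le> k" "gs ! j = \<one>\<^bsub>G\<^esub>"
  proof -
    have "\<exists>j\<le>k. gs ! j = \<one>\<^bsub>G\<^esub>" if "\<one>\<^bsub>G\<^esub> \<in> set gs"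
      using that k by (metis in_set_conv_nth less_Suc_eq_le)
    moreover have "0 < t i \<or> t i = 0" for i
      using t by (auto simp: standard_simplex_def order_le_less)
    ultimately show thesis
      using that gs t k unfolding nondegenerate_def by (auto simp: in_lists_conv_set)
  qed
  then show ?case
  proof cases
    case 1
    then show ?thesis by blast
  next
    case 2
    \<comment> \<open>The point lies in the \<open>i\<close>-th face.\<close>
    define \<alpha> where "\<alpha> l = (if l < i then l else Suc l)" for l
    have \<alpha>: "mono_on {..k} \<alpha>" "\<alpha> ` {..k} \<subseteq> {..length gs}"
      using k by (auto simp: \<alpha>_def monotone_on_def)
    define u where "u l = (if l \<le> k then t (\<alpha> l) else 0)" for l
    have img: "{..Suc k} - {i} = \<alpha> ` {..k}"
    proof (intro equalityI subsetI)
      fix l assume l: "l \<in> {..Suc k} - {i}"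
      then have "l = \<alpha> (if l < i then l else l - 1)" "(if l < i then l else l - 1) \<in> {..k}"
        using 2(1) by (auto simp: \<alpha>_def)
      then show "l \<in> \<alpha> ` {..k}" by blast
    qed (auto simp: \<alpha>_def split: if_splits)
    have inj: "inj_on \<alpha> {..k}" by (auto simp: inj_on_def \<alpha>_def split: if_splits)
    have "sum u {..k} = sum t (\<alpha> ` {..k})"
      unfolding sum.reindex[OF inj] by (simp add: u_def)
    also have "\<dots> = sum t {..Suc k}"
      unfolding img[symmetric] using 2 by (simp add: sum_diff1)
    finally have u: "u \<in> standard_simplex k"
      using t by (auto simp: standard_simplex_def u_def)
    have "simplex_push k \<alpha> u = t"
    proof
      fix j
      show "simplex_push k \<alpha> u j = t j"
      proof (cases "j \<in> \<alpha> ` {..k}")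
        case True
        then obtain l where l: "l \<le> k" "j = \<alpha> l" by auto
        have "simplex_push k \<alpha> u j = (\<Sum>i\<le>k. if i = l then t j else 0)"
          unfolding simplex_push_eq
        proof (rule sum.cong)
          fix i assume "i \<in> {..k}"
          then show "(if \<alpha> i = j then u i else 0) = (if i = l then t j else 0)"
            using l inj_onD[OF inj, of i l] by (auto simp: u_def)
        qed simp
        then show ?thesis using l by simp
      next
        case False
        then have "j = i \<or> Suc k < j" unfolding img[symmetric] by auto
        then have "t j = 0"
          using 2 t by (auto simp: standard_simplex_def)
        moreover have "simplex_push k \<alpha> u j = 0"
          unfolding simplex_push_eq using False by (intro sum.neutral) auto
        ultimately show ?thesis by simp
      qed
    qed
    then have "BG_point G (nerve_pull G k \<alpha> gs, u) = BG_point G (gs, t)"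
      using BG_point_nerve_pull[OF gs u \<alpha>] by simp
    moreover have "\<exists>w. nondegenerate G w \<and> BG_point G w = BG_point G (nerve_pull G k \<alpha> gs, u)"
      using Suc.hyps(1)[of "nerve_pull G k \<alpha> gs" u] nerve_pull_closed[OF gs \<alpha>(1)] u by simp
    ultimately show ?thesis by simp
  next
    case 3
    \<comment> \<open>The simplex is the \<open>j\<close>-th degeneracy of the simplex with the entry \<open>gs ! j\<close> omitted.\<close>
    define \<sigma> where "\<sigma> l = (if l \<le> j then l else l - 1)" for l
    define \<delta> where "\<delta> l = (if l \<le> j then l else Suc l)" for l
    let ?hs = "simplex_of G k (\<lambda>l. vlabel G gs (\<delta> l))"
    have hs: "set ?hs \<subseteq> carrier G" by (rule simplex_of_closed) (simp add: gs)
    have \<sigma>: "mono_on {..Suc k} \<sigma>" "\<sigma> ` {..Suc k} \<subseteq> {..length ?hs}"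
      using 3(1) by (auto simp: \<sigma>_def monotone_on_def)
    have "vlabel G gs (\<delta> (\<sigma> l)) = vlabel G gs l" if "l \<le> Suc k" for l
    proof (cases "l = Suc j")
      case True
      then show ?thesis
        using vlabel_Suc[OF gs, of j] 3 k gs by (simp add: \<delta>_def \<sigma>_def)
    qed (auto simp: \<delta>_def \<sigma>_def)
    then have "nerve_pull G (Suc k) \<sigma> ?hs = simplex_of G (Suc k) (vlabel G gs)"
      using nerve_pull_simplex_of[of k "\<lambda>l. vlabel G gs (\<delta> l)", OF _ \<sigma>(1)] \<sigma>(2) gs
      by (auto intro!: simplex_of_cong)
    then have "nerve_pull G (Suc k) \<sigma> ?hs = gs"
      using simplex_of_vlabel[OF gs] k by simp
    then have "BG_point G (gs, t) = BG_point G (?hs, simplex_push (Suc k) \<sigma> t)"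
      using BG_point_nerve_pull[OF hs t \<sigma>] by simp
    moreover have "\<exists>w. nondegenerate G w \<and> BG_point G w = BG_point G (?hs, simplex_push (Suc k) \<sigma> t)"
      using Suc.hyps(1)[of ?hs "simplex_push (Suc k) \<sigma> t"] hs simplex_push_in_simplex[OF t \<sigma>(2)] by simp
    ultimately show ?thesis by simp
  qed
qed

text \<open>The index of the segment that contains \<open>x\<close>.\<close>

definition step_index :: "(nat \<Rightarrow> real) \<Rightarrow> real \<Rightarrow> nat" where
  "step_index t x = (LEAST i. x < (\<Sum>l\<le>i. t l))"

text \<open>A simplex with a point in it is encoded by a step function from \<open>[0, 1)\<close> to \<open>G\<close>: divide the interval into
  segments of lengths \<open>t\<^sub>0, \<dots>, t\<^sub>k\<close> and take the label of vertex \<open>i\<close> on the \<open>i\<close>-th segment, normalised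
  by left multiplication to the value \<open>\<one>\<close> at \<open>0\<close>. Simplicial operators do not change this function
  (\<open>step_label_respects\<close>). It determines a nondegenerate simplex, since there all segments are nonempty
  and consecutive labels are different.\<close>

definition step_label :: "('g, 'x) monoid_scheme \<Rightarrow> real \<Rightarrow> 'g list \<times> (nat \<Rightarrow> real) \<Rightarrow> 'g" where
  "step_label G x z =
     inv\<^bsub>G\<^esub> (vlabel G (fst z) (step_index (snd z) 0)) \<otimes>\<^bsub>G\<^esub> vlabel G (fst z) (step_index (snd z) x)"

lemma step_index:
  assumes t: "t \<in> standard_simplex m" and x: "0 \<le> x" "x < 1"
  shows "step_index t x \<le> m" "x < (\<Sum>l\<le>step_index t x. t l)" "(\<Sum>l<step_index t x. t l) \<le> x"
proof -
  have m: "x < (\<Sum>l\<le>m. t l)" using t x by (simp add: standard_simplex_def)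
  show "step_index t x \<le> m" unfolding step_index_def using m by (rule Least_le)
  show "x < (\<Sum>l\<le>step_index t x. t l)" unfolding step_index_def using m by (rule LeastI)
  show "(\<Sum>l<step_index t x. t l) \<le> x"
  proof (cases "step_index t x")
    case (Suc i)
    then have "\<not> x < (\<Sum>l\<le>i. t l)"
      using not_less_Least[of i "\<lambda>i. x < (\<Sum>l\<le>i. t l)"] unfolding step_index_def by simp
    then show ?thesis using Suc by (simp add: lessThan_Suc_atMost)
  qed (simp add: x)
qed

lemma step_index_eqI:
  assumes "\<And>l. 0 \<le> t l" "(\<Sum>l<i. t l) \<le> x" "x < (\<Sum>l\<le>i. t l)"
  shows "step_index t x = i"
  unfolding step_index_def
proof (rule Least_equality)
  fix j assume j: "x < (\<Sum>l\<le>j. t l)"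
  show "i \<le> j"
  proof (rule ccontr)
    assume "\<not> i \<le> j"
    then have "(\<Sum>l\<le>j. t l) \<le> (\<Sum>l<i. t l)"
      by (intro sum_mono2) (auto simp: assms(1))
    then show False using j assms(2) by simp
  qed
qed (rule assms(3))

lemma step_index_push:
  assumes t: "t \<in> standard_simplex m" and \<alpha>: "mono_on {..m} \<alpha>" and x: "0 \<le> x" "x < 1"
  shows "step_index (simplex_push m \<alpha> t) x = \<alpha> (step_index t x)"
proof (rule step_index_eqI)
  note s = step_index[OF t x]
  have nn: "0 \<le> t l" for l using t by (simp add: standard_simplex_def)
  show "0 \<le> simplex_push m \<alpha> t l" for l
    unfolding simplex_push_def by (rule sum_nonneg) (simp add: nn)
  have cum: "(\<Sum>j\<in>A. simplex_push m \<alpha> t j) = sum t {l. l \<le> m \<and> \<alpha> l \<in> A}" if "finite A" for A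
  proof -
    have "(\<Sum>j\<in>A. simplex_push m \<alpha> t j) = (\<Sum>l\<le>m. \<Sum>j\<in>A. if \<alpha> l = j then t l else 0)"
      unfolding simplex_push_eq by (rule sum.swap)
    also have "\<dots> = (\<Sum>l\<le>m. if \<alpha> l \<in> A then t l else 0)"
      using that by simp
    also have "\<dots> = sum t {l. l \<le> m \<and> \<alpha> l \<in> A}"
      by (simp flip: sum.inter_filter)
    finally show ?thesis .
  qed
  have "sum t {l. l \<le> m \<and> \<alpha> l \<in> {..<\<alpha> (step_index t x)}} \<le> sum t {..<step_index t x}"
  proof (rule sum_mono2)
    show "{l. l \<le> m \<and> \<alpha> l \<in> {..<\<alpha> (step_index t x)}} \<subseteq> {..<step_index t x}"
      using monotone_onD[OF \<alpha>] s(1) by (auto simp: not_le[symmetric])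
  qed (auto simp: nn)
  then show "(\<Sum>l<\<alpha> (step_index t x). simplex_push m \<alpha> t l) \<le> x"
    unfolding cum[OF finite_lessThan] using s(3) by linarith
  have "sum t {..step_index t x} \<le> sum t {l. l \<le> m \<and> \<alpha> l \<in> {..\<alpha> (step_index t x)}}"
    by (rule sum_mono2) (use monotone_onD[OF \<alpha>] s(1) nn in auto)
  then show "x < (\<Sum>l\<le>\<alpha> (step_index t x). simplex_push m \<alpha> t l)"
    unfolding cum[OF finite_atMost] using s(2) by linarith
qed

lemma step_label_respects:
  assumes "group G" "0 \<le> x" "x < 1"
  shows "respects_rel G (step_label G x)"
proof (rule respects_relI)
  interpret group G by fact
  fix m \<alpha> gs t
  assume gs: "set gs \<subseteq> carrier G" and t: "t \<in> standard_simplex m" and \<alpha>: "mono_on {..m} \<alpha>"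
    "\<alpha> ` {..m} \<subseteq> {..length gs}"
  have "inv\<^bsub>G\<^esub> (inv\<^bsub>G\<^esub> u \<otimes>\<^bsub>G\<^esub> a) \<otimes>\<^bsub>G\<^esub> (inv\<^bsub>G\<^esub> u \<otimes>\<^bsub>G\<^esub> b) = inv\<^bsub>G\<^esub> a \<otimes>\<^bsub>G\<^esub> b"
    if "u \<in> carrier G" "a \<in> carrier G" "b \<in> carrier G" for u a b
  proof -
    have "inv\<^bsub>G\<^esub> (inv\<^bsub>G\<^esub> u \<otimes>\<^bsub>G\<^esub> a) \<otimes>\<^bsub>G\<^esub> (inv\<^bsub>G\<^esub> u \<otimes>\<^bsub>G\<^esub> b)
        = inv\<^bsub>G\<^esub> a \<otimes>\<^bsub>G\<^esub> ((u \<otimes>\<^bsub>G\<^esub> inv\<^bsub>G\<^esub> u) \<otimes>\<^bsub>G\<^esub> b)"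
      using that by (simp only: inv_mult_group m_assoc m_closed inv_closed inv_inv)
    then show ?thesis using that by simp
  qed
  then show "step_label G x (nerve_pull G m \<alpha> gs, t) = step_label G x (gs, simplex_push m \<alpha> t)"
    using step_index(1)[OF t, of x] step_index(1)[OF t, of 0] assms gs
    by (simp add: step_label_def step_index_push[OF t \<alpha>(1)] vlabel_nerve_pull[OF gs \<alpha>(1)])
qed

lemma nondegenerate_step_label:
  assumes "group G" "nondegenerate G (gs, t)" "i \<le> length gs" "(\<Sum>l<i. t l) \<le> x" "x < (\<Sum>l\<le>i. t l)"
  shows "step_label G x (gs, t) = vlabel G gs i"
proof -
  interpret group G by fact
  have t: "\<And>l. 0 \<le> t l" "0 < t 0" and gs: "set gs \<subseteq> carrier G"
    using assms(2) by (auto simp: nondegenerate_def standard_simplex_def)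
  have "step_index t x = i" by (rule step_index_eqI[OF t(1) assms(4,5)])
  moreover have "step_index t 0 = 0" by (rule step_index_eqI[OF t(1)]) (simp_all add: t)
  ultimately show ?thesis using gs by (simp add: step_label_def)
qed

lemma nondegenerate_partial_sum:
  assumes "nondegenerate G (gs, t)"
  shows "i \<le> length gs \<Longrightarrow> (\<Sum>l<i. t l) < 1" "(\<Sum>l<Suc (length gs). t l) = 1" "0 \<le> (\<Sum>l<i. t l)"
proof -
  have t: "\<And>l. 0 \<le> t l" "\<And>l. l \<le> length gs \<Longrightarrow> 0 < t l" "(\<Sum>l\<le>length gs. t l) = 1"
    using assms by (auto simp: nondegenerate_def standard_simplex_def)
  show "(\<Sum>l<Suc (length gs). t l) = 1" using t(3) by (simp add: lessThan_Suc_atMost)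
  show "0 \<le> (\<Sum>l<i. t l)" by (rule sum_nonneg) (simp add: t)
  assume i: "i \<le> length gs"
  have "(\<Sum>l<i. t l) < (\<Sum>l\<le>length gs. t l)"
    by (rule sum_strict_mono2[where b = i]) (use i t in auto)
  then show "(\<Sum>l<i. t l) < 1" using t(3) by simp
qed

text \<open>If both step functions agree and their \<open>i\<close>-th segments start at the same point, then the first one
  cannot jump before the second one does.\<close>

lemma nondegenerate_jump_le:
  assumes G: "group G" and n: "nondegenerate G (gs, t)" "nondegenerate G (hs, u)"
    and eq: "\<And>x. 0 \<le> x \<Longrightarrow> x < 1 \<Longrightarrow> step_label G x (gs, t) = step_label G x (hs, u)"
    and i: "i \<le> length gs" "i \<le> length hs" and S: "(\<Sum>l<i. t l) = (\<Sum>l<i. u l)"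
  shows "(\<Sum>l<Suc i. u l) \<le> (\<Sum>l<Suc i. t l)"
proof (rule ccontr)
  interpret group G by fact
  assume "\<not> ?thesis"
  then have lt: "(\<Sum>l<Suc i. t l) < (\<Sum>l<Suc i. u l)" by simp
  have pos: "\<And>l. l \<le> length gs \<Longrightarrow> 0 < t l" "\<And>l. l \<le> length hs \<Longrightarrow> 0 < u l"
    and gs: "set gs \<subseteq> carrier G" "\<one>\<^bsub>G\<^esub> \<notin> set gs"
    using n by (auto simp: nondegenerate_def)
  have "(\<Sum>l<Suc i. u l) \<le> 1"
    using nondegenerate_partial_sum(1)[OF n(2), of "Suc i"] nondegenerate_partial_sum(2)[OF n(2)] i(2)
    by (cases "i = length hs") auto
  then have x1: "(\<Sum>l<Suc i. t l) < 1" using lt by linarith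
  then have i': "i < length gs"
    using nondegenerate_partial_sum(2)[OF n(1)] i(1) by (cases "i = length gs") auto
  \<comment> \<open>At \<open>?x\<close> the first step function has jumped to the label of vertex \<open>i + 1\<close>, the second has not.\<close>
  let ?a = "\<Sum>l<i. t l" and ?x = "\<Sum>l<Suc i. t l"
  have ti: "0 < t i" "0 < t (Suc i)" "0 < u i" using pos i i' by auto
  have "vlabel G gs i = step_label G ?a (gs, t)"
    by (rule nondegenerate_step_label[OF G n(1), symmetric]) (use i ti in \<open>auto simp flip: lessThan_Suc_atMost\<close>)
  also have "\<dots> = step_label G ?a (hs, u)"
    using eq nondegenerate_partial_sum(1,3)[OF n(1)] i by simp
  also have "\<dots> = vlabel G hs i"
    by (rule nondegenerate_step_label[OF G n(2)]) (use i ti S in \<open>auto simp flip: lessThan_Suc_atMost\<close>)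
  also have "\<dots> = step_label G ?x (hs, u)"
    by (rule nondegenerate_step_label[OF G n(2), symmetric])
       (use i ti S lt in \<open>auto simp flip: lessThan_Suc_atMost\<close>)
  also have "\<dots> = step_label G ?x (gs, t)"
    using eq[of ?x] nondegenerate_partial_sum(3)[OF n(1), of "Suc i"] x1 by simp
  also have "\<dots> = vlabel G gs (Suc i)"
    by (rule nondegenerate_step_label[OF G n(1)]) (use i' ti in \<open>auto simp flip: lessThan_Suc_atMost\<close>)
  finally have "vlabel G gs i = vlabel G gs i \<otimes>\<^bsub>G\<^esub> gs ! i"
    using vlabel_Suc[OF gs(1) i'] by simp
  moreover have "gs ! i \<in> set gs" using i' by simp
  ultimately have "gs ! i = \<one>\<^bsub>G\<^esub>"
    using gs(1) by (metis l_cancel_one' subsetD vlabel_closed)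
  then show False using gs(2) \<open>gs ! i \<in> set gs\<close> by simp
qed

lemma nondegenerate_unique:
  assumes G: "group G" and n: "nondegenerate G (gs, t)" "nondegenerate G (hs, u)"
    and eq: "BG_point G (gs, t) = BG_point G (hs, u)"
  shows "(gs, t) = (hs, u)"
proof -
  interpret group G by fact
  have lab: "step_label G x (gs, t) = step_label G x (hs, u)" if "0 \<le> x" "x < 1" for x
    by (rule BG_point_eq_imp[OF step_label_respects[OF G that] eq])
  have S: "(\<Sum>l<i. t l) = (\<Sum>l<i. u l)" if "i \<le> Suc (length gs)" "i \<le> Suc (length hs)" for i
    using that
  proof (induction i)
    case (Suc i)
    then have "(\<Sum>l<i. t l) = (\<Sum>l<i. u l)" by simp
    then show ?case
      using nondegenerate_jump_le[OF G n lab, of i] nondegenerate_jump_le[OF G n(2,1) lab[symmetric], of i]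
        Suc.prems by simp
  qed simp
  have len: "length gs = length hs"
  proof (rule antisym; rule ccontr)
    assume "\<not> length gs \<le> length hs"
    then show False
      using S[of "Suc (length hs)"] nondegenerate_partial_sum(2)[OF n(2)]
        nondegenerate_partial_sum(1)[OF n(1), of "Suc (length hs)"] by simp
  next
    assume "\<not> length hs \<le> length gs"
    then show False
      using S[of "Suc (length gs)"] nondegenerate_partial_sum(2)[OF n(1)]
        nondegenerate_partial_sum(1)[OF n(2), of "Suc (length gs)"] by simp
  qed
  have tu: "t i = u i" for i
  proof (cases "i \<le> length gs")
    case True
    then show ?thesis using S[of i] S[of "Suc i"] len by simp
  next
    case False
    then show ?thesis using n len by (simp add: nondegenerate_def standard_simplex_def)
  qed
  have pos: "\<And>l. l \<le> length gs \<Longrightarrow> 0 < t l" and c: "set gs \<subseteq> carrier G" "set hs \<subseteq> carrier G"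
    using n by (auto simp: nondegenerate_def)
  have "vlabel G gs i = vlabel G hs i" if "i \<le> length gs" for i
  proof -
    let ?a = "\<Sum>l<i. t l"
    have "vlabel G gs i = step_label G ?a (gs, t)"
      by (rule nondegenerate_step_label[OF G n(1), symmetric])
         (use that pos in \<open>auto simp flip: lessThan_Suc_atMost\<close>)
    also have "\<dots> = step_label G ?a (hs, u)"
      using lab nondegenerate_partial_sum(1,3)[OF n(1)] that by simp
    also have "\<dots> = vlabel G hs i"
      by (rule nondegenerate_step_label[OF G n(2)])
         (use that pos len tu in \<open>auto simp flip: lessThan_Suc_atMost\<close>)
    finally show ?thesis .
  qed
  then have "gs = hs"
    using simplex_of_vlabel[OF c(1)] simplex_of_vlabel[OF c(2)] len simplex_of_cong by metis
  then show ?thesis using tu by auto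
qed

lemma line_to_base_eq:
  assumes "group G" "z \<in> topspace (pre_realization G)"
  shows "line_to_base G (BG_point G z) = path_class (BG G) (vertex_line G z)"
proof -
  have "set (fst z) \<subseteq> carrier G" "snd z \<in> standard_simplex (length (fst z))"
    using assms(2) by (auto simp: topspace_pre_realization)
  then obtain gs t where w: "nondegenerate G (gs, t)" "BG_point G (gs, t) = BG_point G z"
    using nondegenerate_exists[OF assms(1), of "fst z" "snd z"] by auto
  have "interior_rep G (BG_point G z) = (gs, t)"
    unfolding interior_rep_def
  proof (rule the_equality)
    fix w' assume w': "case w' of (gs', t') \<Rightarrow> gs' \<in> lists (carrier G) \<and> \<one>\<^bsub>G\<^esub> \<notin> set gs' \<and>
      t' \<in> standard_simplex (length gs') \<and> (\<forall>i\<le>length gs'. 0 < t' i) \<and> BG_point G (gs', t') = BG_point G z"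
    obtain gs' t' where "w' = (gs', t')" by (cases w')
    then show "w' = (gs, t)"
      using nondegenerate_unique[OF assms(1), of gs' t' gs t] w w' by (auto simp: nondegenerate_def)
  qed (use w in \<open>auto simp: nondegenerate_def\<close>)
  moreover have "0 < t 0" using w(1) by (simp add: nondegenerate_def)
  then have "first_vertex t = 0" unfolding first_vertex_def by (intro Least_equality) auto
  ultimately have "line_to_base G (BG_point G z) = path_class (BG G) (vertex_line G (gs, t))"
    by (simp add: line_to_base_def vertex_line_def[abs_def] line_weights_def)
  also have "\<dots> = path_class (BG G) (vertex_line G z)"
  proof (rule path_class_cong)
    show "pathin (BG G) (vertex_line G (gs, t))"
      by (rule pathin_vertex_line) (use w(1) in \<open>auto simp: nondegenerate_def topspace_pre_realization\<close>)
    show "vertex_line G (gs, t) s = vertex_line G z s" if "s \<in> {0..1}" for s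
      by (rule BG_point_eq_imp[OF vertex_line_respects[OF that] w(2)])
  qed
  finally show ?thesis .
qed

section \<open>The normalised system with a given twist\<close>

lemma Zt_system_eqI:
  assumes "Zt_system X \<Lambda>" "Zt_system X \<Lambda>'"
    and "\<And>p. pathin X p \<Longrightarrow> \<Lambda> (path_class X p) = \<Lambda>' (path_class X p)"
  shows "\<Lambda> = \<Lambda>'"
proof (rule extensionalityI[of _ "path_groupoid X"])
  show "\<Lambda> \<in> extensional (path_groupoid X)" "\<Lambda>' \<in> extensional (path_groupoid X)"
    using assms(1,2) by (simp_all add: Zt_system_def PiE_iff)
  show "\<Lambda> a = \<Lambda>' a" if "a \<in> path_groupoid X" for a
    using that assms(3) by (auto simp: path_groupoid_def)
qed

text \<open>A choice of a path from each point of \<open>BG\<close> to the base point, in the class \<open>line_to_base\<close>. At the base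
  point the representative is prescribed, so that the path is constant.\<close>

definition base_line :: "('a point, 'x) monoid_scheme \<Rightarrow> 'a point \<Rightarrow> real \<Rightarrow> 'a point" where
  "base_line G x = vertex_line G (if x = BG_base G then ([], \<lambda>i. if i = 0 then 1 else 0)
    else SOME z. z \<in> topspace (pre_realization G) \<and> BG_point G z = x)"

lemma base_line:
  assumes "group G" "x \<in> topspace (BG G)"
  shows "pathin (BG G) (base_line G x)" "base_line G x 0 = x" "base_line G x 1 = BG_base G"
    "line_to_base G x = path_class (BG G) (base_line G x)"
proof -
  obtain z where z: "z \<in> topspace (pre_realization G)" "BG_point G z = x" "base_line G x = vertex_line G z"
  proof (cases "x = BG_base G")
    case True
    then show ?thesis
      using that[of "([], \<lambda>i. if i = 0 then 1 else 0)"] base_in_pre_realization[of G] by (simp add: base_line_def)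
  next
    case False
    let ?z = "SOME z. z \<in> topspace (pre_realization G) \<and> BG_point G z = x"
    have "\<exists>z. z \<in> topspace (pre_realization G) \<and> BG_point G z = x"
      using assms(2) by (auto simp: topspace_BG)
    from someI_ex[OF this] show ?thesis
      using that[of ?z] False by (simp add: base_line_def)
  qed
  show "pathin (BG G) (base_line G x)" "base_line G x 0 = x" "base_line G x 1 = BG_base G"
    "line_to_base G x = path_class (BG G) (base_line G x)"
    using z(2) pathin_vertex_line[OF z(1)] vertex_line_0[of G z] vertex_line_1[OF z(1)]
      line_to_base_eq[OF assms(1) z(1)] by (simp_all add: z(3))
qed

lemma base_line_base: "base_line G (BG_base G) = (\<lambda>_. BG_base G)"
  by (simp add: base_line_def fun_eq_iff vertex_line_base)

lemma normalised_system_unique: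
  assumes G: "group G"
    and L1: "Zt_system (BG G) \<Lambda>1" "\<And>x. x \<in> topspace (BG G) \<Longrightarrow> \<Lambda>1 (line_to_base G x) = 1"
    and L2: "Zt_system (BG G) \<Lambda>2" "\<And>x. x \<in> topspace (BG G) \<Longrightarrow> \<Lambda>2 (line_to_base G x) = 1"
    and tw: "twist (BG G) \<Lambda>1 = twist (BG G) \<Lambda>2"
  shows "\<Lambda>1 = \<Lambda>2"
proof (rule Zt_system_eqI[OF L1(1) L2(1)])
  fix p assume p: "pathin (BG G) p"
  note l = base_line[OF G]
  have "cohomologous (BG G) (cocycle_of (BG G) \<Lambda>1) (cocycle_of (BG G) \<Lambda>2)"
    using tw cohomology_class_eq_iff cocycle_imp_cochain cocycle_of_cocycle[OF L1(1)]
      cocycle_of_cocycle[OF L2(1)] twist_eq[OF path_connected_BG L1(1)] twist_eq[OF path_connected_BG L2(1)]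
    by metis
  then obtain e where e: "e \<in> topspace (BG G) \<rightarrow> {1, -1}"
    and v: "\<And>L. pathin (BG G) L \<Longrightarrow> \<Lambda>2 (path_class (BG G) L) = \<Lambda>1 (path_class (BG G) L) * (e (L 0) * e (L 1))"
    unfolding cohomologous_def by (auto simp: cocycle_of_path_simplex)
  have "e (BG_base G) = 1 \<or> e (BG_base G) = -1"
    using e BG_base_in_topspace by fastforce
  moreover have "e x * e (BG_base G) = 1" if "x \<in> topspace (BG G)" for x
    using v[OF l(1)[OF that]] l(2-4)[OF that] L1(2)[OF that] L2(2)[OF that] by simp
  ultimately have "e x = e (BG_base G)" if "x \<in> topspace (BG G)" for x
    using that by force
  then have "e (p 0) * e (p 1) = 1"
    using \<open>e (BG_base G) = 1 \<or> e (BG_base G) = -1\<close> path_start_in_topspace[OF p] path_finish_in_topspace[OF p]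
    by auto
  then show "\<Lambda>1 (path_class (BG G) p) = \<Lambda>2 (path_class (BG G) p)"
    using v[OF p] by simp
qed

lemma normalised_system_exists:
  assumes G: "group G" and w: "w \<in> H1 (BG G)"
  shows "\<exists>\<Lambda>. Zt_system (BG G) \<Lambda> \<and> twist (BG G) \<Lambda> = w \<and>
    (\<forall>x\<in>topspace (BG G). \<Lambda> (line_to_base G x) = 1)"
proof -
  let ?X = "BG G"
  note l = base_line[OF G]
  obtain c where c: "c \<in> cocycles 1 ?X" "w = cohomology_class 1 ?X c" using H1E[OF w] .
  note pm = cochain_1_value[OF cocycle_imp_cochain[OF c(1)]]
  define e where "e x = c (path_simplex (base_line G x))" for x
  have e: "e \<in> topspace ?X \<rightarrow> {1, -1}" using pm l(1) by (auto simp: e_def)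
  define d where "d = (\<lambda>\<sigma>\<in>singular_simplex_set 1 ?X. c \<sigma> * (e (\<sigma> (seg 0)) * e (\<sigma> (seg 1))))"
  have dv: "d (path_simplex L) = c (path_simplex L) * (e (L 0) * e (L 1))" if "pathin ?X L" for L
    using singular_simplex_path_simplex[OF that] by (simp add: d_def)
  have "d \<in> cochains 1 ?X"
    unfolding cochains_def
  proof (rule PiE_I)
    fix \<sigma> assume "\<sigma> \<in> singular_simplex_set 1 ?X"
    then obtain L where L: "pathin ?X L" "\<sigma> = path_simplex L"
      using singular_1_simplex_eq by (metis mem_Collect_eq)
    have "e (L 0) \<in> {1, -1}" "e (L 1) \<in> {1, -1}"
      using e path_start_in_topspace[OF L(1)] path_finish_in_topspace[OF L(1)] by blast+
    then show "d \<sigma> \<in> {1, -1}" using dv[OF L(1)] pm[OF L(1)] L(2) by auto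
  qed (simp add: d_def)
  moreover have cd: "cohomologous ?X c d"
    unfolding cohomologous_def by (rule bexI[OF _ e]) (simp add: dv)
  ultimately have d: "d \<in> cocycles 1 ?X" "cohomology_class 1 ?X d = w"
    using cohomologous_cocycle[OF c(1)] cohomology_class_eq_iff[OF cocycle_imp_cochain[OF c(1)]] c(2) by auto
  let ?L = "system_of ?X d"
  have S: "Zt_system ?X ?L" by (rule Zt_system_system_of[OF d(1)])
  moreover have "twist ?X ?L = w"
  proof -
    have "cocycle_of ?X ?L = d"
      by (rule cochains_1_eqI)
         (use cocycle_of_cocycle[OF S] d(1) in \<open>auto intro!: cochains_extensional cocycle_imp_cochain
           simp: cocycle_of_path_simplex system_of_path_class simp del: One_nat_def\<close>)
    then show ?thesis using twist_eq[OF path_connected_BG S] d(2) by simp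
  qed
  moreover have "?L (line_to_base G x) = 1" if x: "x \<in> topspace ?X" for x
  proof -
    have "?L (line_to_base G x) = c (path_simplex (base_line G x)) * (e x * e (BG_base G))"
      using l(1-4)[OF x] dv by (simp add: system_of_path_class[OF d(1)])
    moreover have "e (BG_base G) = 1"
      unfolding e_def base_line_base by (rule cocycle_const[OF c(1) BG_base_in_topspace])
    ultimately show ?thesis using pm[OF l(1)[OF x]] by (auto simp: e_def)
  qed
  ultimately show ?thesis by blast
qed

lemma BG_system:
  assumes "group G" "w \<in> H1 (BG G)"
  shows "Zt_system (BG G) (BG_system G w)" "twist (BG G) (BG_system G w) = w"
    "\<And>x. x \<in> topspace (BG G) \<Longrightarrow> BG_system G w (line_to_base G x) = 1"
proof -
  have "\<exists>!\<Lambda>. Zt_system (BG G) \<Lambda> \<and> twist (BG G) \<Lambda> = w \<and>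
    (\<forall>x\<in>topspace (BG G). \<Lambda> (line_to_base G x) = 1)"
    using normalised_system_exists[OF assms] normalised_system_unique[OF assms(1)] by (intro ex_ex1I) auto
  from theI'[OF this]
  show "Zt_system (BG G) (BG_system G w)" "twist (BG G) (BG_system G w) = w"
    "\<And>x. x \<in> topspace (BG G) \<Longrightarrow> BG_system G w (line_to_base G x) = 1"
    unfolding BG_system_def[symmetric] by auto
qed

section \<open>The map induced by an inner automorphism\<close>

lemma map_inner_aut_closed:
  assumes "group G" "h \<in> carrier G" "set gs \<subseteq> carrier G"
  shows "set (map (inner_aut G h) gs) \<subseteq> carrier G"
proof -
  interpret group G by fact
  show ?thesis using assms(2,3) by (auto simp: inner_aut_def)
qed

lemma topspace_map_inner_aut:
  assumes "group G" "h \<in> carrier G" "z \<in> topspace (pre_realization G)"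
  shows "(map (inner_aut G h) (fst z), snd z) \<in> topspace (pre_realization G)"
proof -
  have "set (fst z) \<subseteq> carrier G" "snd z \<in> standard_simplex (length (fst z))"
    using assms(3) by (auto simp: topspace_pre_realization)
  then show ?thesis
    using map_inner_aut_closed[OF assms(1,2)] by (simp add: topspace_pre_realization)
qed

lemma continuous_map_conj_cylinder_path:
  assumes G: "group G" "h \<in> carrier G" and L: "pathin (BG G) L"
  shows "continuous_map unit_square (BG G) (\<lambda>z. conj_cylinder G h (Cyl (L (snd z)) (fst z)))"
proof -
  have "continuous_map unit_square (BG G) (L \<circ> snd)"
    using continuous_map_compose[OF continuous_map_snd] L unfolding pathin_def by blast
  then have "continuous_map unit_square (prod_topology (BG G) unit_interval) (\<lambda>z. (L (snd z), fst z))"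
    by (intro continuous_map_pairedI continuous_map_fst) (simp add: o_def)
  then have "continuous_map unit_square (BG G)
      (conj_cylinder G h \<circ> ((\<lambda>(x, t). Cyl x t) \<circ> (\<lambda>z. (L (snd z), fst z))))"
    by (intro continuous_map_compose[OF _ continuous_map_conj_cylinder[OF G]]
        continuous_map_compose[OF _ quotient_imp_continuous_map[OF quotient_map_cylinder]])
  then show ?thesis by (simp add: o_def)
qed

lemma continuous_map_B_map_inner_aut:
  assumes G: "group G" "h \<in> carrier G"
  shows "continuous_map (BG G) (BG G) (B_map G G (inner_aut G h))"
proof -
  have "continuous_map (BG G) (prod_topology (BG G) unit_interval) (\<lambda>x. (x, 1))"
    by (intro continuous_map_pairedI continuous_map_id[unfolded id_def]) simp
  then have "continuous_map (BG G) (BG G) (conj_cylinder G h \<circ> ((\<lambda>(x, t). Cyl x t) \<circ> (\<lambda>x. (x, 1))))"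
    by (intro continuous_map_compose[OF _ continuous_map_conj_cylinder[OF G]]
        continuous_map_compose[OF _ quotient_imp_continuous_map[OF quotient_map_cylinder]])
  then show ?thesis
    by (rule continuous_map_eq) (use homotopy_conj_cylinder[OF G] in \<open>auto simp: homotopy_from_to_def\<close>)
qed

lemma B_map_inner_aut_inverse:
  assumes G: "group G" "h \<in> carrier G" and x: "x \<in> topspace (BG G)"
  shows "B_map G G (inner_aut G (inv\<^bsub>G\<^esub> h)) (B_map G G (inner_aut G h) x) = x"
proof -
  interpret group G by fact
  obtain z where z: "z \<in> topspace (pre_realization G)" "x = BG_point G z"
    using x by (auto simp: topspace_BG)
  have i: "inv\<^bsub>G\<^esub> h \<in> carrier G" using G(2) by simp
  have "inner_aut G (inv\<^bsub>G\<^esub> h) (inner_aut G h y) = y" if "y \<in> carrier G" for y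
  proof -
    have "inner_aut G (inv\<^bsub>G\<^esub> h) (inner_aut G h y)
        = (h \<otimes>\<^bsub>G\<^esub> inv\<^bsub>G\<^esub> h) \<otimes>\<^bsub>G\<^esub> (y \<otimes>\<^bsub>G\<^esub> (h \<otimes>\<^bsub>G\<^esub> inv\<^bsub>G\<^esub> h))"
      using that G(2) unfolding inner_aut_def by (simp only: m_assoc m_closed inv_closed inv_inv)
    then show ?thesis using that G(2) by simp
  qed
  moreover have "set (fst z) \<subseteq> carrier G" using z(1) by (auto simp: topspace_pre_realization)
  ultimately have "map (inner_aut G (inv\<^bsub>G\<^esub> h)) (map (inner_aut G h) (fst z)) = fst z"
    by (auto intro!: map_idI)
  then show ?thesis
    unfolding z(2) B_map_inner_aut[OF G z(1)]
      B_map_inner_aut[OF G(1) i topspace_map_inner_aut[OF G z(1)]] by simp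
qed

lemma induces_pi1_iso_B_map_inner_aut:
  assumes G: "group G" "h \<in> carrier G"
  shows "induces_pi1_iso (BG G) (BG G) (B_map G G (inner_aut G h))"
proof -
  interpret group G by fact
  have i: "inv\<^bsub>G\<^esub> h \<in> carrier G" using G(2) by simp
  show ?thesis
    by (rule homeomorphism_induces_pi1_iso[OF continuous_map_B_map_inner_aut[OF G]
          continuous_map_B_map_inner_aut[OF G(1) i] B_map_inner_aut_inverse[OF G]])
       (use B_map_inner_aut_inverse[OF G(1) i] G(2) in auto)
qed

lemma cohomology_pullback_B_map_inner_aut:
  assumes G: "group G" "h \<in> carrier G" and w: "w \<in> H1 (BG G)"
  shows "cohomology_pullback 1 (BG G) (B_map G G (inner_aut G h)) w = w"
proof (rule cohomology_pullback_id[OF path_connected_BG continuous_map_B_map_inner_aut[OF G] w])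
  fix c L assume c: "c \<in> cocycles 1 (BG G)" and L: "pathin (BG G) L" "L 0 = L 1"
  let ?H = "\<lambda>z. conj_cylinder G h (Cyl (L (snd z)) (fst z))"
  have H: "continuous_map unit_square (BG G) ?H"
    by (rule continuous_map_conj_cylinder_path[OF G L(1)])
  have "path_simplex (\<lambda>t. ?H (0, t)) = path_simplex L"
    "path_simplex (\<lambda>t. ?H (1, t)) = path_simplex (B_map G G (inner_aut G h) \<circ> L)"
    by (rule path_simplex_cong,
        use homotopy_conj_cylinder[OF G] pathin_in_topspace[OF L(1)] in \<open>auto simp: homotopy_from_to_def\<close>)+
  moreover have "path_simplex (\<lambda>t. ?H (t, 0)) = path_simplex (\<lambda>t. ?H (t, 1))"
    using L(2) by simp
  ultimately show "c (path_simplex (B_map G G (inner_aut G h) \<circ> L)) = c (path_simplex L)"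
    using cocycle_square[OF c H] cochain_1_value[OF cocycle_imp_cochain[OF c] pathin_square_edge(2)[OF H, of 1]]
    by auto
qed

text \<open>\<open>Bc\<^sub>h\<close> is simplicial and preserves the coordinates, so it maps lines to lines.\<close>

lemma line_to_base_B_map_inner_aut:
  assumes G: "group G" "h \<in> carrier G" and z: "z \<in> topspace (pre_realization G)"
  shows "path_class (BG G) (B_map G G (inner_aut G h) \<circ> vertex_line G z)
    = line_to_base G (B_map G G (inner_aut G h) (BG_point G z))"
proof -
  let ?w = "(map (inner_aut G h) (fst z), snd z)"
  have w: "?w \<in> topspace (pre_realization G)" by (rule topspace_map_inner_aut[OF G z])
  have "path_class (BG G) (vertex_line G ?w) = path_class (BG G) (B_map G G (inner_aut G h) \<circ> vertex_line G z)"
  proof (rule path_class_cong[OF pathin_vertex_line[OF w]])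
    fix s :: real assume s: "s \<in> {0..1}"
    have "(fst z, line_weights (snd z) s) \<in> topspace (pre_realization G)"
      using z s by (auto simp: topspace_pre_realization intro!: line_weights_in_simplex)
    then show "vertex_line G ?w s = (B_map G G (inner_aut G h) \<circ> vertex_line G z) s"
      using B_map_inner_aut[OF G] by (simp add: vertex_line_def)
  qed
  then show ?thesis
    using line_to_base_eq[OF G(1) w] B_map_inner_aut[OF G z] by simp
qed

section \<open>Homotopy functors\<close>

lemma cylinder_point: "x \<in> topspace X \<Longrightarrow> s \<in> {0..1} \<Longrightarrow> Cyl x s \<in> topspace (cylinder X)"
  by (auto simp: topspace_cylinder)

lemma subcategory_Zt_Top:
  assumes "subcategory T Zt_Top"
  shows "Dom T = src" "Cod T = tgt" "Ident T A = zarrow A A (id_fn (fst A)) (one_map (fst A))"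
    "Comp T b a = zarrow (src a) (tgt b) (compose (topspace (fst (src a))) (fn b) (fn a))
       (\<lambda>x\<in>topspace (fst (src a)). sgm b (fn a x) * sgm a x)"
  using assms by (simp_all add: subcategory_def Zt_Top_def)

lemma subcategory_closed:
  assumes "subcategory T Zt_Top"
  shows "A \<in> Obj T \<Longrightarrow> Ident T A \<in> Arr T"
    "a \<in> Arr T \<Longrightarrow> b \<in> Arr T \<Longrightarrow> src b = tgt a \<Longrightarrow> Comp T b a \<in> Arr T"
proof -
  show "A \<in> Obj T \<Longrightarrow> Ident T A \<in> Arr T"
    using assms unfolding subcategory_def by blast
  have "\<forall>a\<in>Arr T. \<forall>b\<in>Arr T. Dom T b = Cod T a \<longrightarrow> Comp T b a \<in> Arr T"
    using assms unfolding subcategory_def by blast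
  then show "a \<in> Arr T \<Longrightarrow> b \<in> Arr T \<Longrightarrow> src b = tgt a \<Longrightarrow> Comp T b a \<in> Arr T"
    using subcategory_Zt_Top(1,2)[OF assms] by simp
qed

lemma category_laws:
  assumes "is_category D"
  shows "f \<in> Homs D a b \<Longrightarrow> Comp D (Ident D b) f = f"
    "f \<in> Homs D a b \<Longrightarrow> Comp D f (Ident D a) = f"
    "f \<in> Homs D a b \<Longrightarrow> g \<in> Homs D b c \<Longrightarrow> h \<in> Homs D c d \<Longrightarrow>
      Comp D h (Comp D g f) = Comp D (Comp D h g) f"
  using assms by (auto simp: is_category_def Homs_def)

lemma arrow_Zt_Top:
  assumes "subcategory T Zt_Top" "zarrow A B f \<zeta> \<in> Arr T"
  shows "continuous_map (fst A) (fst B) f" "f \<in> extensional (topspace (fst A))"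
    "system_map (fst A) (snd A) (sys_pullback (fst A) (fst B) f (snd B)) \<zeta>"
  using assms by (auto simp: subcategory_def Zt_Top_def)

text \<open>The identity \<open>r \<circ> \<iota>\<^sub>i = 1\<close>, as morphisms of spaces with systems.\<close>

lemma proj_incl:
  assumes "subcategory T Zt_Top" "i \<in> {0..1}"
  shows "Comp T (proj_arr A) (incl_arr A i) = Ident T A"
proof -
  obtain X \<Lambda> where "A = (X, \<Lambda>)" by (cases A)
  then show ?thesis
    using assms(2)
    by (auto simp: subcategory_Zt_Top[OF assms(1)] proj_arr_def incl_arr_def compose_def cyl_incl_def
        cyl_proj_def one_map_def cylinder_point intro!: restrict_ext)
qed

text \<open>Since \<open>\<Omega>(r, 1)\<close> is a two-sided inverse of \<open>\<Omega>(\<iota>\<^sub>0, 1)\<close> and a left inverse of \<open>\<Omega>(\<iota>\<^sub>1, 1)\<close>, the two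
  inclusions have the same image.\<close>

lemma homotopy_functor_incl:
  assumes hf: "homotopy_functor T D \<Omega>o \<Omega>m" and A: "A \<in> Obj T"
  shows "\<Omega>m (incl_arr A 0) = \<Omega>m (incl_arr A 1)"
proof -
  have hh: "has_homotopies T" and fu: "is_functor T D \<Omega>o \<Omega>m"
    and r: "proj_arr A \<in> Arr T"
      "Comp D (\<Omega>m (incl_arr A 0)) (\<Omega>m (proj_arr A)) = Ident D (\<Omega>o (cyl_obj A))"
    using hf A by (auto simp: homotopy_functor_def)
  have sc: "subcategory T Zt_Top" and incl: "incl_arr A 0 \<in> Arr T" "incl_arr A 1 \<in> Arr T"
    using hh A by (auto simp: has_homotopies_def)
  note T = subcategory_Zt_Top[OF sc]
  have D: "is_category D" using fu by (simp add: is_functor_def)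
  have hom: "\<Omega>m f \<in> Homs D (\<Omega>o (src f)) (\<Omega>o (tgt f))" if "f \<in> Arr T" for f
    using fu that T(1,2) by (simp add: is_functor_def)
  have comp: "\<Omega>m (Comp T g f) = Comp D (\<Omega>m g) (\<Omega>m f)" if "f \<in> Arr T" "g \<in> Arr T" "src g = tgt f" for f g
    using fu that T(1,2) by (simp add: is_functor_def)
  have i: "\<Omega>m (incl_arr A k) \<in> Homs D (\<Omega>o A) (\<Omega>o (cyl_obj A))" if "incl_arr A k \<in> Arr T" for k
    using hom[OF that] by (simp add: incl_arr_def)
  have p: "\<Omega>m (proj_arr A) \<in> Homs D (\<Omega>o (cyl_obj A)) (\<Omega>o A)"
    using hom[OF r(1)] by (simp add: proj_arr_def)
  have pi: "Comp D (\<Omega>m (proj_arr A)) (\<Omega>m (incl_arr A 1)) = Ident D (\<Omega>o A)"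
    using comp[OF incl(2) r(1)] proj_incl[OF sc, of 1 A] fu A
    by (simp add: proj_arr_def incl_arr_def is_functor_def)
  have "\<Omega>m (incl_arr A 1) = Comp D (Ident D (\<Omega>o (cyl_obj A))) (\<Omega>m (incl_arr A 1))"
    using category_laws(1)[OF D i[OF incl(2)]] by simp
  also have "\<dots> = Comp D (Comp D (\<Omega>m (incl_arr A 0)) (\<Omega>m (proj_arr A))) (\<Omega>m (incl_arr A 1))"
    by (simp add: r(2))
  also have "\<dots> = Comp D (\<Omega>m (incl_arr A 0)) (Comp D (\<Omega>m (proj_arr A)) (\<Omega>m (incl_arr A 1)))"
    using category_laws(3)[OF D i[OF incl(2)] p i[OF incl(1)]] by simp
  also have "\<dots> = \<Omega>m (incl_arr A 0)"
    using category_laws(2)[OF D i[OF incl(1)]] by (simp add: pi)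
  finally show ?thesis by simp
qed

section \<open>The effect of an inner automorphism\<close>

text \<open>The closure property applied to \<open>K = BG\<close> and \<open>u = Bc\<^sub>h\<close>: since \<open>u\<^sup>*\<close> is the identity on \<open>H\<^sup>1\<close>, the target
  is again \<open>(BG, \<Lambda>\<^sub>\<omega>)\<close>.\<close>

lemma pi1_closed_B_map_inner_aut:
  fixes G :: "'a point monoid"
  assumes cl: "pi1_closed T" and G: "group G" "h \<in> carrier G" and w: "w \<in> H1 (BG G)"
    and A: "BG_obj G w \<in> Obj T"
  shows "\<exists>\<zeta>. zarrow (BG_obj G w) (BG_obj G w) (B_map G G (inner_aut G h)) \<zeta> \<in> Arr T"
proof -
  let ?b = "B_map G G (inner_aut G h)"
  note pull = cohomology_pullback_B_map_inner_aut[OF G]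
  have "inv_into (H1 (BG G)) (cohomology_pullback 1 (BG G) ?b) w = w"
    by (rule inv_into_f_eq) (use pull w in \<open>auto intro!: inj_onI\<close>)
  then have "inv_into (H1 (BG G)) (cohomology_pullback 1 (BG G) ?b) (twist (BG G) (BG_system G w)) = w"
    using BG_system(2)[OF G(1) w] by simp
  moreover have "topspace (BG G) \<noteq> {}" using BG_base_in_topspace by blast
  moreover have "?b \<in> extensional (topspace (BG G))" by (simp add: B_map_def)
  moreover have "\<forall>K \<Lambda>. \<forall>P :: 'a point monoid. \<forall>u. (K, \<Lambda>) \<in> Obj T \<longrightarrow> path_connected_space K \<longrightarrow>
      topspace K \<noteq> {} \<longrightarrow> group P \<longrightarrow> continuous_map K (BG P) u \<longrightarrow> u \<in> extensional (topspace K) \<longrightarrow>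
      induces_pi1_iso K (BG P) u \<longrightarrow>
      (\<exists>\<zeta>. zarrow (K, \<Lambda>)
        (BG_obj P (inv_into (H1 (BG P)) (cohomology_pullback 1 K u) (twist K \<Lambda>))) u \<zeta> \<in> Arr T)"
    using cl unfolding pi1_closed_def Let_def by blast
  note this[rule_format, OF A[unfolded BG_obj_def] path_connected_BG _ G(1)
      continuous_map_B_map_inner_aut[OF G] _ induces_pi1_iso_B_map_inner_aut[OF G]]
  ultimately show ?thesis by (simp add: BG_obj_def)
qed

text \<open>If the homotopy is lifted to a morphism that starts at the identity, then its other end has the
  constant sign \<open>\<omega>(h)\<close>.\<close>

lemma conj_cylinder_end:
  fixes G :: "'a point monoid"
  assumes sc: "subcategory T Zt_Top" and G: "group G" "h \<in> carrier G" and w: "w \<in> H1 (BG G)"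
    and F: "zarrow (cyl_obj (BG_obj G w)) (BG_obj G w) (conj_cylinder G h) \<zeta> \<in> Arr T"
    and F0: "Comp T (zarrow (cyl_obj (BG_obj G w)) (BG_obj G w) (conj_cylinder G h) \<zeta>)
      (incl_arr (BG_obj G w) 0) = Ident T (BG_obj G w)"
    and F1: "Comp T (zarrow (cyl_obj (BG_obj G w)) (BG_obj G w) (conj_cylinder G h) \<zeta>)
      (incl_arr (BG_obj G w) 1) \<in> Arr T"
  shows "Comp T (zarrow (cyl_obj (BG_obj G w)) (BG_obj G w) (conj_cylinder G h) \<zeta>)
      (incl_arr (BG_obj G w) 1)
    = zarrow (BG_obj G w) (BG_obj G w) (B_map G G (inner_aut G h))
        (\<lambda>x\<in>topspace (BG G). value_on G w h)"
proof -
  let ?X = "BG G" and ?L = "BG_system G w" and ?C = "cylinder (BG G)" and ?b = "B_map G G (inner_aut G h)"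
    and ?F = "conj_cylinder G h" and ?x0 = "BG_base G"
  note S = BG_system[OF G(1) w] and T = subcategory_Zt_Top[OF sc] and H = homotopy_conj_cylinder[OF G]
  have x0: "?x0 \<in> topspace ?X" by (rule BG_base_in_topspace)
  define \<phi> where "\<phi> = (\<lambda>x\<in>topspace ?X. \<zeta> (Cyl x 1))"
  have "compose (topspace ?X) ?F (cyl_incl ?X 1) = ?b"
  proof (rule extensionalityI[of _ "topspace ?X"])
    show "?b \<in> extensional (topspace ?X)" by (simp add: B_map_def)
    show "compose (topspace ?X) ?F (cyl_incl ?X 1) x = ?b x" if "x \<in> topspace ?X" for x
      using H that by (simp add: compose_def cyl_incl_def homotopy_from_to_def)
  qed simp
  then have end_eq: "Comp T (zarrow (cyl_obj (BG_obj G w)) (BG_obj G w) ?F \<zeta>) (incl_arr (BG_obj G w) 1)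
      = zarrow (BG_obj G w) (BG_obj G w) ?b \<phi>"
    by (auto simp: T incl_arr_def BG_obj_def one_map_def cyl_incl_def \<phi>_def intro!: restrict_ext)
  have "sgm (Comp T (zarrow (cyl_obj (BG_obj G w)) (BG_obj G w) ?F \<zeta>) (incl_arr (BG_obj G w) 0)) ?x0 = 1"
    unfolding F0 using x0 by (simp add: T BG_obj_def one_map_def)
  then have z0: "\<zeta> (Cyl ?x0 0) = 1"
    using x0 by (simp add: T incl_arr_def BG_obj_def one_map_def cyl_incl_def)

  \<comment> \<open>Along the cylinder over the base point, the homotopy runs once around the loop \<open>h\<close>.\<close>
  let ?p = "\<lambda>s. Cyl ?x0 s"
  have "continuous_map unit_interval (prod_topology ?X unit_interval) (\<lambda>s. (?x0, s))"
    using x0 by (intro continuous_map_pairedI) (auto simp: continuous_map_id[unfolded id_def])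
  then have p: "pathin ?C ?p"
    unfolding pathin_def
    using continuous_map_compose[OF _ quotient_imp_continuous_map[OF quotient_map_cylinder]]
    by (force simp: o_def)
  have cF: "continuous_map ?C ?X ?F"
    by (rule continuous_map_conj_cylinder[OF G])
  have cr: "continuous_map ?C ?X (cyl_proj ?X)"
  proof (rule continuous_compose_quotient_map[OF quotient_map_cylinder])
    show "continuous_map (prod_topology ?X unit_interval) ?X (cyl_proj ?X \<circ> (\<lambda>(x, t). Cyl x t))"
      by (rule continuous_map_eq[OF continuous_map_fst]) (auto simp: cyl_proj_def cylinder_point)
  qed
  let ?loop = "\<lambda>s. BG_point G ([h], \<lambda>i. if i = 0 then 1 - s else if i = 1 then s else 0)"
  have Fp: "?F (?p s) = ?loop s" if "s \<in> {0..1}" for s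
    using that conj_cylinder_apply[OF G base_in_pre_realization that] conj_homotopy_base[OF G] by simp
  have "path_class ?X (?F \<circ> ?p) = path_class ?X ?loop"
    by (rule path_class_cong[OF pathin_compose[OF p cF]]) (simp add: Fp)
  moreover have loop: "pathin ?X ?loop"
    using pathin_compose[OF p cF] unfolding pathin_def
    by (rule continuous_map_eq) (simp add: Fp)
  moreover have "?loop 0 = ?loop 1"
  proof -
    have "?loop 0 = ?x0"
      using Fp[of 0] H x0 by (simp add: homotopy_from_to_def)
    moreover have "?loop 1 = ?x0"
      using Fp[of 1] H x0 B_map_inner_aut[OF G base_in_pre_realization] by (simp add: homotopy_from_to_def)
    ultimately show ?thesis by simp
  qed
  ultimately have val: "?L (path_class ?X (?F \<circ> ?p)) = value_on G w h"
    using twist_loop_value[OF path_connected_BG S(1) loop] S(2) by (simp add: value_on_def)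
  have "path_class ?X (cyl_proj ?X \<circ> ?p) = line_to_base G ?x0"
  proof -
    have "path_class ?X (\<lambda>_. ?x0) = path_class ?X (cyl_proj ?X \<circ> ?p)"
      by (rule path_class_cong) (use x0 in \<open>auto simp: cyl_proj_def cylinder_point\<close>)
    then show ?thesis
      using base_line(4)[OF G(1) x0] base_line_base[of G] by simp
  qed
  then have const: "?L (path_class ?X (cyl_proj ?X \<circ> ?p)) = 1" using S(3)[OF x0] by simp
  have "system_map ?C (sys_pullback ?C ?X (cyl_proj ?X) ?L) (sys_pullback ?C ?X ?F ?L) \<zeta>"
    using arrow_Zt_Top(3)[OF sc F] by (simp add: BG_obj_def)
  then have "?L (path_class ?X (cyl_proj ?X \<circ> ?p)) * ?L (path_class ?X (?F \<circ> ?p)) = \<zeta> (?p 0) * \<zeta> (?p 1)"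
    using p by (simp add: system_map_def sys_pullback_def class_map_path_class[OF p cF, symmetric]
        class_map_path_class[OF p cr, symmetric])
  then have \<phi>0: "\<phi> ?x0 = value_on G w h"
    using val const z0 x0 by (simp add: \<phi>_def)

  \<comment> \<open>Both systems are trivial on the lines to the base point, so \<open>\<phi>\<close> is constant.\<close>
  have \<phi>: "system_map ?X ?L (sys_pullback ?X ?X ?b ?L) \<phi>"
    using arrow_Zt_Top(3)[OF sc F1[unfolded end_eq]] by (simp add: BG_obj_def)
  have "\<phi> x = value_on G w h" if x: "x \<in> topspace ?X" for x
  proof -
    obtain z where z: "z \<in> topspace (pre_realization G)" "x = BG_point G z"
      using x by (auto simp: topspace_BG)
    note l = pathin_vertex_line[OF z(1)] and cb = continuous_map_B_map_inner_aut[OF G]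
    have bx: "?b x \<in> topspace ?X" using cb x by (auto simp: continuous_map_def)
    have "?L (path_class ?X (vertex_line G z)) * ?L (path_class ?X (?b \<circ> vertex_line G z)) = \<phi> x * \<phi> ?x0"
      using \<phi> l by (simp add: system_map_def sys_pullback_def class_map_path_class[OF l cb, symmetric]
          vertex_line_0 vertex_line_1[OF z(1)] z(2))
    moreover have "?L (path_class ?X (vertex_line G z)) = 1"
      using S(3)[OF x] line_to_base_eq[OF G(1) z(1)] z(2) by simp
    moreover have "?L (path_class ?X (?b \<circ> vertex_line G z)) = 1"
      using S(3)[OF bx] line_to_base_B_map_inner_aut[OF G z(1)] z(2) by simp
    ultimately have "\<phi> x * \<phi> ?x0 = 1" by simp
    moreover have "\<phi> ?x0 = 1 \<or> \<phi> ?x0 = -1"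
      using \<phi> x0 by (auto simp: system_map_def PiE_iff)
    ultimately show ?thesis using \<phi>0 by auto
  qed
  then have "\<phi> = (\<lambda>x\<in>topspace ?X. value_on G w h)"
    by (intro extensionalityI[of _ "topspace ?X"]) (auto simp: \<phi>_def)
  then show ?thesis using end_eq by simp
qed

lemma surgery_theory_inner_aut:
  fixes G :: "'a point monoid"
  assumes st: "surgery_theory T D \<Omega>o \<Omega>m" and G: "group G" "h \<in> carrier G" and w: "w \<in> H1 (BG G)"
    and A: "BG_obj G w \<in> Obj T"
  defines "a \<equiv> zarrow (BG_obj G w) (BG_obj G w) (B_map G G (inner_aut G h))
      (\<lambda>x\<in>topspace (BG G). value_on G w h)"
  shows "a \<in> Arr T" "\<Omega>m a = Ident D (\<Omega>o (BG_obj G w))"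
proof -
  let ?A = "BG_obj G w" and ?F = "conj_cylinder G h"
  have hf: "homotopy_functor T D \<Omega>o \<Omega>m" and cl: "pi1_closed T"
    using st by (auto simp: surgery_theory_def)
  then have hh: "has_homotopies T" and fu: "is_functor T D \<Omega>o \<Omega>m"
    by (auto simp: homotopy_functor_def)
  then have sc: "subcategory T Zt_Top" and incl: "incl_arr ?A 0 \<in> Arr T" "incl_arr ?A 1 \<in> Arr T"
    using A by (auto simp: has_homotopies_def)
  note T = subcategory_Zt_Top[OF sc]
  have idA: "Ident T ?A \<in> Arr T" by (rule subcategory_closed(1)[OF sc A])
  have id_eq: "Ident T ?A = zarrow ?A ?A (id_fn (BG G)) (one_map (BG G))"
    by (simp add: T BG_obj_def)
  obtain \<zeta>1 where \<zeta>1: "zarrow ?A ?A (B_map G G (inner_aut G h)) \<zeta>1 \<in> Arr T"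
    using pi1_closed_B_map_inner_aut[OF cl G w A] by blast
  have "homotopy_from_to (fst ?A) (fst ?A) ?F (id_fn (BG G)) (B_map G G (inner_aut G h))"
    using homotopy_conj_cylinder[OF G] by (simp add: BG_obj_def)
  then obtain \<zeta> where F: "zarrow (cyl_obj ?A) ?A ?F \<zeta> \<in> Arr T"
    and F0: "Comp T (zarrow (cyl_obj ?A) ?A ?F \<zeta>) (incl_arr ?A 0) = Ident T ?A"
  proof -
    have "\<forall>A B f0 \<zeta>0 f1 \<zeta>1 F. zarrow A B f0 \<zeta>0 \<in> Arr T \<longrightarrow> zarrow A B f1 \<zeta>1 \<in> Arr T \<longrightarrow>
        homotopy_from_to (fst A) (fst B) F f0 f1 \<longrightarrow>
        (\<exists>\<zeta>F. zarrow (cyl_obj A) B F \<zeta>F \<in> Arr T \<and>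
              Comp T (zarrow (cyl_obj A) B F \<zeta>F) (incl_arr A 0) = zarrow A B f0 \<zeta>0)"
      using hh by (simp add: has_homotopies_def)
    from this[rule_format, OF idA[unfolded id_eq] \<zeta>1 \<open>homotopy_from_to _ _ _ _ _\<close>]
    show thesis using that unfolding id_eq by blast
  qed
  have src: "src (zarrow (cyl_obj ?A) ?A ?F \<zeta>) = tgt (incl_arr ?A k)" for k
    by (simp add: incl_arr_def)
  have F1: "Comp T (zarrow (cyl_obj ?A) ?A ?F \<zeta>) (incl_arr ?A 1) \<in> Arr T"
    by (rule subcategory_closed(2)[OF sc incl(2) F src])
  have a: "a = Comp T (zarrow (cyl_obj ?A) ?A ?F \<zeta>) (incl_arr ?A 1)"
    unfolding a_def by (rule conj_cylinder_end[OF sc G w F F0 F1, symmetric])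
  then show "a \<in> Arr T" using F1 by simp
  have comp: "\<Omega>m (Comp T (zarrow (cyl_obj ?A) ?A ?F \<zeta>) (incl_arr ?A k))
      = Comp D (\<Omega>m (zarrow (cyl_obj ?A) ?A ?F \<zeta>)) (\<Omega>m (incl_arr ?A k))" if "incl_arr ?A k \<in> Arr T" for k
    using fu F that src[of k] T(1,2) by (simp add: is_functor_def)
  have "\<Omega>m a = \<Omega>m (Ident T ?A)"
    unfolding a comp[OF incl(2)] F0[symmetric] comp[OF incl(1)] homotopy_functor_incl[OF hf A] ..
  then show "\<Omega>m a = Ident D (\<Omega>o ?A)"
    using fu A by (simp add: is_functor_def)
qed

theorem theorem8p3:
  fixes T :: "('a obj, 'a arr) category"
    and D :: "('o, 'm) category"
    and \<Omega>o :: "'a obj \<Rightarrow> 'o" and \<Omega>m :: "'a arr \<Rightarrow> 'm"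
    and G :: "'a point monoid" and \<omega> :: "'a point cochain set" and g :: "'a point"
  defines "c \<equiv> inner_aut G g"
    and "minus_one \<equiv>
      zarrow (BG_obj G \<omega>) (BG_obj G \<omega>) (id_fn (BG G)) (neg_map (BG G) (one_map (BG G)))"
  assumes "surgery_theory T D \<Omega>o \<Omega>m"
    and "group G" and "\<omega> \<in> H1 (BG G)" and "BG_obj G \<omega> \<in> Obj T" and "g \<in> carrier G"
  shows
    "(value_on G \<omega> g = 1 \<longrightarrow>
        B_arr G G c \<omega> \<in> Arr T \<and>
        \<Omega>m (B_arr G G c \<omega>) = Ident D (\<Omega>o (BG_obj G \<omega>))) \<and>
     (value_on G \<omega> g = -1 \<longrightarrow> B_arr G G c \<omega> \<in> Arr T \<or> minus_one \<in> Arr T \<longrightarrow>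
        B_arr G G c \<omega> \<in> Arr T \<and> minus_one \<in> Arr T \<and>
        \<Omega>m (B_arr G G c \<omega>) = \<Omega>m minus_one \<and>
        (\<forall>H. additive_category D H \<longrightarrow> preserves_involution T D H \<Omega>m \<longrightarrow>
           \<Omega>m (B_arr G G c \<omega>) = minus_arr D H (Ident D (\<Omega>o (BG_obj G \<omega>)))))"
proof -
  let ?A = "BG_obj G \<omega>" and ?X = "BG G" and ?b = "B_map G G c"
  let ?n = "neg_map ?X (one_map ?X)"
  have hh: "has_homotopies T" and fu: "is_functor T D \<Omega>o \<Omega>m"
    using assms(3) by (auto simp: surgery_theory_def homotopy_functor_def)
  have sc: "subcategory T Zt_Top" using hh by (simp add: has_homotopies_def)
  note T = subcategory_Zt_Top[OF sc]
  have B: "B_arr G G c \<omega> = zarrow ?A ?A ?b (one_map ?X)"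
    using cohomology_pullback_B_map_inner_aut[OF assms(4,7,5)] by (simp add: B_arr_def c_def)
  note a = surgery_theory_inner_aut[OF assms(3,4,7,5,6), folded c_def]
  have pos: "B_arr G G c \<omega> \<in> Arr T \<and> \<Omega>m (B_arr G G c \<omega>) = Ident D (\<Omega>o ?A)"
    if "value_on G \<omega> g = 1"
    using a that by (simp add: B one_map_def)
  have neg: "B_arr G G c \<omega> \<in> Arr T \<and> minus_one \<in> Arr T \<and> \<Omega>m (B_arr G G c \<omega>) = \<Omega>m minus_one \<and>
      (\<forall>H. additive_category D H \<longrightarrow> preserves_involution T D H \<Omega>m \<longrightarrow>
         \<Omega>m (B_arr G G c \<omega>) = minus_arr D H (Ident D (\<Omega>o ?A)))"
    if v: "value_on G \<omega> g = -1" and or: "B_arr G G c \<omega> \<in> Arr T \<or> minus_one \<in> Arr T"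
  proof -
    have "(\<lambda>x\<in>topspace ?X. value_on G \<omega> g) = ?n"
      by (auto simp: v neg_map_def one_map_def intro!: restrict_ext)
    then have b: "zarrow ?A ?A ?b ?n \<in> Arr T" "\<Omega>m (zarrow ?A ?A ?b ?n) = Ident D (\<Omega>o ?A)"
      using a by simp_all
    have "compose (topspace ?X) ?b (id_fn ?X) = ?b"
      by (rule extensionalityI[of _ "topspace ?X"]) (auto simp: compose_def B_map_def)
    then have comp: "Comp T (zarrow ?A ?A ?b ?n) minus_one = B_arr G G c \<omega>"
      unfolding B minus_one_def T
      by (auto simp: BG_obj_def neg_map_def one_map_def intro!: restrict_ext)
    \<comment> \<open>If \<open>(Bc\<^sub>g, 1)\<close> is a morphism, it differs from \<open>(Bc\<^sub>g, -1)\<close> by the sign \<open>-1\<close>; so \<open>(1, -1)\<close> is one too.\<close>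
    have m: "minus_one \<in> Arr T"
    proof (rule ccontr)
      assume n: "minus_one \<notin> Arr T"
      then have B1: "zarrow ?A ?A ?b (one_map ?X) \<in> Arr T" using or B by simp
      have n0: "?n \<in> H0 ?X"
        using path_start_in_topspace path_finish_in_topspace
        by (fastforce simp: H0_def neg_map_def one_map_def)
      have act: "H0_act ?X ?n (one_map ?X) = ?n"
        by (auto simp: H0_act_def neg_map_def one_map_def intro!: restrict_ext)
      have fst: "fst ?A = ?X" by (simp add: BG_obj_def)
      have "\<forall>A B f \<zeta>0 \<zeta>1 c. zarrow A B f \<zeta>0 \<in> Arr T \<longrightarrow> zarrow A B f \<zeta>1 \<in> Arr T \<longrightarrow>
          c \<in> H0 (fst A) \<longrightarrow> \<zeta>0 = H0_act (fst A) c \<zeta>1 \<longrightarrow>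
          zarrow A A (id_fn (fst A)) (H0_act (fst A) c (one_map (fst A))) \<in> Arr T"
        using hh by (simp add: has_homotopies_def)
      from this[rule_format, OF b(1) B1, of ?n]
      have "zarrow ?A ?A (id_fn (fst ?A)) (H0_act (fst ?A) ?n (one_map (fst ?A))) \<in> Arr T"
        using n0 act by (simp add: fst)
      then show False using n by (simp add: minus_one_def BG_obj_def act)
    qed
    have src: "src (zarrow ?A ?A ?b ?n) = tgt minus_one" by (simp add: minus_one_def)
    have BT: "B_arr G G c \<omega> \<in> Arr T"
      unfolding comp[symmetric] by (rule subcategory_closed(2)[OF sc m b(1) src])
    have "\<Omega>m (B_arr G G c \<omega>) = Comp D (Ident D (\<Omega>o ?A)) (\<Omega>m minus_one)"
      using fu b m src T(1,2) unfolding comp[symmetric] by (simp add: is_functor_def)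
    moreover have "\<Omega>m minus_one \<in> Homs D (\<Omega>o ?A) (\<Omega>o ?A)"
      using fu m T(1,2) by (auto simp: is_functor_def minus_one_def)
    ultimately have \<Omega>: "\<Omega>m (B_arr G G c \<omega>) = \<Omega>m minus_one"
      using fu category_laws(1)[of D] by (simp add: is_functor_def)
    have "\<Omega>m minus_one = minus_arr D H (Ident D (\<Omega>o ?A))" if "preserves_involution T D H \<Omega>m" for H
    proof -
      have inv: "involution (Ident T ?A) = minus_one"
        by (simp add: involution_def T minus_one_def BG_obj_def)
      have "Ident T ?A \<in> Arr T" by (rule subcategory_closed(1)[OF sc assms(6)])
      then have "\<Omega>m minus_one = minus_arr D H (\<Omega>m (Ident T ?A))"
        using that m inv unfolding preserves_involution_def by metis
      then show ?thesis using fu assms(6) by (simp add: is_functor_def)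
    qed
    then show ?thesis using BT m \<Omega> by simp
  qed
  show ?thesis using pos neg by blast
qed

end
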